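(* Let $f=\frac1n\sum_{i=1}^n f_i$ with $f_i(\mathbf x)=\mathbb E_{\boldsymbol\xi_i\sim\mathcal D_i}[F_i(\mathbf x;\boldsymbol\xi_i)]$ on $\mathbb R^d$, and suppose that (A1), (A2), (A3) and (A5) of the context hold. Run the algorithm DOC$^2$S with the first-order estimator and parameters $\delta'=\delta/2$, $K=\mathcal O(\delta^{-1}\epsilon^{-1})$, $T=\mathcal O(\epsilon^{-2})$, $R=\tilde{\mathcal O}(\gamma^{-1/2})$, $\eta=\mathcal O(\delta\epsilon^3)$, $D=\mathcal O(\delta\epsilon^2)$, chosen so that the output satisfies $\mathbb E[\|\nabla f(\mathbf w_i^{\rm out})\|_\delta]\le\epsilon$ for all $i\in[n]$ (such a choice can be made). Then each client can achieve a $(\delta,\epsilon)$-Goldstein stationary point of $f$ (in expectation, i.e. $\mathbb E[\|\nabla f(\mathbf w_i^{\rm out})\|_\delta]\le\epsilon$ for every $i\in[n]$) within - an overall (summed over all clients) stochastic first-order oracle complexity of $\mathcal O(\delta^{-1}\epsilon^{-3})$, - $\mathcal O(\delta^{-1}\epsilon^{-3})$ computation rounds, and - $\tilde{\mathcal O}(\gamma^{-1/2}\delta^{-1}\epsilon^{-3})$ communication rounds.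
   Context: Notation: $[n]=\{1,\dots,n\}$; $\|\cdot\|$ is the Euclidean norm; $\mathbb B^d(\mathbf x,r)$ is the Euclidean ball of radius $r$ centered at $\mathbf x$; $\mathrm{Unif}(S)$ is the uniform distribution on $S$; $\delta,\epsilon>0$ are the target accuracies. $\mathbb E$ is the expectation over all randomness of the algorithm. $\mathcal O$ is the usual order notation and $\tilde{\mathcal O}$ additionally hides logarithmic factors. Assumptions. (A1) For each $i\in[n]$ and $\boldsymbol\xi_i\in\Xi_i$, $|F_i(\mathbf x;\boldsymbol\xi_i)-F_i(\mathbf y;\boldsymbol\xi_i)|\le L(\boldsymbol\xi_i)\|\mathbf x-\mathbf y\|$ for all $\mathbf x,\mathbf y\in\mathbb R^d$, and $\mathbb E_{\boldsymbol\xi_i}[L(\boldsymbol\xi_i)^2]\le L^2$ for some $L>0$. (A2) $f^*=\inf_{\mathbf x\in\mathbb R^d} f(\mathbf x)>-\infty$. (A3) For each $i$ and $\mathbf x$: $\mathbb E[\nabla F_i(\mathbf x;\boldsymbol\xi_i)]=\nabla f_i(\mathbf x)$, $\mathbb E[\|\nabla F_i(\mathbf x;\boldsymbol\xi_i)-\nabla f_i(\mathbf x)\|^2]\le\sigma^2$, and $\mathbb E[\|\nabla F_i(\mathbf x;\boldsymbol\xi_i)\|^2]\le G^2$, with $\boldsymbol\xi_i\sim\mathcal D_i$ and some $\sigma,G\ge0$ (gradients of Lipschitz functions exist almost everywhere, by Rademacher's theorem, and the oracle is understood in this sense). (A5) $\mathbf P=[p_{ij}]\in\mathbb R^{n\times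 n}$ is symmetric with $p_{ij}\ge0$; $p_{ij}\ne0$ iff clients $i,j$ are connected in the network or $i=j$; $\mathbf 0\preceq\mathbf P\preceq\mathbf I$ and $\mathbf P^\top\mathbf 1_n=\mathbf P\mathbf 1_n=\mathbf 1_n$, where $\mathbf 1_n$ is the all-ones vector. Its spectral gap is $\gamma=1-\lambda_2(\mathbf P)\in(0,1]$, with $\lambda_2(\mathbf P)$ the second largest eigenvalue. Goldstein stationarity. For Lipschitz $f$, the Clarke subdifferential is $\partial f(\mathbf x)=\mathrm{conv}\{\mathbf g:\mathbf g=\lim_{\mathbf x_k\to\mathbf x}\nabla f(\mathbf x_k)\}$, the Goldstein $\delta$-subdifferential is $\partial_\delta f(\mathbf x)=\mathrm{conv}\bigl(\bigcup_{\mathbf y\in\mathbb B^d(\mathbf x,\delta)}\partial f(\mathbf y)\bigr)$, and $\|\nabla f(\mathbf x)\|_\delta=\min\{\|\mathbf g\|:\mathbf g\in\partial_\delta f(\mathbf x)\}$. A point $\mathbf x$ is $(\delta,\epsilon)$-Goldstein stationary if $\|\nabla f(\mathbf x)\|_\delta\le\epsilon$. FastGossip$(\{\mathbf z_i^{(0)}\}_{i=1}^n,\mathbf P,R)$: set $\mathbf z_i^{(-1)}=\mathbf z_i^{(0)}$ and $\phi=\frac{1-\sqrt{1-\lambda_2(\mathbf P)^2}}{1+\sqrt{1-\lambda_2(\mathbf P)^2}}$; for $r=0,\dots,R-1$ and all $i$, $\mathbf z_i^{(r+1)}=(1+\phi)\sum_{j=1}^n p_{ij}\mathbf z_j^{(r)}-\phi\,\mathbf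 z_i^{(r-1)}$; return $\{\mathbf z_i^{(R)}\}_{i=1}^n$. First-order estimator at client $i$, point $\mathbf w$, parameter $\delta'$: draw $\boldsymbol\xi_i\sim\mathcal D_i$ and $\mathbf z_i\sim\mathrm{Unif}(\mathbb B^d(0,1))$, return $\nabla F_i(\mathbf w+\delta'\mathbf z_i;\boldsymbol\xi_i)$ (one stochastic first-order oracle call). Algorithm DOC$^2$S (inputs $\delta'\ge0$, $K,T,R\in\mathbb N$, $\eta,D>0$, $\mathbf P$). Set $\mathbf y_i^{0,T}=\mathbf 0$ for all $i$. For $k=1,\dots,K$: set $\boldsymbol\Delta_i^{k,1/2}=\mathbf 0$ and $\mathbf y_i^{k,0}=\mathbf y_i^{k-1,T}$ for all $i$. For $t=1,\dots,T$: (1) draw $i^t\sim\mathrm{Unif}([n])$; (2) for all $i$: $\mathbf x_i^{k,t}=\mathbf y_i^{k,t-1}+n\boldsymbol\Delta_i^{k,t-1/2}$ if $i=i^t$, and $\mathbf x_i^{k,t}=\mathbf y_i^{k,t-1}$ otherwise; draw $s_i^{k,t}\sim\mathrm{Unif}([0,1])$ and set $\mathbf w_i^{k,t}=\mathbf y_i^{k,t-1}+s_i^{k,t}\boldsymbol\Delta_i^{k,t-1/2}$; (3) $\{\mathbf y_i^{k,t}\}_i=\mathrm{FastGossip}(\{\mathbf x_i^{k,t}\}_i,\mathbf P,R)$; (4) $\mathbf g_{i^t}^{k,t}$ is the output of the estimator at client $i^t$, point $\mathbf w_{i^t}^{k,t}$, parameter $\delta'$; (5) $\boldsymbol\Delta_{i}^{k,t}=n\min\{1,D/\|\mathbf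 v\|\}\,\mathbf v$ with $\mathbf v=\boldsymbol\Delta_{i}^{k,t-1/2}-\eta\mathbf g_{i}^{k,t}$ if $i=i^t$ (read as $\mathbf 0$ if $\mathbf v=\mathbf 0$), and $\boldsymbol\Delta_i^{k,t}=\mathbf 0$ if $i\ne i^t$; (6) $\{\boldsymbol\Delta_i^{k,t+1/2}\}_i=\mathrm{FastGossip}(\{\boldsymbol\Delta_i^{k,t}\}_i,\mathbf P,R)$. Output: for each $i$, $\mathbf w_i^{\rm out}\sim\mathrm{Unif}(\{\hat{\mathbf w}_i^1,\dots,\hat{\mathbf w}_i^K\})$ with $\hat{\mathbf w}_i^k=\frac1T\sum_{t=1}^T\mathbf w_i^{k,t}$. Cost measures. A computation round is one iteration $(k,t)$ (in which the sampled client makes its oracle call); a communication round is one exchange with neighbours, i.e. one step $r$ inside FastGossip. *)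

theory Defs
  imports "HOL-Probability.Probability" "Jordan_Normal_Form.Char_Poly"
begin

text \<open>
  \<open>\<real>\<^sup>d\<close> is a type \<open>'a :: euclidean_space\<close> with \<open>d = DIM('a)\<close>; the \<open>n\<close> clients are \<open>0, \<dots>, n - 1\<close>.
  Client \<open>i\<close> has the sample space \<open>space (Dist i)\<close> and the stochastic component \<open>F i x \<xi>\<close>.
\<close>

definition has_gradient :: "('a::euclidean_space \<Rightarrow> real) \<Rightarrow> 'a \<Rightarrow> bool" where
  "has_gradient f x \<longleftrightarrow> (\<exists>g. GDERIV f x :> g)"

text \<open>Only meaningful where \<^const>\<open>has_gradient\<close> holds; elsewhere it is an unspecified constant.\<close>
definition nabla :: "('a::euclidean_space \<Rightarrow> real) \<Rightarrow> 'a \<Rightarrow> 'a" where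
  "nabla f x = (THE g. GDERIV f x :> g)"

definition clarke_subdiff :: "('a::euclidean_space \<Rightarrow> real) \<Rightarrow> 'a \<Rightarrow> 'a set" where
  "clarke_subdiff f x = convex hull
     {g. \<exists>X. (\<forall>k. has_gradient f (X k)) \<and> X \<longlonglongrightarrow> x \<and> (\<lambda>k. nabla f (X k)) \<longlonglongrightarrow> g}"

definition goldstein_subdiff :: "('a::euclidean_space \<Rightarrow> real) \<Rightarrow> real \<Rightarrow> 'a \<Rightarrow> 'a set" where
  "goldstein_subdiff f \<delta> x = convex hull (\<Union>y\<in>cball x \<delta>. clarke_subdiff f y)"

text \<open>For Lipschitz \<open>f\<close> the set is nonempty and compact, so the infimum is the minimum.\<close>
definition goldstein_norm :: "('a::euclidean_space \<Rightarrow> real) \<Rightarrow> real \<Rightarrow> 'a \<Rightarrow> real" where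
  "goldstein_norm f \<delta> x = Inf (norm ` goldstein_subdiff f \<delta> x)"

definition local_obj :: "(nat \<Rightarrow> 'x measure) \<Rightarrow> (nat \<Rightarrow> 'a \<Rightarrow> 'x \<Rightarrow> real) \<Rightarrow> nat \<Rightarrow> 'a \<Rightarrow> real" where
  "local_obj Dist F i x = (\<integral>\<xi>. F i x \<xi> \<partial>Dist i)"

definition global_obj :: "nat \<Rightarrow> (nat \<Rightarrow> 'x measure) \<Rightarrow> (nat \<Rightarrow> 'a \<Rightarrow> 'x \<Rightarrow> real) \<Rightarrow> 'a \<Rightarrow> real" where
  "global_obj n Dist F x = (1 / real n) * (\<Sum>i<n. local_obj Dist F i x)"

definition well_posed :: "nat \<Rightarrow> (nat \<Rightarrow> 'x measure) \<Rightarrow> (nat \<Rightarrow> 'a \<Rightarrow> 'x \<Rightarrow> real) \<Rightarrow> bool" where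
  "well_posed n Dist F \<longleftrightarrow>
     (\<forall>i<n. prob_space (Dist i) \<and> (\<forall>x. integrable (Dist i) (F i x)))"

definition stochastic_Lipschitz ::
  "nat \<Rightarrow> (nat \<Rightarrow> 'x measure) \<Rightarrow> (nat \<Rightarrow> 'a::euclidean_space \<Rightarrow> 'x \<Rightarrow> real) \<Rightarrow> (nat \<Rightarrow> 'x \<Rightarrow> real) \<Rightarrow> real \<Rightarrow> bool"
where
  "stochastic_Lipschitz n Dist F Lip L \<longleftrightarrow> L > 0 \<and>
     (\<forall>i<n. (\<forall>\<xi>\<in>space (Dist i). \<forall>x y. \<bar>F i x \<xi> - F i y \<xi>\<bar> \<le> Lip i \<xi> * norm (x - y)) \<and>
        Lip i \<in> borel_measurable (Dist i) \<and>
        integrable (Dist i) (\<lambda>\<xi>. (Lip i \<xi>)\<^sup>2) \<and> (\<integral>\<xi>. (Lip i \<xi>)\<^sup>2 \<partial>Dist i) \<le> L\<^sup>2)"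

text \<open>
  Gradients of the Lipschitz functions involved exist only almost everywhere (Rademacher), so the
  conditions on the oracle are read at almost every \<open>x\<close> and almost every sample.
\<close>
definition stochastic_gradient_oracle ::
  "nat \<Rightarrow> (nat \<Rightarrow> 'x measure) \<Rightarrow> (nat \<Rightarrow> 'a::euclidean_space \<Rightarrow> 'x \<Rightarrow> real) \<Rightarrow> real \<Rightarrow> real \<Rightarrow> bool"
where
  "stochastic_gradient_oracle n Dist F \<sigma> G \<longleftrightarrow> \<sigma> \<ge> 0 \<and> G \<ge> 0 \<and>
     (\<forall>i<n. AE x in lborel.
        let \<nu> = nabla (local_obj Dist F i) x; \<nu>F = (\<lambda>\<xi>. nabla (\<lambda>u. F i u \<xi>) x) in
        has_gradient (local_obj Dist F i) x \<and>
        (AE \<xi> in Dist i. has_gradient (\<lambda>u. F i u \<xi>) x) \<and>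
        integrable (Dist i) \<nu>F \<and> (\<integral>\<xi>. \<nu>F \<xi> \<partial>Dist i) = \<nu> \<and>
        integrable (Dist i) (\<lambda>\<xi>. (norm (\<nu>F \<xi> - \<nu>))\<^sup>2) \<and>
        (\<integral>\<xi>. (norm (\<nu>F \<xi> - \<nu>))\<^sup>2 \<partial>Dist i) \<le> \<sigma>\<^sup>2 \<and>
        integrable (Dist i) (\<lambda>\<xi>. (norm (\<nu>F \<xi>))\<^sup>2) \<and>
        (\<integral>\<xi>. (norm (\<nu>F \<xi>))\<^sup>2 \<partial>Dist i) \<le> G\<^sup>2)"

text \<open>The eigenvalues of a symmetric real matrix, with multiplicity, are the real roots of its
  characteristic polynomial.\<close>
definition lambda2 :: "real mat \<Rightarrow> real" where
  "lambda2 P = rev (sorted_list_of_multiset (proots (char_poly P))) ! 1"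

definition spectral_gap :: "real mat \<Rightarrow> real" where
  "spectral_gap P = 1 - lambda2 P"

definition psd :: "nat \<Rightarrow> real mat \<Rightarrow> bool" where
  "psd n A \<longleftrightarrow> (\<forall>v\<in>carrier_vec n. scalar_prod v (A *\<^sub>v v) \<ge> 0)"

definition gossip_matrix :: "nat \<Rightarrow> (nat \<Rightarrow> nat \<Rightarrow> bool) \<Rightarrow> real mat \<Rightarrow> bool" where
  "gossip_matrix n adj P \<longleftrightarrow>
     P \<in> carrier_mat n n \<and> transpose_mat P = P \<and>
     (\<forall>i<n. \<forall>j<n. P $$ (i, j) \<ge> 0) \<and>
     (\<forall>i<n. \<forall>j<n. adj i j \<longleftrightarrow> adj j i) \<and>
     (\<forall>i<n. \<forall>j<n. P $$ (i, j) \<noteq> 0 \<longleftrightarrow> adj i j \<or> i = j) \<and>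
     psd n P \<and> psd n (1\<^sub>m n - P) \<and>
     transpose_mat P *\<^sub>v vec n (\<lambda>_. 1) = vec n (\<lambda>_. 1) \<and> P *\<^sub>v vec n (\<lambda>_. 1) = vec n (\<lambda>_. 1) \<and>
     0 < spectral_gap P \<and> spectral_gap P \<le> 1"

definition gossip_momentum :: "real mat \<Rightarrow> real" where
  "gossip_momentum P = (1 - sqrt (1 - (lambda2 P)\<^sup>2)) / (1 + sqrt (1 - (lambda2 P)\<^sup>2))"

text \<open>The triple is \<open>(z\<^sup>(\<^sup>r\<^sup>-\<^sup>1\<^sup>), z\<^sup>(\<^sup>r\<^sup>), number of communication rounds used)\<close>.\<close>
primrec fast_gossip_iter :: "nat \<Rightarrow> real mat \<Rightarrow> (nat \<Rightarrow> 'a::euclidean_space) \<Rightarrow> nat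
    \<Rightarrow> (nat \<Rightarrow> 'a) \<times> (nat \<Rightarrow> 'a) \<times> nat" where
  "fast_gossip_iter n P z 0 = (z, z, 0)"
| "fast_gossip_iter n P z (Suc r) =
     (let (zp, zc, m) = fast_gossip_iter n P z r; \<phi> = gossip_momentum P in
      (zc, \<lambda>i. (1 + \<phi>) *\<^sub>R (\<Sum>j<n. P $$ (i, j) *\<^sub>R zc j) - \<phi> *\<^sub>R zp i, m + 1))"

definition fast_gossip :: "nat \<Rightarrow> real mat \<Rightarrow> nat \<Rightarrow> (nat \<Rightarrow> 'a::euclidean_space) \<Rightarrow> (nat \<Rightarrow> 'a) \<times> nat" where
  "fast_gossip n P R z = snd (fast_gossip_iter n P z R)"

text \<open>
  The state after iteration \<open>(k, t)\<close>: \<open>pos i = y\<^sub>i\<^sup>k\<^sup>,\<^sup>t\<close>, \<open>dir i = \<Delta>\<^sub>i\<^sup>k\<^sup>,\<^sup>t\<^sup>+\<^sup>1\<^sup>/\<^sup>2\<close>, \<open>wpt i = w\<^sub>i\<^sup>k\<^sup>,\<^sup>t\<close>, followed by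
  the costs so far: oracle calls of each client, computation rounds, communication rounds.
\<close>
record 'a state =
  pos :: "nat \<Rightarrow> 'a"
  dir :: "nat \<Rightarrow> 'a"
  wpt :: "nat \<Rightarrow> 'a"
  oracle_calls :: "nat \<Rightarrow> nat"
  comp_rounds :: nat
  comm_rounds :: nat

text \<open>
  The randomness \<open>(i\<^sup>t, s, \<xi>, z)\<close> of one iteration. Independent \<open>\<xi>\<^sub>i\<close> and \<open>z\<^sub>i\<close> are provided for all
  clients, but only those of the client \<open>i\<^sup>t\<close> are used.
\<close>
type_synonym ('x, 'a) draw = "nat \<times> (nat \<Rightarrow> real) \<times> (nat \<Rightarrow> 'x) \<times> (nat \<Rightarrow> 'a)"

text \<open>At \<open>v = 0\<close> this is \<open>0\<close>.\<close>
definition clip :: "real \<Rightarrow> 'a::euclidean_space \<Rightarrow> 'a" where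
  "clip D v = min 1 (D / norm v) *\<^sub>R v"

definition first_order_estimator :: "('a::euclidean_space \<Rightarrow> 'x \<Rightarrow> real) \<Rightarrow> real \<Rightarrow> 'a \<Rightarrow> 'x \<Rightarrow> 'a \<Rightarrow> 'a" where
  "first_order_estimator Fi \<delta>' w \<xi> z = nabla (\<lambda>u. Fi u \<xi>) (w + \<delta>' *\<^sub>R z)"

definition doc2s_step :: "nat \<Rightarrow> real mat \<Rightarrow> (nat \<Rightarrow> 'a::euclidean_space \<Rightarrow> 'x \<Rightarrow> real) \<Rightarrow> real \<Rightarrow> nat \<Rightarrow> real
    \<Rightarrow> real \<Rightarrow> ('x, 'a) draw \<Rightarrow> 'a state \<Rightarrow> 'a state" where
  "doc2s_step n P F \<delta>' R \<eta> D \<rho> S =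
     (let (it, s, \<xi>, z) = \<rho>;
          y = pos S;
          \<Delta> = dir S;
          x = (\<lambda>i. if i = it then y i + real n *\<^sub>R \<Delta> i else y i);
          w = (\<lambda>i. y i + s i *\<^sub>R \<Delta> i);
          (y', m1) = fast_gossip n P R x;
          g = first_order_estimator (F it) \<delta>' (w it) (\<xi> it) (z it);
          \<Delta>1 = (\<lambda>i. if i = it then real n *\<^sub>R clip D (\<Delta> i - \<eta> *\<^sub>R g) else 0);
          (\<Delta>', m2) = fast_gossip n P R \<Delta>1
      in \<lparr> pos = y', dir = \<Delta>', wpt = w,
           oracle_calls = (oracle_calls S)(it := oracle_calls S it + 1),
           comp_rounds = comp_rounds S + 1,
           comm_rounds = comm_rounds S + m1 + m2 \<rparr>)"

text \<open>\<open>doc2s_state \<dots> k 0\<close> is the state in which epoch \<open>k\<close> starts.\<close>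
fun doc2s_state :: "nat \<Rightarrow> real mat \<Rightarrow> (nat \<Rightarrow> 'a::euclidean_space \<Rightarrow> 'x \<Rightarrow> real) \<Rightarrow> real \<Rightarrow> nat \<Rightarrow> nat \<Rightarrow> real
    \<Rightarrow> real \<Rightarrow> (nat \<times> nat \<Rightarrow> ('x, 'a) draw) \<Rightarrow> nat \<Rightarrow> nat \<Rightarrow> 'a state" where
  "doc2s_state n P F \<delta>' T R \<eta> D \<rho> 0 t =
     \<lparr> pos = (\<lambda>i. 0), dir = (\<lambda>i. 0), wpt = (\<lambda>i. 0),
       oracle_calls = (\<lambda>i. 0), comp_rounds = 0, comm_rounds = 0 \<rparr>"
| "doc2s_state n P F \<delta>' T R \<eta> D \<rho> (Suc k) 0 =
     (doc2s_state n P F \<delta>' T R \<eta> D \<rho> k T) \<lparr> dir := (\<lambda>i. 0) \<rparr>"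
| "doc2s_state n P F \<delta>' T R \<eta> D \<rho> (Suc k) (Suc t) =
     doc2s_step n P F \<delta>' R \<eta> D (\<rho> (Suc k, Suc t)) (doc2s_state n P F \<delta>' T R \<eta> D \<rho> (Suc k) t)"

text \<open>The second component of a run's randomness gives, for each client, the epoch whose average it
  outputs.\<close>
definition doc2s_output :: "nat \<Rightarrow> real mat \<Rightarrow> (nat \<Rightarrow> 'a::euclidean_space \<Rightarrow> 'x \<Rightarrow> real) \<Rightarrow> real \<Rightarrow> nat \<Rightarrow> nat
    \<Rightarrow> real \<Rightarrow> real \<Rightarrow> (nat \<times> nat \<Rightarrow> ('x, 'a) draw) \<times> (nat \<Rightarrow> nat) \<Rightarrow> nat \<Rightarrow> 'a" where
  "doc2s_output n P F \<delta>' T R \<eta> D \<omega> i =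
     (1 / real T) *\<^sub>R (\<Sum>t=1..T. wpt (doc2s_state n P F \<delta>' T R \<eta> D (fst \<omega>) (snd \<omega> i) t) i)"

definition draw_space :: "nat \<Rightarrow> (nat \<Rightarrow> 'x measure) \<Rightarrow> ('x, 'a::euclidean_space) draw measure" where
  "draw_space n Dist =
     uniform_count_measure {..<n}
     \<Otimes>\<^sub>M (PiM {..<n} (\<lambda>_. uniform_measure lborel {0..1}))
     \<Otimes>\<^sub>M (PiM {..<n} Dist)
     \<Otimes>\<^sub>M (PiM {..<n} (\<lambda>_. uniform_measure lborel (cball 0 1)))"

definition run_space :: "nat \<Rightarrow> (nat \<Rightarrow> 'x measure) \<Rightarrow> nat \<Rightarrow> nat
    \<Rightarrow> ((nat \<times> nat \<Rightarrow> ('x, 'a::euclidean_space) draw) \<times> (nat \<Rightarrow> nat)) measure" where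
  "run_space n Dist K T =
     PiM ({1..K} \<times> {1..T}) (\<lambda>_. draw_space n Dist)
     \<Otimes>\<^sub>M PiM {..<n} (\<lambda>_. uniform_count_measure {1..K})"

definition outputs_stationary :: "nat \<Rightarrow> (nat \<Rightarrow> 'x measure) \<Rightarrow> real mat \<Rightarrow> (nat \<Rightarrow> 'a::euclidean_space \<Rightarrow> 'x \<Rightarrow> real)
    \<Rightarrow> real \<Rightarrow> real \<Rightarrow> real \<Rightarrow> nat \<Rightarrow> nat \<Rightarrow> nat \<Rightarrow> real \<Rightarrow> real \<Rightarrow> bool" where
  "outputs_stationary n Dist P F \<delta> \<epsilon> \<delta>' K T R \<eta> D \<longleftrightarrow>
     (\<forall>i<n. let X = (\<lambda>\<omega>. goldstein_norm (global_obj n Dist F) \<delta> (doc2s_output n P F \<delta>' T R \<eta> D \<omega> i)) in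
        integrable (run_space n Dist K T) X \<and> (\<integral>\<omega>. X \<omega> \<partial>run_space n Dist K T) \<le> \<epsilon>)"

text \<open>The logarithmic factor hidden by the soft-O notation.\<close>
definition log_factor :: "nat \<Rightarrow> nat \<Rightarrow> real \<Rightarrow> real \<Rightarrow> real" where
  "log_factor n d \<delta> \<epsilon> = 1 + ln (real n * real d / (\<delta> * \<epsilon>))"

definition parameter_orders :: "real \<Rightarrow> real \<Rightarrow> real \<Rightarrow> real \<Rightarrow> real \<Rightarrow> nat \<Rightarrow> nat \<Rightarrow> nat \<Rightarrow> real \<Rightarrow> real \<Rightarrow> bool" where
  "parameter_orders c \<delta> \<epsilon> \<gamma> lf K T R \<eta> D \<longleftrightarrow>
     1 \<le> K \<and> 1 \<le> T \<and> 1 \<le> R \<and> 0 < \<eta> \<and> 0 < D \<and>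
     real K \<le> c / (\<delta> * \<epsilon>) \<and>
     real T \<le> c / \<epsilon>^2 \<and>
     real R \<le> c * \<gamma> powr (-1/2) * lf \<and>
     \<eta> \<le> c * \<delta> * \<epsilon>^3 \<and>
     D \<le> c * \<delta> * \<epsilon>^2"

text \<open>
  The constant hidden by the O-notation. It depends on nothing but \<open>L\<close>, \<open>\<sigma>\<close>, \<open>G\<close> and the initial gap
  \<open>f(0) - f\<^sup>*\<close>. It is given in closed form because an existentially quantified constant could depend
  on the types of a theorem, hence on \<open>d\<close>; no attempt is made to keep it small.
\<close>
definition order_const :: "real \<Rightarrow> real \<Rightarrow> real \<Rightarrow> real \<Rightarrow> real" where
  "order_const L \<sigma> G gap = 10^6 * (1 + L + \<sigma> + G + gap)^4"

end

theory Submission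
  imports Defs
begin

text \<open>
  The algorithm is online-to-nonconvex conversion carried out on network averages. Gossip preserves
  averages, so the mean position moves by \<open>\<Delta>\<close> of the sampled client and the mean direction is one step of
  projected online gradient descent; both up to a consensus error. Writing \<open>h\<close> for the uniform smoothing
  of \<open>f\<close> over balls of radius \<open>\<delta>/2\<close>, the mean value theorem turns the decrease of \<open>h\<close> in one iteration into
  \<open>\<langle>m, d\<rangle>\<close>, where \<open>m\<close> is the gradient of \<open>h\<close> averaged over the segment from \<open>y\<close> to \<open>y + d\<close>. The random
  interpolation weight makes the stochastic gradient an almost unbiased estimate of \<open>m\<close>, so the regret
  bound against the comparator of length \<open>D\<close> opposite to the sum of the \<open>m\<close> bounds the norm of their
  average. As an epoch stays in a ball of radius \<open>\<delta>/2\<close>, this average lies in the closed Goldstein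
  \<open>\<delta>\<close>-subdifferential at every client's output.

  The gradient of \<open>h\<close> is \<open>2Ld/\<delta>\<close>-Lipschitz (compare the volumes of two overlapping balls), so the consensus
  error only has to be polynomially small in \<open>\<delta>\<epsilon>/(nd)\<close>, which takes \<open>\<gamma>\<^sup>-\<^sup>1\<^sup>/\<^sup>2 log(nd/(\<delta>\<epsilon>))\<close> gossip rounds. The
  dependence on \<open>d\<close> therefore enters through the logarithm alone.
\<close>

section \<open>Accelerated gossip\<close>

text \<open>Gradients exist only almost everywhere, so a gradient at a point of the trajectory
  cannot be used as such. The uniform perturbation of radius \<open>\<delta> / 2\<close> cures this:
  the query point misses any fixed null set almost surely, and averaging over the perturbation gives
  a field defined everywhere. The Goldstein radius is spent in two halves, one on this perturbation
  and one on the spread of an epoch; the second half forces \<open>D\<close> to be of order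
  \<open>\<delta> / T\<close>. The comparator depends on the whole epoch, so its product with the
  noise has no reason to vanish in expectation; it is bounded by the norm of the accumulated noise,
  of order \<open>sqrt T\<close>. The step size balances \<open>D^2 / \<eta>\<close> against
  \<open>\<eta> * T * L^2\<close>, after which the noise and regret terms, divided by
  \<open>D * T\<close>, are of order \<open>1 / sqrt T\<close>; this fixes \<open>T\<close>. The
  initial gap contributes a term of order \<open>1 / (\<delta> * K)\<close>, which fixes
  \<open>K\<close>. Second moments of samples come from the Lipschitz moduli of the components, and
  independence of the draws is used in the form that redrawing one coordinate of a product measure
  does not change its law.\<close>

no_notation scalar_prod (infix "\<bullet>" 70)
no_notation vec_nth (infixl "$" 90)

section \<open>Quadratic form and second eigenvalue of the gossip matrix\<close>

definition qform :: "nat \<Rightarrow> real mat \<Rightarrow> (nat \<Rightarrow> real) \<Rightarrow> (nat \<Rightarrow> real) \<Rightarrow> real" where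
  "qform n P v w = (\<Sum>i<n. \<Sum>j<n. v i * P $$ (i, j) * w j)"

text \<open>Replaces library vectors by functions of the client index. A single coordinate of a
  family of points of \<open>'a\<close> is such a function, and this is how
  \<open>ip_mix_eq_qform\<close> inserts it.\<close>

lemma scalar_prod_mult_mat_vec_eq_qform:
  assumes "P \<in> carrier_mat n n"
  shows "scalar_prod (vec n v) (P *\<^sub>v vec n w) = qform n P v w"
  using assms by (simp add: qform_def scalar_prod_def lessThan_atLeast0 sum_distrib_left mult.assoc)

lemma gossip_matrixD:
  assumes "gossip_matrix n adj P"
  shows "P \<in> carrier_mat n n"
    and "\<And>i j. i < n \<Longrightarrow> j < n \<Longrightarrow> P $$ (i, j) = P $$ (j, i)"
    and "\<And>i. i < n \<Longrightarrow> (\<Sum>j<n. P $$ (i, j)) = 1"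
    and "\<And>v. 0 \<le> qform n P v v"
    and "\<And>v. qform n P v v \<le> (\<Sum>i<n. (v i)\<^sup>2)"
    and "0 < spectral_gap P" "spectral_gap P \<le> 1"
proof -
  have car: "P \<in> carrier_mat n n" and tr: "transpose_mat P = P"
    and psd: "psd n P" "psd n (1\<^sub>m n - P)"
    and ones: "P *\<^sub>v vec n (\<lambda>_. 1) = vec n (\<lambda>_. 1)"
    using assms by (auto simp: gossip_matrix_def)
  show "P \<in> carrier_mat n n" by fact
  show "P $$ (i, j) = P $$ (j, i)" if "i < n" "j < n" for i j
    using tr car that by (metis carrier_matD index_transpose_mat(1))
  show "(\<Sum>j<n. P $$ (i, j)) = 1" if "i < n" for i
  proof -
    have "(P *\<^sub>v vec n (\<lambda>_. 1)) $ i = 1" unfolding ones using that by simp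
    then show ?thesis using car that by (simp add: scalar_prod_def lessThan_atLeast0)
  qed
  show "0 \<le> qform n P v v" for v
    using psd(1) scalar_prod_mult_mat_vec_eq_qform[OF car, of v v] unfolding psd_def
    by (metis vec_carrier)
  show "qform n P v v \<le> (\<Sum>i<n. (v i)\<^sup>2)" for v
  proof -
    have car': "1\<^sub>m n - P \<in> carrier_mat n n" using car by auto
    have "0 \<le> scalar_prod (vec n v) ((1\<^sub>m n - P) *\<^sub>v vec n v)"
      using psd(2) by (simp add: psd_def)
    also have "\<dots> = qform n (1\<^sub>m n - P) v v"
      by (rule scalar_prod_mult_mat_vec_eq_qform[OF car'])
    also have "\<dots> = (\<Sum>i<n. \<Sum>j<n. (if i = j then v i * v j else 0) - v i * P $$ (i, j) * v j)"
      unfolding qform_def using car by (intro sum.cong refl) (auto simp: algebra_simps)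
    also have "\<dots> = (\<Sum>i<n. (v i)\<^sup>2) - qform n P v v"
      by (simp add: sum_subtractf qform_def power2_eq_square)
    finally show ?thesis by simp
  qed
  show "0 < spectral_gap P" "spectral_gap P \<le> 1" using assms by (auto simp: gossip_matrix_def)
qed

text \<open>Counting multiplicity, two entries of the descending list are at least \<open>y\<close>,
  so the entry in second place is. The multiset inclusion also covers \<open>x = y\<close>, where
  the value must occur twice.\<close>

lemma nth_rev_sorted_list_of_multiset_ge:
  fixes A :: "real multiset"
  assumes "{#x, y#} \<subseteq># A" "y \<le> x"
  shows "y \<le> rev (sorted_list_of_multiset A) ! 1"
proof -
  define xs where "xs = rev (sorted_list_of_multiset A)"
  have A: "mset xs = A" by (simp add: xs_def)
  have sorted: "sorted (rev xs)" by (simp add: xs_def)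
  have len: "2 \<le> length xs"
    using size_mset_mono[OF assms(1)] by (simp flip: A)
  then obtain a b ys where xs: "xs = a # b # ys"
    by (metis One_nat_def Suc_1 length_0_conv length_Suc_conv list.exhaust not_less_eq_eq le0 list.size(3) not_one_le_zero Suc_le_length_iff)
  have le: "z \<le> b" if "z \<in> set (b # ys)" for z
    using sorted that by (auto simp: xs sorted_append)
  show ?thesis
  proof (rule ccontr)
    assume "\<not> ?thesis"
    then have "b < y" by (simp flip: xs_def add: xs)
    \<comment> \<open>Beyond the head nothing reaches \<open>y\<close>, so \<open>x\<close> and
      \<open>y\<close> can only be the head; one head cannot supply two occurrences.\<close>
    then have "x \<notin> set (b # ys)" "y \<notin> set (b # ys)" using le assms(2) by fastforce+
    then have "count (mset xs) x = (if a = x then 1 else 0)" "count (mset xs) y = (if a = y then 1 else 0)"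
      by (auto simp: xs count_mset_0_iff simp del: set_ConsD)
    moreover have "count {#x, y#} x \<le> count (mset xs) x" "count {#x, y#} y \<le> count (mset xs) y"
      unfolding A by (rule mset_subset_eq_count[OF assms(1)])+
    ultimately show False by (auto split: if_splits)
  qed
qed

text \<open>The deleted column only ever multiplies the vanishing entry of \<open>v\<close>, and the
  deleted row merely drops one equation.\<close>

lemma eigenvalue_mat_delete:
  fixes A :: "real mat"
  assumes A: "A \<in> carrier_mat n n" and i: "i < n"
    and v: "v \<in> carrier_vec n" "A *\<^sub>v v = c \<cdot>\<^sub>v v" "v $ i = 0" "v \<noteq> 0\<^sub>v n"
  shows "eigenvalue (mat_delete A i i) c"
proof -
  obtain m where m: "n = Suc m" using i by (cases n) auto
  define u where "u = vec m (\<lambda>j. v $ (insert_index i j))"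
  have ins: "inj_on (insert_index i) {..<m}" "insert_index i ` {..<m} = {..<n} - {i}"
    using insert_index_inj_on[of i] insert_index_image[of i m] i m
    by (auto intro: inj_on_subset simp: lessThan_atLeast0)
  have "u \<noteq> 0\<^sub>v m"
  proof
    assume "u = 0\<^sub>v m"
    then have z: "v $ insert_index i j = 0" if "j < m" for j
      using that by (metis index_vec index_zero_vec(1) u_def)
    have "v $ k = 0" if "k < n" for k
    proof (cases "k = i")
      case False
      then have "k \<in> insert_index i ` {..<m}" using ins(2) that by auto
      then show ?thesis using z by auto
    qed (simp add: v(3))
    then have "v = 0\<^sub>v n" using v(1) by (intro eq_vecI) auto
    with v(4) show False by simp
  qed
  moreover have "mat_delete A i i *\<^sub>v u = c \<cdot>\<^sub>v u"
  proof (rule eq_vecI)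
    show "dim_vec (mat_delete A i i *\<^sub>v u) = dim_vec (c \<cdot>\<^sub>v u)"
      using A m by (simp add: mat_delete_def u_def)
    fix k assume "k < dim_vec (c \<cdot>\<^sub>v u)"
    then have k: "k < m" by (simp add: u_def)
    have kk: "insert_index i k < n" using k ins(2) by auto
    have "(mat_delete A i i *\<^sub>v u) $ k = (\<Sum>j<m. mat_delete A i i $$ (k, j) * u $ j)"
      using k A m by (simp add: scalar_prod_def lessThan_atLeast0 u_def mat_delete_def)
    also have "\<dots> = (\<Sum>j<m. A $$ (insert_index i k, insert_index i j) * v $ (insert_index i j))"
      using k A m i by (intro sum.cong) (auto simp: u_def mat_delete_index[symmetric])
    also have "\<dots> = (\<Sum>j\<in>{..<n} - {i}. A $$ (insert_index i k, j) * v $ j)"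
      by (simp add: sum.reindex[OF ins(1), unfolded ins(2)] o_def)
    also have "\<dots> = (\<Sum>j<n. A $$ (insert_index i k, j) * v $ j)"
      using v(3) by (intro sum.mono_neutral_left) auto
    also have "\<dots> = (A *\<^sub>v v) $ (insert_index i k)"
      using kk A v(1) by (simp add: scalar_prod_def lessThan_atLeast0)
    also have "\<dots> = (c \<cdot>\<^sub>v u) $ k" using kk k v(1) by (simp add: v(2) u_def)
    finally show "(mat_delete A i i *\<^sub>v u) $ k = (c \<cdot>\<^sub>v u) $ k" .
  qed
  moreover have "dim_row (mat_delete A i i) = m" using A m by (auto simp: mat_delete_def)
  ultimately show ?thesis
    unfolding eigenvalue_def eigenvector_def by (intro exI[of _ u]) (auto simp: u_def)
qed

text \<open>The derivative of the characteristic polynomial is the sum of those of the principal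
  minors. Since no entry of \<open>u\<close> vanishes, for each \<open>i\<close> a multiple of
  \<open>u\<close> can be subtracted from \<open>v\<close> to make entry \<open>i\<close> zero, so
  \<open>c\<close> is an eigenvalue of every minor and hence a root of the derivative.\<close>

lemma two_le_order_char_poly:
  fixes A :: "real mat"
  assumes A: "A \<in> carrier_mat n n" and n: "2 \<le> n"
    and u: "u \<in> carrier_vec n" "A *\<^sub>v u = c \<cdot>\<^sub>v u" "\<And>i. i < n \<Longrightarrow> u $ i \<noteq> 0"
    and v: "v \<in> carrier_vec n" "A *\<^sub>v v = c \<cdot>\<^sub>v v" "\<And>a. v \<noteq> a \<cdot>\<^sub>v u"
  shows "2 \<le> order c (char_poly A)"
proof -
  let ?p = "char_poly A"
  have deg: "degree ?p = n" "lead_coeff ?p = 1" using degree_monic_char_poly[OF A] by auto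
  then have p0: "?p \<noteq> 0" "pderiv ?p \<noteq> 0" using n by (auto simp: pderiv_eq_0_iff)
  have "eigenvector A u c"
    using A u(1,2) u(3)[of 0] n by (auto simp: eigenvector_def)
  then have r: "poly ?p c = 0"
    using eigenvalue_root_char_poly[OF A, of c] by (auto simp: eigenvalue_def)
  have "poly (char_poly (mat_delete A i i)) c = 0" if i: "i < n" for i
  proof -
    define w where "w = v - (v $ i / u $ i) \<cdot>\<^sub>v u"
    have w: "w \<in> carrier_vec n" using u v by (auto simp: w_def)
    have "A *\<^sub>v w = A *\<^sub>v v - (v $ i / u $ i) \<cdot>\<^sub>v (A *\<^sub>v u)"
      using A u(1) v(1) by (simp add: w_def mult_minus_distrib_mat_vec mult_mat_vec)
    also have "\<dots> = c \<cdot>\<^sub>v w"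
      using u(1) v(1) unfolding u(2) v(2) w_def by (intro eq_vecI) (auto simp: algebra_simps)
    finally have Aw: "A *\<^sub>v w = c \<cdot>\<^sub>v w" .
    have wi: "w $ i = 0" using u(1,3) v(1) i by (simp add: w_def)
    have w0: "w \<noteq> 0\<^sub>v n"
    proof
      assume "w = 0\<^sub>v n"
      then have "v $ k - (v $ i / u $ i) * u $ k = 0" if "k < n" for k
      proof -
        have "w $ k = 0" using \<open>w = 0\<^sub>v n\<close> that by simp
        then show ?thesis using that u(1) v(1) by (simp add: w_def)
      qed
      then have "v = (v $ i / u $ i) \<cdot>\<^sub>v u" using u(1) v(1) by (intro eq_vecI) auto
      with v(3) show False by blast
    qed
    have "mat_delete A i i \<in> carrier_mat (n - 1) (n - 1)" using A by (auto simp: mat_delete_def)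
    from eigenvalue_root_char_poly[OF this, of c] eigenvalue_mat_delete[OF A i w Aw wi w0]
    show ?thesis by simp
  qed
  then have "poly (pderiv ?p) c = 0"
    by (simp add: pderiv_char_poly[OF A] poly_sum)
  then have "order c (pderiv ?p) \<noteq> 0" "order c ?p \<noteq> 0"
    using r p0 by (auto simp: order_root)
  moreover from this p0 have "order c ?p = Suc (order c (pderiv ?p))"
    by (intro order_pderiv r)
  ultimately show ?thesis by simp
qed

text \<open>Entries from \<open>n\<close> on are pinned to zero, which places the set inside a
  product of compact intervals; Tychonoff's theorem and closedness of the two equations do the
  rest.\<close>

lemma compact_sphere_zero_sum:
  "compact {v::nat \<Rightarrow> real. (\<forall>i\<ge>n. v i = 0) \<and> (\<Sum>i<n. v i) = 0 \<and> (\<Sum>i<n. (v i)\<^sup>2) = 1}" (is "compact ?S")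
proof -
  let ?B = "PiE UNIV (\<lambda>i. if i < n then {-1..1} else {0::real})"
  have "compactin (product_topology (\<lambda>i::nat. euclidean :: real topology) UNIV) ?B"
    by (subst compactin_PiE) auto
  then have B: "compact ?B" by (simp add: euclidean_product_topology)
  have c: "continuous_on UNIV (\<lambda>v::nat \<Rightarrow> real. v i)" for i by simp
  have "closed {v::nat \<Rightarrow> real. (\<Sum>i<n. v i) = 0 \<and> (\<Sum>i<n. (v i)\<^sup>2) = 1}"
    by (intro closed_Collect_conj closed_Collect_eq continuous_intros c)
  from compact_Int_closed[OF B this]
  have "compact (?B \<inter> {v. (\<Sum>i<n. v i) = 0 \<and> (\<Sum>i<n. (v i)\<^sup>2) = 1})" .
  moreover have "?B \<inter> {v. (\<Sum>i<n. v i) = 0 \<and> (\<Sum>i<n. (v i)\<^sup>2) = 1} = ?S"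
  proof (rule subset_antisym; rule subsetI)
    fix v assume v: "v \<in> ?B \<inter> {v. (\<Sum>i<n. v i) = 0 \<and> (\<Sum>i<n. (v i)\<^sup>2) = 1}"
    have "v i = 0" if "n \<le> i" for i
    proof -
      have "v i \<in> (if i < n then {-1..1} else {0})" using v by (auto simp: PiE_iff)
      then show ?thesis using that by simp
    qed
    then show "v \<in> ?S" using v by simp
  next
    fix v assume v: "v \<in> ?S"
    have "-1 \<le> v i \<and> v i \<le> 1" if "i < n" for i
    proof -
      have "(v i)\<^sup>2 \<le> (\<Sum>i<n. (v i)\<^sup>2)" using that by (intro member_le_sum) auto
      then have "\<bar>v i\<bar> \<le> 1" using v by (auto simp: abs_square_le_1)
      then show ?thesis by linarith
    qed
    then show "v \<in> ?B \<inter> {v. (\<Sum>i<n. v i) = 0 \<and> (\<Sum>i<n. (v i)\<^sup>2) = 1}"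
      using v by (simp add: PiE_iff)
  qed
  ultimately show ?thesis by simp
qed

lemma qform_sum_left: "qform n P v w = (\<Sum>i<n. v i * (\<Sum>j<n. P $$ (i, j) * w j))"
  by (simp add: qform_def sum_distrib_left mult.assoc)

lemma qform_add_scaled:
  assumes "\<And>i j. i < n \<Longrightarrow> j < n \<Longrightarrow> P $$ (i, j) = P $$ (j, i)"
  shows "qform n P (\<lambda>i. v i + t * w i) (\<lambda>i. v i + t * w i)
    = qform n P v v + 2 * t * qform n P w v + t\<^sup>2 * qform n P w w"
proof -
  have "qform n P v w = (\<Sum>i<n. \<Sum>j<n. w j * P $$ (j, i) * v i)"
    unfolding qform_def by (intro sum.cong refl) (simp add: assms)
  also have "\<dots> = qform n P w v" unfolding qform_def by (rule sum.swap)
  finally have s: "qform n P v w = qform n P w v" .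
  have "qform n P (\<lambda>i. v i + t * w i) (\<lambda>i. v i + t * w i)
    = qform n P v v + t * qform n P v w + t * qform n P w v + t\<^sup>2 * qform n P w w"
    unfolding qform_def sum_distrib_left sum.distrib[symmetric]
    by (intro sum.cong refl) (simp add: algebra_simps power2_eq_square)
  then show ?thesis by (simp add: s)
qed

text \<open>The first-order condition at a maximum: near \<open>t = 0\<close> the linear term
  decides the sign.\<close>

lemma linear_coefficient_eq_0:
  fixes a b :: real
  assumes "\<And>t. 2 * t * a + t\<^sup>2 * b \<le> 0"
  shows "a = 0"
proof (rule ccontr)
  assume a: "a \<noteq> 0"
  \<comment> \<open>The sign of \<open>t\<close> is that of \<open>a\<close>, and the denominator
    keeps the quadratic term below half of the linear one.\<close>
  define t where "t = a / (\<bar>b\<bar> + 1)"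
  have "2 * t * a + t\<^sup>2 * b = a\<^sup>2 / (\<bar>b\<bar> + 1) * (2 + b / (\<bar>b\<bar> + 1))"
    by (simp add: t_def power2_eq_square add_divide_distrib distrib_left)
  also have "\<dots> > 0"
  proof (intro mult_pos_pos)
    have "b / (\<bar>b\<bar> + 1) \<ge> -1" by (simp add: field_simps)
    then show "2 + b / (\<bar>b\<bar> + 1) > 0" by simp
  qed (use a in simp)
  finally show False using assms[of t] by simp
qed

text \<open>A maximiser of the Rayleigh quotient on the orthogonal complement of the all-ones vector is an
  eigenvector. Its eigenvalue and the eigenvalue 1 of the all-ones vector are two entries of the list
  that \<^const>\<open>lambda2\<close> inspects; if they coincide, 1 is a multiple root.\<close>
lemma qform_le_lambda2:
  assumes P: "gossip_matrix n adj P" and n: "2 \<le> n" and v: "(\<Sum>i<n. v i) = 0"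
  shows "qform n P v v \<le> lambda2 P * (\<Sum>i<n. (v i)\<^sup>2)"
proof -
  note G = gossip_matrixD[OF P]
  let ?S = "{v::nat \<Rightarrow> real. (\<forall>i\<ge>n. v i = 0) \<and> (\<Sum>i<n. v i) = 0 \<and> (\<Sum>i<n. (v i)\<^sup>2) = 1}"
  \<comment> \<open>The normalised difference of two clients shows that the constraint set is not
    empty; this takes at least two clients.\<close>
  define e where "e = (\<lambda>i::nat. if i = 0 then 1 / sqrt 2 else if i = 1 then - 1 / sqrt 2 else 0)"
  have "(\<Sum>i<n. e i) = (\<Sum>i\<in>{0, 1}. e i)" "(\<Sum>i<n. (e i)\<^sup>2) = (\<Sum>i\<in>{0, 1}. (e i)\<^sup>2)"
    using n by (intro sum.mono_neutral_right; auto simp: e_def)+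
  then have "e \<in> ?S" using n by (simp add: e_def power_divide)
  then have ne: "?S \<noteq> {}" by blast
  have cont: "continuous_on ?S (\<lambda>v. qform n P v v)"
    unfolding qform_def
    by (intro continuous_intros continuous_on_subset[OF continuous_on_product_coordinates]) auto
  obtain u where u: "u \<in> ?S" and max: "\<And>w. w \<in> ?S \<Longrightarrow> qform n P w w \<le> qform n P u u"
    using continuous_attains_sup[OF compact_sphere_zero_sum ne cont] by blast
  define \<mu> where "\<mu> = qform n P u u"
  have le: "qform n P w w \<le> \<mu> * (\<Sum>i<n. (w i)\<^sup>2)" if w: "(\<Sum>i<n. w i) = 0" for w
  proof (cases "(\<Sum>i<n. (w i)\<^sup>2) = 0")
    case True
    then have "\<forall>i<n. w i = 0" by (simp add: sum_nonneg_eq_0_iff)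
    then have "qform n P w w = 0" by (simp add: qform_def)
    then show ?thesis using True by simp
  next
    case False
    define s where "s = sqrt (\<Sum>i<n. (w i)\<^sup>2)"
    have s2: "s\<^sup>2 = (\<Sum>i<n. (w i)\<^sup>2)" by (simp add: s_def sum_nonneg)
    have s0: "s \<noteq> 0" using False s2 by auto
    define w' where "w' = (\<lambda>i. if i < n then w i / s else 0)"
    have "(\<Sum>i<n. w' i) = (\<Sum>i<n. w i) / s" "(\<Sum>i<n. (w' i)\<^sup>2) = (\<Sum>i<n. (w i)\<^sup>2) / s\<^sup>2"
      by (auto simp: w'_def sum_divide_distrib power_divide intro!: sum.cong)
    then have "w' \<in> ?S" using w s0 by (simp add: w'_def flip: s2)
    from max[OF this] have "qform n P w' w' \<le> \<mu>" by (simp add: \<mu>_def)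
    moreover have "qform n P w' w' = qform n P w w / s\<^sup>2"
      by (simp add: qform_def w'_def sum_divide_distrib power2_eq_square)
    ultimately show ?thesis using s0 by (simp add: s2[symmetric] field_simps)
  qed
  \<comment> \<open>The residual of the eigenvalue equation. It sums to zero because the columns of
    \<open>P\<close> sum to one, so it is an admissible direction of variation.\<close>
  define z where "z = (\<lambda>i. (\<Sum>j<n. P $$ (i, j) * u j) - \<mu> * u i)"
  have colsum: "(\<Sum>i<n. P $$ (i, j)) = 1" if "j < n" for j
    using G(3)[OF that] G(2) that by simp
  have "(\<Sum>i<n. \<Sum>j<n. P $$ (i, j) * u j) = (\<Sum>j<n. (\<Sum>i<n. P $$ (i, j)) * u j)"
    by (subst sum.swap) (simp add: sum_distrib_right)
  also have "\<dots> = 0" using u colsum by simp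
  finally have z_sum: "(\<Sum>i<n. z i) = 0"
    using u by (simp add: z_def sum_subtractf flip: sum_distrib_left)
  \<comment> \<open>Varying \<open>u\<close> along its own residual makes the linear coefficient the
    squared norm of the residual, which must therefore vanish.\<close>
  have "2 * t * (\<Sum>i<n. (z i)\<^sup>2) + t\<^sup>2 * (qform n P z z - \<mu> * (\<Sum>i<n. (z i)\<^sup>2)) \<le> 0" for t
  proof -
    have "(\<Sum>i<n. u i + t * z i) = 0" using u z_sum by (simp add: sum.distrib flip: sum_distrib_left)
    from le[OF this]
    have "\<mu> + 2 * t * qform n P z u + t\<^sup>2 * qform n P z z \<le> \<mu> * (\<Sum>i<n. (u i + t * z i)\<^sup>2)"
      using qform_add_scaled[of n P u t z, OF G(2)] by (simp add: \<mu>_def)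
    also have "(\<Sum>i<n. (u i + t * z i)\<^sup>2) = (\<Sum>i<n. (u i)\<^sup>2) + 2 * t * (\<Sum>i<n. z i * u i) + t\<^sup>2 * (\<Sum>i<n. (z i)\<^sup>2)"
      unfolding sum_distrib_left sum.distrib[symmetric]
      by (intro sum.cong refl) (simp add: algebra_simps power2_eq_square)
    also have "(\<Sum>i<n. (u i)\<^sup>2) = 1" using u by simp
    finally have "2 * t * (qform n P z u - \<mu> * (\<Sum>i<n. z i * u i))
        + t\<^sup>2 * (qform n P z z - \<mu> * (\<Sum>i<n. (z i)\<^sup>2)) \<le> 0"
      by (simp add: algebra_simps)
    moreover have "qform n P z u - \<mu> * (\<Sum>i<n. z i * u i) = (\<Sum>i<n. (z i)\<^sup>2)"
    proof -
      have "(\<Sum>j<n. P $$ (i, j) * u j) = z i + \<mu> * u i" for i by (simp add: z_def)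
      then show ?thesis
        by (simp add: qform_sum_left distrib_left sum.distrib power2_eq_square sum_distrib_left mult.left_commute)
    qed
    ultimately show ?thesis by simp
  qed
  then have "(\<Sum>i<n. (z i)\<^sup>2) = 0" by (rule linear_coefficient_eq_0)
  then have z0: "z i = 0" if "i < n" for i using that by (simp add: sum_nonneg_eq_0_iff)
  let ?u = "vec n u" and ?e = "vec n (\<lambda>_. 1 :: real)"
  have Pu: "P *\<^sub>v ?u = \<mu> \<cdot>\<^sub>v ?u"
    using z0 G(1) by (intro eq_vecI) (auto simp: z_def scalar_prod_def lessThan_atLeast0)
  have Pe: "P *\<^sub>v ?e = 1 \<cdot>\<^sub>v ?e"
    using G(3) G(1) by (intro eq_vecI) (auto simp: scalar_prod_def lessThan_atLeast0)
  have u_nc: "?u \<noteq> a \<cdot>\<^sub>v ?e" for a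
  proof
    assume "?u = a \<cdot>\<^sub>v ?e"
    then have a: "u i = a" if "i < n" for i
    proof -
      have "?u $ i = (a \<cdot>\<^sub>v ?e) $ i" by (simp only: \<open>?u = a \<cdot>\<^sub>v ?e\<close>)
      then show ?thesis using that by simp
    qed
    then have "(\<Sum>i<n. u i) = real n * a" by simp
    then have "a = 0" using u n by simp
    then have "(\<Sum>i<n. (u i)\<^sup>2) = 0" using a by simp
    then show False using u by simp
  qed
  have p0: "char_poly P \<noteq> 0" using degree_monic_char_poly[OF G(1)] by auto
  have "eigenvector P ?u \<mu>" "eigenvector P ?e 1"
  proof -
    have "0 \<cdot>\<^sub>v ?e = 0\<^sub>v n" by (intro eq_vecI) auto
    then have "?u \<noteq> 0\<^sub>v n" using u_nc[of 0] by simp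
    moreover have "?e $ 0 \<noteq> 0\<^sub>v n $ 0" using n by simp
    then have "?e \<noteq> 0\<^sub>v n" by metis
    ultimately show "eigenvector P ?u \<mu>" "eigenvector P ?e 1"
      using G(1) Pu Pe by (auto simp: eigenvector_def)
  qed
  then have roots: "poly (char_poly P) \<mu> = 0" "poly (char_poly P) 1 = 0"
    using eigenvalue_root_char_poly[OF G(1)] by (auto simp: eigenvalue_def)
  have \<mu>1: "\<mu> \<le> 1" using G(5)[of u] u by (simp add: \<mu>_def)
  have "{#1, \<mu>#} \<subseteq># proots (char_poly P)"
  proof (cases "\<mu> = 1")
    case True
    have "2 \<le> order 1 (char_poly P)"
      using Pu Pe u_nc unfolding True by (intro two_le_order_char_poly[OF G(1) n, of ?e 1 ?u]) auto
    then show ?thesis using True p0 by (auto simp: subseteq_mset_def)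
  next
    case False
    then show ?thesis using roots p0 by (auto simp: subseteq_mset_def order_root Suc_le_eq)
  qed
  from nth_rev_sorted_list_of_multiset_ge[OF this \<mu>1] have "\<mu> \<le> lambda2 P"
    by (simp add: lambda2_def)
  then have "\<mu> * (\<Sum>i<n. (v i)\<^sup>2) \<le> lambda2 P * (\<Sum>i<n. (v i)\<^sup>2)"
    by (intro mult_right_mono sum_nonneg) auto
  with le[OF v] show ?thesis by linarith
qed

section \<open>Families of vectors indexed by the clients\<close>

definition mix :: "nat \<Rightarrow> real mat \<Rightarrow> (nat \<Rightarrow> 'a::euclidean_space) \<Rightarrow> nat \<Rightarrow> 'a" where
  "mix n P x i = (\<Sum>j<n. P $$ (i, j) *\<^sub>R x j)"

definition ip :: "nat \<Rightarrow> (nat \<Rightarrow> 'a::euclidean_space) \<Rightarrow> (nat \<Rightarrow> 'a) \<Rightarrow> real" where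
  "ip n x y = (\<Sum>i<n. inner (x i) (y i))"

text \<open>The Frobenius norm of the matrix whose rows are the vectors of the clients;
  \<open>ip\<close> is the inner product that induces it.\<close>

definition stack_norm :: "nat \<Rightarrow> (nat \<Rightarrow> 'a::euclidean_space) \<Rightarrow> real" where
  "stack_norm n x = L2_set (\<lambda>i. norm (x i)) {..<n}"

definition mean :: "nat \<Rightarrow> (nat \<Rightarrow> 'a::euclidean_space) \<Rightarrow> 'a" where
  "mean n x = (1 / real n) *\<^sub>R (\<Sum>i<n. x i)"

lemma stack_norm_power2: "(stack_norm n x)\<^sup>2 = ip n x x"
  by (simp add: stack_norm_def L2_set_def ip_def sum_nonneg power2_norm_eq_inner)

lemma stack_norm_nonneg [simp]: "0 \<le> stack_norm n x"
  by (simp add: stack_norm_def)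

lemma ip_self_nonneg [simp]: "0 \<le> ip n x x"
  by (simp add: ip_def sum_nonneg)

lemma norm_le_stack_norm: "i < n \<Longrightarrow> norm (x i) \<le> stack_norm n x"
  unfolding stack_norm_def by (rule member_le_L2_set) auto

lemma stack_norm_cong: "(\<And>i. i < n \<Longrightarrow> x i = y i) \<Longrightarrow> stack_norm n x = stack_norm n y"
  unfolding stack_norm_def by (rule L2_set_cong) auto

lemma stack_norm_triangle: "stack_norm n (\<lambda>i. x i + y i) \<le> stack_norm n x + stack_norm n y"
proof -
  have "stack_norm n (\<lambda>i. x i + y i) \<le> L2_set (\<lambda>i. norm (x i) + norm (y i)) {..<n}"
    unfolding stack_norm_def by (intro L2_set_mono norm_triangle_ineq) auto
  also have "\<dots> \<le> stack_norm n x + stack_norm n y"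
    unfolding stack_norm_def by (rule L2_set_triangle_ineq)
  finally show ?thesis .
qed

lemma stack_norm_scaleR: "stack_norm n (\<lambda>i. c *\<^sub>R x i) = \<bar>c\<bar> * stack_norm n x"
  unfolding stack_norm_def by (simp add: L2_set_right_distrib)

lemma stack_norm_single:
  assumes "i < n" "\<And>j. j < n \<Longrightarrow> j \<noteq> i \<Longrightarrow> x j = 0"
  shows "stack_norm n x = norm (x i)"
proof -
  have "(\<Sum>j<n. (norm (x j))\<^sup>2) = (\<Sum>j\<in>{i}. (norm (x j))\<^sup>2)"
    using assms by (intro sum.mono_neutral_right) auto
  then show ?thesis by (simp add: stack_norm_def L2_set_def)
qed

lemma ip_add_left: "ip n (\<lambda>i. x i + y i) z = ip n x z + ip n y z"
  and ip_add_right: "ip n z (\<lambda>i. x i + y i) = ip n z x + ip n z y"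
  and ip_diff_left: "ip n (\<lambda>i. x i - y i) z = ip n x z - ip n y z"
  and ip_diff_right: "ip n z (\<lambda>i. x i - y i) = ip n z x - ip n z y"
  and ip_scaleR_left: "ip n (\<lambda>i. c *\<^sub>R x i) z = c * ip n x z"
  and ip_scaleR_right: "ip n z (\<lambda>i. c *\<^sub>R x i) = c * ip n z x"
  and ip_commute: "ip n x z = ip n z x"
  by (simp_all add: ip_def inner_add_left inner_add_right inner_diff_left inner_diff_right
      sum.distrib sum_subtractf sum_distrib_left inner_commute)

lemmas ip_linear = ip_add_left ip_add_right ip_diff_left ip_diff_right ip_scaleR_left ip_scaleR_right

text \<open>Subtracting the mean is an orthogonal projection: it lowers the squared norm by
  \<open>n\<close> times that of the mean.\<close>

lemma stack_norm_sub_mean_le: "stack_norm n (\<lambda>i. x i - mean n x) \<le> stack_norm n x"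
proof (cases "n = 0")
  case False
  define c where "c = mean n x"
  have "ip n (\<lambda>_. c) x = inner c (\<Sum>i<n. x i)" by (simp add: ip_def inner_sum_right)
  also have "(\<Sum>i<n. x i) = real n *\<^sub>R c" using False by (simp add: c_def mean_def)
  finally have cx: "ip n (\<lambda>_. c) x = real n * inner c c" by simp
  have cc: "ip n (\<lambda>_. c) (\<lambda>_. c) = real n * inner c c" by (simp add: ip_def)
  have "ip n (\<lambda>i. x i - c) (\<lambda>i. x i - c)
      = ip n x x - ip n x (\<lambda>_. c) - (ip n (\<lambda>_. c) x - ip n (\<lambda>_. c) (\<lambda>_. c))"
    by (simp only: ip_diff_left ip_diff_right)
  also have "\<dots> = ip n x x - real n * inner c c"
    unfolding ip_commute[of n x "\<lambda>_. c"] cx cc by simp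
  also have "\<dots> \<le> ip n x x" by simp
  finally have "(stack_norm n (\<lambda>i. x i - c))\<^sup>2 \<le> (stack_norm n x)\<^sup>2"
    by (simp only: stack_norm_power2)
  then show ?thesis unfolding c_def by (rule power2_le_imp_le) simp
qed (simp add: stack_norm_def)

lemma mix_add: "mix n P (\<lambda>i. x i + y i) = (\<lambda>i. mix n P x i + mix n P y i)"
  and mix_diff: "mix n P (\<lambda>i. x i - y i) = (\<lambda>i. mix n P x i - mix n P y i)"
  and mix_scaleR: "mix n P (\<lambda>i. c *\<^sub>R x i) = (\<lambda>i. c *\<^sub>R mix n P x i)"
  by (auto simp: mix_def fun_eq_iff scaleR_add_right scaleR_diff_right sum.distrib sum_subtractf scaleR_sum_right mult.commute)

lemma mix_cong: "(\<And>i. i < n \<Longrightarrow> x i = y i) \<Longrightarrow> mix n P x = mix n P y"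
  by (auto simp: mix_def fun_eq_iff)

text \<open>On an eigenvector of eigenvalue \<open>l\<close> the momentum recursion has the
  characteristic equation \<open>z^2 = (1 + phi) * l * z - phi\<close>. For
  \<open>l = lambda2 P\<close> its discriminant vanishes and this number is the double root; for
  smaller nonnegative \<open>l\<close> the roots are complex of this modulus.\<close>

definition gossip_rate :: "real mat \<Rightarrow> real" where
  "gossip_rate P = sqrt (gossip_momentum P)"

context
  fixes n adj P
  assumes P: "gossip_matrix n adj P" and n: "2 \<le> n"
begin

lemma ip_mix_commute: "ip n x (mix n P y) = ip n (mix n P x) y"
proof -
  have "ip n x (mix n P y) = (\<Sum>i<n. \<Sum>j<n. P $$ (i, j) * inner (x i) (y j))"
    by (simp add: ip_def mix_def inner_sum_right)
  also have "\<dots> = (\<Sum>j<n. \<Sum>i<n. P $$ (j, i) * inner (x i) (y j))"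
    by (subst sum.swap) (intro sum.cong refl, simp add: gossip_matrixD(2)[OF P])
  also have "\<dots> = ip n (mix n P x) y"
    by (simp add: ip_def mix_def inner_sum_left)
  finally show ?thesis .
qed

text \<open>\<open>P\<close> acts on the client index alone, so the form splits over an orthonormal
  basis of \<open>'a\<close>.\<close>

lemma ip_mix_eq_qform:
  "ip n x (mix n P x) = (\<Sum>b\<in>Basis. qform n P (\<lambda>i. inner (x i) b) (\<lambda>i. inner (x i) b))"
proof -
  have "ip n x (mix n P x) = (\<Sum>i<n. \<Sum>j<n. \<Sum>b\<in>Basis. inner (x i) b * P $$ (i, j) * inner (x j) b)"
    unfolding ip_def mix_def inner_sum_right inner_scaleR_right
    by (subst euclidean_inner) (simp add: sum_distrib_left algebra_simps)
  also have "\<dots> = (\<Sum>i<n. \<Sum>b\<in>Basis. \<Sum>j<n. inner (x i) b * P $$ (i, j) * inner (x j) b)"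
    by (intro sum.cong refl sum.swap)
  also have "\<dots> = (\<Sum>b\<in>Basis. qform n P (\<lambda>i. inner (x i) b) (\<lambda>i. inner (x i) b))"
    unfolding qform_def by (rule sum.swap)
  finally show ?thesis .
qed

lemma ip_mix_nonneg: "0 \<le> ip n x (mix n P x)"
  unfolding ip_mix_eq_qform by (intro sum_nonneg gossip_matrixD(4)[OF P])

lemma ip_mix_le:
  assumes "(\<Sum>i<n. x i) = 0"
  shows "ip n x (mix n P x) \<le> lambda2 P * ip n x x"
proof -
  have "ip n x (mix n P x) \<le> (\<Sum>b\<in>Basis. lambda2 P * (\<Sum>i<n. (inner (x i) b)\<^sup>2))"
    unfolding ip_mix_eq_qform using assms
    by (intro sum_mono qform_le_lambda2[OF P n]) (simp flip: inner_sum_left)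
  also have "\<dots> = lambda2 P * (\<Sum>i<n. \<Sum>b\<in>Basis. (inner (x i) b)\<^sup>2)"
    by (subst sum.swap) (simp add: sum_distrib_left)
  also have "\<dots> = lambda2 P * ip n x x"
  proof -
    have "inner (x i) (x i) = (\<Sum>b\<in>Basis. (inner (x i) b)\<^sup>2)" for i
      by (subst euclidean_inner) (simp add: power2_eq_square)
    then show ?thesis by (simp add: ip_def)
  qed
  finally show ?thesis .
qed

lemma lambda2_bounds: "0 \<le> lambda2 P" "lambda2 P < 1"
  using gossip_matrixD(6,7)[OF P] by (auto simp: spectral_gap_def)

lemma sum_mix: "(\<Sum>i<n. mix n P x i) = (\<Sum>i<n. x i)"
proof -
  have "(\<Sum>i<n. mix n P x i) = (\<Sum>j<n. (\<Sum>i<n. P $$ (i, j)) *\<^sub>R x j)"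
    unfolding mix_def by (subst sum.swap) (simp add: scaleR_sum_left)
  also have "\<dots> = (\<Sum>j<n. (\<Sum>i<n. P $$ (j, i)) *\<^sub>R x j)"
    by (intro sum.cong refl arg_cong2[of _ _ _ _ "scaleR"]) (simp add: gossip_matrixD(2)[OF P])
  also have "\<dots> = (\<Sum>i<n. x i)" by (simp add: gossip_matrixD(3)[OF P])
  finally show ?thesis .
qed

lemma mix_const: "i < n \<Longrightarrow> mix n P (\<lambda>_. c) i = c"
  by (simp add: mix_def gossip_matrixD(3)[OF P] flip: scaleR_sum_left)

text \<open>With \<open>s = sqrt (1 - lambda2^2)\<close> the momentum is
  \<open>(1 - s) / (1 + s)\<close>, at most \<open>1 - s\<close>, hence at most
  \<open>exp (- s)\<close>. The last identity expresses critical damping at the second eigenvalue: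
  on zero-sum families \<open>(1 + phi) * P\<close> is bounded by twice the rate.\<close>

lemma momentum_bounds:
  shows "0 \<le> gossip_momentum P" "gossip_momentum P \<le> exp (- sqrt (spectral_gap P))" "gossip_momentum P \<le> 1"
    and rate_bounds: "0 \<le> gossip_rate P" "gossip_rate P \<le> 1" and rate_power2: "(gossip_rate P)\<^sup>2 = gossip_momentum P" and momentum_eq: "(1 + gossip_momentum P) * lambda2 P = 2 * gossip_rate P"
proof -
  define s where "s = sqrt (1 - (lambda2 P)\<^sup>2)"
  have l2: "(lambda2 P)\<^sup>2 \<le> 1" using lambda2_bounds by (simp add: power_le_one)
  have s: "0 \<le> s" "s \<le> 1" "s\<^sup>2 = 1 - (lambda2 P)\<^sup>2" using l2 by (auto simp: s_def)
  have mom_s: "gossip_momentum P = (1 - s) / (1 + s)" by (simp add: gossip_momentum_def s_def)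
  show "0 \<le> gossip_momentum P" using s by (simp add: mom_s)
  \<comment> \<open>\<open>1 - l^2 = (1 - l) * (1 + l)\<close> with \<open>l\<close> nonnegative:
    this is where the square root of the spectral gap, the gain of acceleration, comes from.\<close>
  have "spectral_gap P \<le> 1 - (lambda2 P)\<^sup>2"
    using lambda2_bounds by (simp add: spectral_gap_def power2_eq_square mult_left_le)
  then have "sqrt (spectral_gap P) \<le> s" by (simp add: s_def)
  have "gossip_momentum P \<le> 1 - s" using s mult_left_le[of s s] by (simp add: mom_s divide_simps algebra_simps)
  also have "\<dots> \<le> exp (- s)" using exp_ge_add_one_self[of "- s"] by simp
  also have "\<dots> \<le> exp (- sqrt (spectral_gap P))" using \<open>sqrt (spectral_gap P) \<le> s\<close> by simp
  finally show "gossip_momentum P \<le> exp (- sqrt (spectral_gap P))" .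
  show "gossip_momentum P \<le> 1" using s by (simp add: mom_s divide_simps)
  show "0 \<le> gossip_rate P" "gossip_rate P \<le> 1" and q2: "(gossip_rate P)\<^sup>2 = gossip_momentum P"
    using \<open>0 \<le> gossip_momentum P\<close> \<open>gossip_momentum P \<le> 1\<close> by (auto simp: gossip_rate_def)
  have "((1 + gossip_momentum P) * lambda2 P)\<^sup>2 = 4 * gossip_momentum P"
  proof -
    have "(1 + gossip_momentum P) = 2 / (1 + s)" using s by (simp add: mom_s field_simps)
    then have "((1 + gossip_momentum P) * lambda2 P)\<^sup>2 = 4 * ((1 - s) * (1 + s)) / (1 + s)\<^sup>2"
      using s(3) by (simp add: power_mult_distrib power_divide algebra_simps power2_eq_square)
    also have "\<dots> = 4 * gossip_momentum P" using s(1) by (simp add: mom_s power2_eq_square)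
    finally show ?thesis .
  qed
  then have "((1 + gossip_momentum P) * lambda2 P)\<^sup>2 = (2 * gossip_rate P)\<^sup>2" using q2 by (simp add: power_mult_distrib)
  then show "(1 + gossip_momentum P) * lambda2 P = 2 * gossip_rate P"
    by (rule power2_eq_imp_eq)
      (use lambda2_bounds(1) \<open>0 \<le> gossip_momentum P\<close> \<open>0 \<le> gossip_rate P\<close> in simp_all)
qed

section \<open>The momentum recursion on zero-sum families\<close>

definition amix :: "(nat \<Rightarrow> 'a::euclidean_space) \<Rightarrow> nat \<Rightarrow> 'a" where
  "amix x i = (1 + gossip_momentum P) *\<^sub>R mix n P x i"

lemma amix_linear:
  "amix (\<lambda>i. x i + y i) = (\<lambda>i. amix x i + amix y i)"
  "amix (\<lambda>i. x i - y i) = (\<lambda>i. amix x i - amix y i)"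
  "amix (\<lambda>i. c *\<^sub>R x i) = (\<lambda>i. c *\<^sub>R amix x i)"
  by (auto simp: amix_def fun_eq_iff mix_add mix_diff mix_scaleR algebra_simps)

lemma ip_amix_commute: "ip n x (amix y) = ip n (amix x) y"
  using ip_mix_commute[of x y] unfolding amix_def by (simp add: ip_linear)

lemma ip_amix_nonneg: "0 \<le> ip n x (amix x)"
  using ip_mix_nonneg[of x] momentum_bounds(1) unfolding amix_def by (simp add: ip_linear)

lemma ip_amix_le:
  assumes "(\<Sum>i<n. x i) = 0"
  shows "ip n x (amix x) \<le> 2 * gossip_rate P * ip n x x"
proof -
  have "ip n x (amix x) = (1 + gossip_momentum P) * ip n x (mix n P x)" unfolding amix_def by (simp add: ip_linear)
  also have "\<dots> \<le> (1 + gossip_momentum P) * (lambda2 P * ip n x x)"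
    using ip_mix_le[OF assms] momentum_bounds(1) by (intro mult_left_mono) auto
  finally show ?thesis using momentum_eq by (simp flip: mult.assoc)
qed

lemma sum_amix: "(\<Sum>i<n. amix x i) = (1 + gossip_momentum P) *\<^sub>R (\<Sum>i<n. x i)"
  unfolding amix_def by (simp add: sum_mix flip: scaleR_sum_right)

text \<open>The fundamental solution of the recursion, with values 0 and \<open>v\<close> at times 0
  and 1: up to powers of the rate, the Chebyshev polynomial of the second kind of degree
  \<open>r - 1\<close> in \<open>amix\<close>, applied to \<open>v\<close>.\<close>

fun cheb :: "(nat \<Rightarrow> 'a::euclidean_space) \<Rightarrow> nat \<Rightarrow> nat \<Rightarrow> 'a" where
  "cheb v 0 = (\<lambda>_. 0)"
| "cheb v (Suc 0) = v"
| "cheb v (Suc (Suc r)) = (\<lambda>i. amix (cheb v (Suc r)) i - gossip_momentum P *\<^sub>R cheb v r i)"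

lemma cheb_sum: "(\<Sum>i<n. v i) = 0 \<Longrightarrow> (\<Sum>i<n. cheb v r i) = 0"
  by (induction v r rule: cheb.induct) (auto simp: sum_subtractf sum_amix simp flip: scaleR_sum_right)

text \<open>The quadratic form conserved by the momentum recursion; it replaces the diagonalisation of \<open>P\<close>. At
  the extremal eigenvalue the form degenerates, and only the combination \<open>cheb (r + 1) - q cheb r\<close> is
  bounded without a factor \<open>r\<close>. The iterates of the gossip are such combinations up to a term of relative
  size \<open>(1 - q) r\<close>, which keeps \<open>\<gamma>\<close> out of the constant.\<close>
lemma cheb_conserved:
  "ip n (cheb v (Suc r)) (cheb v (Suc r)) + gossip_momentum P * ip n (cheb v r) (cheb v r)
    - ip n (cheb v (Suc r)) (amix (cheb v r)) = gossip_momentum P ^ r * ip n v v"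
proof (induction r)
  case 0
  show ?case by (simp add: ip_def amix_def mix_def)
next
  case (Suc r)
  let ?a = "cheb v (Suc r)" and ?b = "cheb v r"
  have "ip n (amix ?a) ?b = ip n ?a (amix ?b)" by (simp add: ip_amix_commute)
  moreover have "ip n ?b (amix ?a) = ip n ?a (amix ?b)"
    by (subst ip_amix_commute) (rule ip_commute)
  ultimately have "ip n (cheb v (Suc (Suc r))) (cheb v (Suc (Suc r))) + gossip_momentum P * ip n ?a ?a
      - ip n (cheb v (Suc (Suc r))) (amix ?a)
    = gossip_momentum P * (ip n ?a ?a + gossip_momentum P * ip n ?b ?b - ip n ?a (amix ?b))"
    by (simp add: ip_linear algebra_simps)
  then show ?case using Suc by simp
qed

text \<open>Let \<open>q\<close> be the rate, and \<open>m\<close> and \<open>p\<close> the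
  difference and the sum of the new iterate and \<open>q\<close> times the old one. Then
  \<open>4 * q\<close> times the conserved form equals
  \<open>2 * q * ip n m m + ip n m (amix m)\<close> plus the gap
  \<open>2 * q * ip n p p - ip n p (amix p)\<close>. The form of \<open>amix\<close> and the gap are
  nonnegative on zero-sum families, which leaves the factor \<open>sqrt 2\<close>.\<close>

lemma cheb_step_bound:
  assumes v: "(\<Sum>i<n. v i) = 0"
  shows "stack_norm n (\<lambda>i. cheb v (Suc r) i - gossip_rate P *\<^sub>R cheb v r i) \<le> sqrt 2 * gossip_rate P ^ r * stack_norm n v"
proof (cases "gossip_rate P = 0")
  case True
  then have mom0: "gossip_momentum P = 0" using rate_power2 by simp
  \<comment> \<open>At rate zero that identity carries no information. Here the form of
    \<open>amix\<close> vanishes on zero-sum families, and evaluating it at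
    \<open>x + amix x\<close> shows that \<open>amix\<close> itself vanishes there.\<close>
  have form0: "ip n x (amix x) = 0" if "(\<Sum>i<n. x i) = 0" for x
    using ip_amix_nonneg[of x] ip_amix_le[OF that] True by simp
  have zero: "ip n (amix x) (amix x) = 0" if x: "(\<Sum>i<n. x i) = 0" for x
  proof -
    have y: "(\<Sum>i<n. amix x i) = 0" using x by (simp add: sum_amix)
    have "(\<Sum>i<n. x i + amix x i) = 0" using x y by (simp add: sum.distrib)
    from form0[OF this] have "ip n x (amix (amix x)) + ip n (amix x) (amix x) = 0"
      using form0[OF x] form0[OF y] by (simp add: amix_linear ip_linear)
    then show ?thesis by (simp add: ip_amix_commute)
  qed
  show ?thesis
  proof (cases r)
    case 0
    have "1 * stack_norm n v \<le> sqrt 2 * stack_norm n v" by (intro mult_right_mono) auto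
    then show ?thesis using 0 by simp
  next
    case (Suc r')
    have "stack_norm n (amix (cheb v r)) = 0"
      using zero[OF cheb_sum[OF v, of r]] by (simp flip: stack_norm_power2)
    then show ?thesis using Suc mom0 True by simp
  qed
next
  case False
  have rt: "gossip_rate P > 0" "(gossip_rate P)\<^sup>2 = gossip_momentum P" using False rate_bounds(1) rate_power2 by auto
  let ?a = "cheb v (Suc r)" and ?b = "cheb v r"
  let ?m = "\<lambda>i. ?a i - gossip_rate P *\<^sub>R ?b i" and ?p = "\<lambda>i. ?a i + gossip_rate P *\<^sub>R ?b i"
  have "(\<Sum>i<n. ?p i) = 0"
    using cheb_sum[OF v, of r] cheb_sum[OF v, of "Suc r"] by (simp add: sum.distrib flip: scaleR_sum_right)
  from ip_amix_le[OF this] have pos1: "0 \<le> 2 * gossip_rate P * ip n ?p ?p - ip n ?p (amix ?p)" by simp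
  have pos2: "0 \<le> ip n ?m (amix ?m)" by (rule ip_amix_nonneg)
  have e: "ip n ?a ?a + (gossip_rate P)\<^sup>2 * ip n ?b ?b - ip n ?a (amix ?b) = gossip_momentum P ^ r * ip n v v"
    using cheb_conserved[of v r] rt(2) by simp
  have expand: "2 * gossip_rate P * ip n ?m ?m + ip n ?m (amix ?m) + (2 * gossip_rate P * ip n ?p ?p - ip n ?p (amix ?p))
      = 4 * gossip_rate P * (ip n ?a ?a + (gossip_rate P)\<^sup>2 * ip n ?b ?b - ip n ?a (amix ?b))"
    using ip_amix_commute[of ?b ?a] ip_commute[of n ?b ?a] ip_commute[of n "amix ?b" ?a]
    by (simp add: amix_linear ip_linear algebra_simps power2_eq_square)
  from expand[unfolded e] pos1 pos2 have "2 * gossip_rate P * ip n ?m ?m \<le> 4 * gossip_rate P * (gossip_momentum P ^ r * ip n v v)" by linarith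
  then have "2 * gossip_rate P * ip n ?m ?m \<le> 2 * gossip_rate P * (2 * gossip_momentum P ^ r * ip n v v)" by (simp add: mult.assoc)
  then have "ip n ?m ?m \<le> 2 * gossip_momentum P ^ r * ip n v v" using rt(1) by (subst (asm) mult_le_cancel_left_pos) auto
  also have "\<dots> = (sqrt 2 * gossip_rate P ^ r * stack_norm n v)\<^sup>2"
  proof -
    have "(gossip_rate P ^ r)\<^sup>2 = gossip_momentum P ^ r" unfolding rt(2)[symmetric] by (simp add: mult.commute flip: power_mult)
    then show ?thesis by (simp add: power_mult_distrib stack_norm_power2)
  qed
  finally have "(stack_norm n ?m)\<^sup>2 \<le> (sqrt 2 * gossip_rate P ^ r * stack_norm n v)\<^sup>2"
    by (simp only: stack_norm_power2)
  then show ?thesis by (rule power2_le_imp_le) (simp add: rate_bounds(1))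
qed

text \<open>Adding up the one-step bounds costs a factor \<open>r\<close>. The rate stays on the
  left as a factor so that rate zero needs no division.\<close>

lemma cheb_bound:
  assumes v: "(\<Sum>i<n. v i) = 0"
  shows "gossip_rate P * stack_norm n (cheb v r) \<le> sqrt 2 * real r * gossip_rate P ^ r * stack_norm n v"
proof (induction r)
  case 0
  show ?case by (simp add: stack_norm_def L2_set_def)
next
  case (Suc r)
  note q0 = rate_bounds(1)
  have "stack_norm n (cheb v (Suc r)) = stack_norm n (\<lambda>i. (cheb v (Suc r) i - gossip_rate P *\<^sub>R cheb v r i) + gossip_rate P *\<^sub>R cheb v r i)"
    by simp
  also have "\<dots> \<le> stack_norm n (\<lambda>i. cheb v (Suc r) i - gossip_rate P *\<^sub>R cheb v r i) + gossip_rate P * stack_norm n (cheb v r)"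
    using stack_norm_triangle[of n "\<lambda>i. cheb v (Suc r) i - gossip_rate P *\<^sub>R cheb v r i" "\<lambda>i. gossip_rate P *\<^sub>R cheb v r i"] q0
    by (simp only: stack_norm_scaleR abs_of_nonneg)
  also have "\<dots> \<le> sqrt 2 * gossip_rate P ^ r * stack_norm n v + sqrt 2 * real r * gossip_rate P ^ r * stack_norm n v"
    by (intro add_mono cheb_step_bound[OF v] Suc)
  finally have "gossip_rate P * stack_norm n (cheb v (Suc r))
      \<le> gossip_rate P * (sqrt 2 * gossip_rate P ^ r * stack_norm n v + sqrt 2 * real r * gossip_rate P ^ r * stack_norm n v)"
    using q0 by (rule mult_left_mono)
  then show ?case by (simp add: algebra_simps)
qed

text \<open>Each \<open>p^k\<close> with \<open>k < r\<close> is at least \<open>p^r\<close>, so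
  \<open>r * p^r\<close> is at most the geometric sum. This lets half of the decay pay for the
  factor \<open>r\<close>.\<close>

lemma mult_power_le:
  fixes p :: real
  assumes "0 \<le> p" "p \<le> 1"
  shows "(1 - p\<^sup>2) * (real r * p ^ r) \<le> 2"
proof -
  have "real r * p ^ r = (\<Sum>k<r. p ^ r)" by simp
  also have "\<dots> \<le> (\<Sum>k<r. p ^ k)" using assms by (intro sum_mono power_decreasing) auto
  finally have "(1 - p\<^sup>2) * (real r * p ^ r) \<le> (1 - p\<^sup>2) * (\<Sum>k<r. p ^ k)"
    using assms by (intro mult_left_mono) (auto simp: power_le_one)
  also have "\<dots> = (1 + p) * ((1 - p) * (\<Sum>k<r. p ^ k))"
  proof -
    have "1 - p\<^sup>2 = (1 + p) * (1 - p)" by (simp add: power2_eq_square algebra_simps)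
    then show ?thesis by (simp only: mult.assoc)
  qed
  also have "(1 - p) * (\<Sum>k<r. p ^ k) = 1 - p ^ r"
    by (rule one_diff_power_eq[symmetric])
  also have "(1 + p) * (1 - p ^ r) \<le> (1 + 1) * (1 - 0)"
    using assms by (intro mult_mono) (auto simp: power_le_one)
  finally show ?thesis by simp
qed

text \<open>With \<open>q\<close> the rate, \<open>q^r\<close> is written as
  \<open>p^r * p^r\<close>: one factor absorbs \<open>(1 - q) * r\<close>, the other remains as
  decay. As \<open>p\<close> is the fourth root of the momentum, the exponent carries a quarter. The
  5 rounds up \<open>3 * sqrt 2\<close>.\<close>

lemma cheb_combination_bound:
  assumes v: "(\<Sum>i<n. v i) = 0"
  shows "stack_norm n (\<lambda>i. cheb v (Suc r) i - gossip_momentum P *\<^sub>R cheb v r i)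
    \<le> 5 * exp (- sqrt (spectral_gap P) * real r / 4) * stack_norm n v"
proof -
  define p where "p = sqrt (gossip_rate P)"
  have p: "0 \<le> p" "p \<le> 1" "p\<^sup>2 = gossip_rate P" "gossip_rate P \<le> 1" "0 \<le> gossip_rate P" "(gossip_rate P)\<^sup>2 = gossip_momentum P"
    using rate_bounds rate_power2 by (auto simp: p_def)
  have "stack_norm n (\<lambda>i. cheb v (Suc r) i - gossip_momentum P *\<^sub>R cheb v r i)
    = stack_norm n (\<lambda>i. (cheb v (Suc r) i - gossip_rate P *\<^sub>R cheb v r i) + (gossip_rate P - (gossip_rate P)\<^sup>2) *\<^sub>R cheb v r i)"
    unfolding p(6) by (rule stack_norm_cong) (simp add: algebra_simps)
  also have "\<dots> \<le> stack_norm n (\<lambda>i. cheb v (Suc r) i - gossip_rate P *\<^sub>R cheb v r i) + (1 - gossip_rate P) * (gossip_rate P * stack_norm n (cheb v r))"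
  proof -
    have "(gossip_rate P)\<^sup>2 \<le> gossip_rate P" using p mult_left_le[of "gossip_rate P" "gossip_rate P"] by (simp add: power2_eq_square)
    then have "stack_norm n (\<lambda>i. (gossip_rate P - (gossip_rate P)\<^sup>2) *\<^sub>R cheb v r i) = (gossip_rate P - (gossip_rate P)\<^sup>2) * stack_norm n (cheb v r)"
      by (simp only: stack_norm_scaleR abs_of_nonneg diff_ge_0_iff_ge)
    also have "\<dots> = (1 - gossip_rate P) * (gossip_rate P * stack_norm n (cheb v r))"
      by (simp add: power2_eq_square algebra_simps)
    finally show ?thesis
      using stack_norm_triangle[of n "\<lambda>i. cheb v (Suc r) i - gossip_rate P *\<^sub>R cheb v r i" "\<lambda>i. (gossip_rate P - (gossip_rate P)\<^sup>2) *\<^sub>R cheb v r i"]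
      by simp
  qed
  also have "\<dots> \<le> sqrt 2 * gossip_rate P ^ r * stack_norm n v + (1 - gossip_rate P) * (sqrt 2 * real r * gossip_rate P ^ r * stack_norm n v)"
    using p by (intro add_mono cheb_step_bound[OF v] mult_left_mono cheb_bound[OF v]) auto
  also have "\<dots> = (p ^ r + (1 - p\<^sup>2) * (real r * p ^ r)) * (sqrt 2 * p ^ r * stack_norm n v)"
  proof -
    have "(p\<^sup>2) ^ r = p ^ r * p ^ r" by (simp add: power2_eq_square power_mult_distrib)
    then show ?thesis unfolding p(3)[symmetric] by (simp add: algebra_simps)
  qed
  also have "\<dots> \<le> (1 + 2) * (sqrt 2 * p ^ r * stack_norm n v)"
    using p by (intro mult_right_mono add_mono mult_power_le) (auto simp: power_le_one)
  also have "\<dots> = (3 * sqrt 2) * (p ^ r * stack_norm n v)" by simp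
  also have "\<dots> \<le> 5 * (p ^ r * stack_norm n v)"
  proof (intro mult_right_mono)
    have "sqrt 2 \<le> sqrt ((5/3)\<^sup>2)" by (intro real_sqrt_le_mono) (simp add: power2_eq_square)
    then show "3 * sqrt 2 \<le> 5" by simp
  qed (use p in auto)
  also have "\<dots> \<le> 5 * (exp (- sqrt (spectral_gap P) * real r / 4) * stack_norm n v)"
  proof -
    have "p ^ 4 = gossip_momentum P" unfolding p(6)[symmetric] p(3)[symmetric] by simp
    also have "\<dots> \<le> exp (- sqrt (spectral_gap P))" by (rule momentum_bounds)
    also have "\<dots> = exp (- sqrt (spectral_gap P) / 4) ^ 4" by (simp flip: exp_of_nat_mult)
    finally have "p \<le> exp (- sqrt (spectral_gap P) / 4)"
      using p(1) by (simp add: power_mono_iff)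
    then have "p ^ r \<le> exp (- sqrt (spectral_gap P) / 4) ^ r" using p(1) by (rule power_mono)
    also have "\<dots> = exp (- sqrt (spectral_gap P) * real r / 4)"
      by (simp add: algebra_simps flip: exp_of_nat_mult)
    finally have "p ^ r \<le> exp (- sqrt (spectral_gap P) * real r / 4)" .
    then show ?thesis by (intro mult_left_mono mult_right_mono) auto
  qed
  finally show ?thesis by (simp only: mult.assoc)
qed

section \<open>Gossip iterates in terms of the recursion\<close>

lemma fast_gossip_iter_rounds: "snd (snd (fast_gossip_iter n P z r)) = r"
  by (induction r) (auto simp: Let_def case_prod_unfold)

lemma fast_gossip_iter_Suc_0:
  "fst (snd (fast_gossip_iter n P z (Suc 0))) i = amix z i - gossip_momentum P *\<^sub>R z i"
  by (simp add: amix_def mix_def Let_def)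

lemma fast_gossip_iter_Suc_Suc:
  "fst (snd (fast_gossip_iter n P z (Suc (Suc r)))) i
    = amix (fst (snd (fast_gossip_iter n P z (Suc r)))) i - gossip_momentum P *\<^sub>R fst (snd (fast_gossip_iter n P z r)) i"
  by (simp add: amix_def mix_def Let_def case_prod_unfold)

text \<open>Starting with two equal iterates selects this combination: it equals the deviation
  \<open>v\<close> at time 0 and \<open>amix v - phi * v\<close> at time 1, and both sides satisfy
  the same recursion. The mean is stationary because the weights \<open>1 + phi\<close> and
  \<open>- phi\<close> add up to one.\<close>

lemma fast_gossip_iter_eq_cheb:
  assumes "i < n"
  shows "fst (snd (fast_gossip_iter n P z r)) i - mean n z
    = cheb (\<lambda>i. z i - mean n z) (Suc r) i - gossip_momentum P *\<^sub>R cheb (\<lambda>i. z i - mean n z) r i"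
  using assms
proof (induction r arbitrary: i rule: induct_nat_012)
  case 0
  then show ?case by simp
next
  case 1
  then have "amix (\<lambda>i. z i - mean n z) i = amix z i - (1 + gossip_momentum P) *\<^sub>R mean n z"
    unfolding amix_linear by (simp add: amix_def mix_const)
  then show ?case by (simp add: fast_gossip_iter_Suc_0 algebra_simps del: fast_gossip_iter.simps)
next
  case (ge2 r)
  let ?v = "\<lambda>i. z i - mean n z" and ?Z = "\<lambda>r. fst (snd (fast_gossip_iter n P z r))"
  have "mix n P (\<lambda>i. ?Z (Suc r) i - mean n z) = mix n P (\<lambda>i. cheb ?v (Suc (Suc r)) i - gossip_momentum P *\<^sub>R cheb ?v (Suc r) i)"
    by (rule mix_cong) (rule ge2(2))
  then have "amix (\<lambda>i. ?Z (Suc r) i - mean n z) i = amix (\<lambda>i. cheb ?v (Suc (Suc r)) i - gossip_momentum P *\<^sub>R cheb ?v (Suc r) i) i"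
    by (simp only: amix_def)
  moreover have "amix (\<lambda>i. ?Z (Suc r) i - mean n z) i = amix (?Z (Suc r)) i - (1 + gossip_momentum P) *\<^sub>R mean n z"
    unfolding amix_linear using ge2(3) by (simp add: amix_def mix_const del: fast_gossip_iter.simps)
  ultimately have "amix (?Z (Suc r)) i = (1 + gossip_momentum P) *\<^sub>R mean n z
      + amix (cheb ?v (Suc (Suc r))) i - gossip_momentum P *\<^sub>R amix (cheb ?v (Suc r)) i"
    by (simp only: amix_linear) (simp add: algebra_simps del: cheb.simps fast_gossip_iter.simps)
  moreover have "?Z r i = mean n z + cheb ?v (Suc r) i - gossip_momentum P *\<^sub>R cheb ?v r i"
    using ge2(1)[OF ge2(3)] by (simp add: algebra_simps del: cheb.simps fast_gossip_iter.simps)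
  moreover have "cheb ?v (Suc (Suc (Suc r))) i = amix (cheb ?v (Suc (Suc r))) i - gossip_momentum P *\<^sub>R cheb ?v (Suc r) i"
    "cheb ?v (Suc (Suc r)) i = amix (cheb ?v (Suc r)) i - gossip_momentum P *\<^sub>R cheb ?v r i"
    by simp_all
  ultimately show ?case
    unfolding fast_gossip_iter_Suc_Suc by (simp only:) (simp add: algebra_simps del: cheb.simps fast_gossip_iter.simps)
qed

lemma snd_fast_gossip: "snd (fast_gossip n P R z) = R"
  by (simp add: fast_gossip_def fast_gossip_iter_rounds)

theorem fast_gossip_contraction:
  "stack_norm n (\<lambda>i. fst (fast_gossip n P R z) i - mean n z)
    \<le> 5 * exp (- sqrt (spectral_gap P) * real R / 4) * stack_norm n (\<lambda>i. z i - mean n z)"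
proof -
  let ?v = "\<lambda>i. z i - mean n z"
  have "(\<Sum>i<n. ?v i) = 0"
    using n by (simp add: sum_subtractf mean_def sum_constant_scaleR)
  from cheb_combination_bound[OF this, of R] show ?thesis
    by (simp add: fast_gossip_def fast_gossip_iter_eq_cheb cong: stack_norm_cong del: cheb.simps)
qed

theorem mean_fast_gossip: "mean n (fst (fast_gossip n P R z)) = mean n z"
proof -
  have "(\<Sum>i<n. fst (snd (fast_gossip_iter n P z r)) i) = (\<Sum>i<n. z i)" for r
  proof (induction r rule: induct_nat_012)
    case 1
    show ?case
      by (simp add: fast_gossip_iter_Suc_0 sum_subtractf sum_amix algebra_simps
          del: fast_gossip_iter.simps flip: scaleR_sum_right)
  next
    case (ge2 r)
    then show ?case
      by (simp add: fast_gossip_iter_Suc_Suc sum_subtractf sum_amix algebra_simps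
          del: fast_gossip_iter.simps flip: scaleR_sum_right)
  qed simp
  then show ?thesis by (simp add: mean_def fast_gossip_def)
qed

end

section \<open>Gradients\<close>

lemma GDERIV_unique:
  assumes "GDERIV f x :> g" "GDERIV f x :> g'"
  shows "g = g'"
proof -
  have "(\<lambda>h. inner h g) = (\<lambda>h. inner h g')"
    using assms unfolding gderiv_def by (rule has_derivative_unique)
  then have "inner (g - g') g = inner (g - g') g'" by metis
  then have "inner (g - g') (g - g') = 0" by (simp add: inner_diff_right)
  then show ?thesis by simp
qed

lemma nabla_eqI: "GDERIV f x :> g \<Longrightarrow> nabla f x = g"
  unfolding nabla_def by (rule the_equality) (auto dest: GDERIV_unique)

lemma GDERIV_nabla: "has_gradient f x \<Longrightarrow> GDERIV f x :> nabla f x"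
  unfolding has_gradient_def using nabla_eqI by blast

lemma GDERIV_iff:
  "GDERIV f x :> g \<longleftrightarrow>
    (\<forall>e>0. \<exists>d>0. \<forall>h. norm h < d \<longrightarrow> \<bar>f (x + h) - f x - inner h g\<bar> \<le> e * norm h)" (is "_ \<longleftrightarrow> ?R")
proof -
  have "bounded_linear (\<lambda>h. inner h g)" by (rule bounded_linear_inner_left)
  moreover have "(\<forall>y. norm (y - x) < d \<longrightarrow> norm (f y - f x - inner (y - x) g) \<le> e * norm (y - x))
    \<longleftrightarrow> (\<forall>h. norm h < d \<longrightarrow> \<bar>f (x + h) - f x - inner h g\<bar> \<le> e * norm h)" for e d
    by (metis add_diff_cancel_left' diff_add_cancel add.commute real_norm_def)
  ultimately show ?thesis unfolding gderiv_def has_derivative_at_alt by simp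
qed

text \<open>A short step along the gradient changes \<open>f\<close> by almost the norm of the
  gradient per unit length, and the Lipschitz bound limits that rate.\<close>

lemma norm_nabla_le:
  assumes lip: "\<And>y. \<bar>f x - f y\<bar> \<le> C * norm (x - y)" and g: "has_gradient f x"
  shows "norm (nabla f x) \<le> C"
proof (rule field_le_epsilon)
  fix e :: real assume e: "e > 0"
  let ?g = "nabla f x"
  obtain d where d: "d > 0" "\<And>h. norm h < d \<Longrightarrow> \<bar>f (x + h) - f x - inner h ?g\<bar> \<le> e * norm h"
    using GDERIV_nabla[OF g] e unfolding GDERIV_iff by blast
  obtain b :: 'a where b: "b \<in> Basis" using nonempty_Basis by blast
  have C: "0 \<le> C" using lip[of "x + b"] b by (smt (verit) add_diff_cancel_left' norm_Basis norm_minus_commute mult_cancel_left2)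
  show "norm ?g \<le> C + e"
  proof (cases "?g = 0")
    case False
    \<comment> \<open>Half the admissible step length, directed along the gradient.\<close>
    define t where "t = d / (2 * norm ?g)"
    have t: "t > 0" "norm (t *\<^sub>R ?g) < d" using d(1) False by (auto simp: t_def)
    have "t * (norm ?g)\<^sup>2 = inner (t *\<^sub>R ?g) ?g" by (simp add: power2_norm_eq_inner)
    also have "\<dots> \<le> \<bar>f (x + t *\<^sub>R ?g) - f x - inner (t *\<^sub>R ?g) ?g\<bar> + \<bar>f x - f (x + t *\<^sub>R ?g)\<bar>" by linarith
    also have "\<dots> \<le> e * norm (t *\<^sub>R ?g) + C * norm (t *\<^sub>R ?g)"
      using d(2)[OF t(2)] lip[of "x + t *\<^sub>R ?g"] by (simp add: norm_minus_commute)
    also have "\<dots> = t * ((C + e) * norm ?g)" using t(1) by (simp add: algebra_simps)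
    finally have "norm ?g * norm ?g \<le> (C + e) * norm ?g" using t(1) by (simp add: power2_eq_square)
    then show ?thesis using False by simp
  qed (use C e in simp)
qed

section \<open>Measurability of the gradient\<close>

definition diff_quot :: "('a::euclidean_space \<Rightarrow> real) \<Rightarrow> 'a \<Rightarrow> nat \<Rightarrow> 'a" where
  "diff_quot f x k = (\<Sum>b\<in>Basis. (real (Suc k) * (f (x + (1 / real (Suc k)) *\<^sub>R b) - f x)) *\<^sub>R b)"

lemma diff_quot_tendsto:
  assumes "GDERIV f x :> g"
  shows "diff_quot f x \<longlonglongrightarrow> g"
proof -
  have "(\<lambda>k. real (Suc k) * (f (x + (1 / real (Suc k)) *\<^sub>R b) - f x)) \<longlonglongrightarrow> inner g b" if b: "b \<in> Basis" for b
  proof (rule LIMSEQ_I)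
    fix r :: real assume r: "r > 0"
    then obtain d where d: "d > 0" "\<And>h. norm h < d \<Longrightarrow> \<bar>f (x + h) - f x - inner h g\<bar> \<le> r / 2 * norm h"
      using assms unfolding GDERIV_iff by (meson half_gt_zero)
    obtain N where N: "1 / real (Suc N) < d" using d(1) nat_approx_posE by metis
    show "\<exists>no. \<forall>n\<ge>no. norm (real (Suc n) * (f (x + (1 / real (Suc n)) *\<^sub>R b) - f x) - inner g b) < r"
    proof (intro exI allI impI)
      fix n assume n: "N \<le> n"
      let ?k = "real (Suc n)"
      have nh: "norm ((1 / ?k) *\<^sub>R b) = 1 / ?k" using b by simp
      have "1 / ?k \<le> 1 / real (Suc N)" using n by (simp add: frac_le)
      then have "\<bar>f (x + (1 / ?k) *\<^sub>R b) - f x - inner ((1 / ?k) *\<^sub>R b) g\<bar> \<le> r / 2 * (1 / ?k)"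
        using d(2)[of "(1 / ?k) *\<^sub>R b"] N unfolding nh by linarith
      then have "?k * \<bar>f (x + (1 / ?k) *\<^sub>R b) - f x - inner ((1 / ?k) *\<^sub>R b) g\<bar> \<le> ?k * (r / 2 * (1 / ?k))"
        by (intro mult_left_mono) auto
      also have "?k * (r / 2 * (1 / ?k)) = r / 2" by (simp del: of_nat_Suc)
      also have "?k * \<bar>f (x + (1 / ?k) *\<^sub>R b) - f x - inner ((1 / ?k) *\<^sub>R b) g\<bar>
        = \<bar>?k * (f (x + (1 / ?k) *\<^sub>R b) - f x - inner ((1 / ?k) *\<^sub>R b) g)\<bar>"
        by (simp add: abs_mult del: of_nat_Suc)
      also have "?k * (f (x + (1 / ?k) *\<^sub>R b) - f x - inner ((1 / ?k) *\<^sub>R b) g)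
        = ?k * (f (x + (1 / ?k) *\<^sub>R b) - f x) - inner g b"
        by (simp add: right_diff_distrib inner_commute del: of_nat_Suc)
      finally show "norm (?k * (f (x + (1 / ?k) *\<^sub>R b) - f x) - inner g b) < r" using r by simp
    qed
  qed
  then have "(\<lambda>k. \<Sum>b\<in>Basis. (real (Suc k) * (f (x + (1 / real (Suc k)) *\<^sub>R b) - f x)) *\<^sub>R b)
      \<longlonglongrightarrow> (\<Sum>b\<in>Basis. inner g b *\<^sub>R b)"
    by (intro tendsto_intros)
  then show ?thesis unfolding diff_quot_def by (simp add: euclidean_representation)
qed

text \<open>Prepares measurability by removing uncountable quantifiers. The gradient, if any, is the
  limit of difference quotients along a fixed sequence of steps, so no candidate has to be
  quantified over; and by continuity of \<open>f\<close> it is enough to test increments from a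
  dense set, which is later chosen countable.\<close>

lemma has_gradient_iff_countable:
  assumes cont: "continuous_on UNIV f"
    and D: "\<And>X. open X \<Longrightarrow> X \<noteq> {} \<Longrightarrow> \<exists>d\<in>D. d \<in> X"
  shows "has_gradient f x \<longleftrightarrow> Cauchy (diff_quot f x) \<and>
    (\<forall>m. \<exists>k. \<forall>h\<in>D. norm h < 1 / real (Suc k) \<longrightarrow>
      \<bar>f (x + h) - f x - inner h (lim (diff_quot f x))\<bar> \<le> 1 / real (Suc m) * norm h)" (is "_ \<longleftrightarrow> _ \<and> ?R")
proof
  assume g: "has_gradient f x"
  note G = GDERIV_nabla[OF g]
  have l: "diff_quot f x \<longlonglongrightarrow> nabla f x" by (rule diff_quot_tendsto[OF G])
  have ?R unfolding limI[OF l]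
  proof
    fix m
    have "0 < 1 / real (Suc m)" by simp
    then obtain d where "d > 0" "\<And>h. norm h < d \<Longrightarrow> \<bar>f (x + h) - f x - inner h (nabla f x)\<bar> \<le> 1 / real (Suc m) * norm h"
      using G unfolding GDERIV_iff by blast
    moreover obtain k where "1 / real (Suc k) < d" using \<open>d > 0\<close> nat_approx_posE by metis
    ultimately show "\<exists>k. \<forall>h\<in>D. norm h < 1 / real (Suc k) \<longrightarrow>
      \<bar>f (x + h) - f x - inner h (nabla f x)\<bar> \<le> 1 / real (Suc m) * norm h"
      by (meson order.strict_trans)
  qed
  then show "Cauchy (diff_quot f x) \<and> ?R" using LIMSEQ_imp_Cauchy[OF l] by blast
next
  assume R: "Cauchy (diff_quot f x) \<and> ?R"
  let ?g = "lim (diff_quot f x)"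
  have "GDERIV f x :> ?g"
    unfolding GDERIV_iff
  proof (intro allI impI)
    fix e :: real assume "e > 0"
    then obtain m where m: "1 / real (Suc m) < e" using nat_approx_posE by metis
    obtain k where k: "\<And>h. h \<in> D \<Longrightarrow> norm h < 1 / real (Suc k) \<Longrightarrow>
        \<bar>f (x + h) - f x - inner h ?g\<bar> \<le> 1 / real (Suc m) * norm h"
      using R by meson
    have "\<bar>f (x + h) - f x - inner h ?g\<bar> \<le> 1 / real (Suc m) * norm h" if h: "norm h < 1 / real (Suc k)" for h
    proof (rule ccontr)
      \<comment> \<open>The increments that violate the estimate form an open set, so if there is
        one there is one in \<open>D\<close>.\<close>
      let ?bad = "{h. norm h < 1 / real (Suc k) \<and> 1 / real (Suc m) * norm h < \<bar>f (x + h) - f x - inner h ?g\<bar>}"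
      assume "\<not> ?thesis"
      then have "?bad \<noteq> {}" using h by (auto simp: not_le)
      moreover have "open ?bad"
        by (intro open_Collect_conj open_Collect_less continuous_intros continuous_on_compose2[OF cont]) auto
      ultimately obtain h' where "h' \<in> D" "h' \<in> ?bad" using D by blast
      then show False using k[of h'] by auto
    qed
    moreover have "1 / real (Suc m) * norm h \<le> e * norm h" for h :: 'a
      using m by (intro mult_right_mono) auto
    ultimately show "\<exists>d>0. \<forall>h. norm h < d \<longrightarrow> \<bar>f (x + h) - f x - inner h ?g\<bar> \<le> e * norm h"
      by (intro exI[of _ "1 / real (Suc k)"]) (auto intro: order.trans)
  qed
  then show "has_gradient f x" by (auto simp: has_gradient_def)
qed

text \<open>The point is approximated by simple functions. On each of their finitely many values
  measurability in the sample suffices, and continuity in the point passes to the limit.\<close>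

lemma borel_measurable_Caratheodory:
  fixes F :: "'a::euclidean_space \<Rightarrow> 'x \<Rightarrow> real"
  assumes meas: "\<And>x. F x \<in> borel_measurable M"
    and cont: "\<And>\<xi>. \<xi> \<in> space M \<Longrightarrow> continuous_on UNIV (\<lambda>x. F x \<xi>)"
  shows "(\<lambda>p. F (fst p) (snd p)) \<in> borel_measurable (borel \<Otimes>\<^sub>M M)"
proof -
  have "(\<lambda>x::'a. x) \<in> borel_measurable borel" by simp
  from borel_measurable_implies_sequence_metric[OF this, of 0]
  obtain s :: "nat \<Rightarrow> 'a \<Rightarrow> 'a" where s: "\<And>k. simple_function borel (s k)"
    and lim: "\<And>x. (\<lambda>k. s k x) \<longlonglongrightarrow> x" by auto
  have fin: "finite (range (s k))" for k using simple_functionD(1)[OF s[of k]] by simp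
  show ?thesis
  proof (rule borel_measurable_LIMSEQ_metric)
    fix k
    have "s k \<in> measurable borel (count_space (range (s k)))"
      using s[of k] fin[of k] by (intro measurable_count_space_eq2[THEN iffD2]) (auto simp: simple_function_def)
    then have "(\<lambda>p. s k (fst p)) \<in> measurable (borel \<Otimes>\<^sub>M M) (count_space (range (s k)))"
      by (rule measurable_compose[OF measurable_fst])
    moreover have "(\<lambda>p. F x (snd p)) \<in> borel_measurable (borel \<Otimes>\<^sub>M M)" for x
      by (rule measurable_compose[OF measurable_snd meas])
    ultimately show "(\<lambda>p. F (s k (fst p)) (snd p)) \<in> borel_measurable (borel \<Otimes>\<^sub>M M)"
      by (intro measurable_compose_countable'[where f="\<lambda>x p. F x (snd p)" and g="\<lambda>p. s k (fst p)" and I="range (s k)"])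
        (auto intro: countable_finite fin)
  next
    fix p assume "p \<in> space ((borel :: 'a measure) \<Otimes>\<^sub>M M)"
    then have "snd p \<in> space M" by (auto simp: space_pair_measure)
    from continuous_on_tendsto_compose[OF cont[OF this] lim[of "fst p"]]
    show "(\<lambda>k. F (s k (fst p)) (snd p)) \<longlonglongrightarrow> F (fst p) (snd p)" by simp
  qed
qed

text \<open>Joint measurability in point and sample is required because the algorithm evaluates a
  random gradient at a random point.\<close>

lemma
  fixes F :: "'a::euclidean_space \<Rightarrow> 'x \<Rightarrow> real"
  assumes meas: "\<And>x. F x \<in> borel_measurable M"
    and cont: "\<And>\<xi>. \<xi> \<in> space M \<Longrightarrow> continuous_on UNIV (\<lambda>x. F x \<xi>)"
  shows pred_has_gradient:
      "Measurable.pred (borel \<Otimes>\<^sub>M M) (\<lambda>p. has_gradient (\<lambda>u. F u (snd p)) (fst p))" (is ?A)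
    and borel_measurable_nabla:
      "(\<lambda>p. nabla (\<lambda>u. F u (snd p)) (fst p)) \<in> borel_measurable (borel \<Otimes>\<^sub>M M)" (is ?B)
proof -
  obtain D :: "'a set" where D: "countable D" "\<And>X. open X \<Longrightarrow> X \<noteq> {} \<Longrightarrow> \<exists>d\<in>D. d \<in> X"
    by (erule countable_dense_setE)
  note [measurable] = borel_measurable_Caratheodory[OF meas cont]
  have F_shift[measurable]: "(\<lambda>p. F (fst p + h) (snd p)) \<in> borel_measurable (borel \<Otimes>\<^sub>M M)" for h
    using measurable_compose[OF _ borel_measurable_Caratheodory[OF meas cont], of "\<lambda>p. (fst p + h, snd p)" "borel \<Otimes>\<^sub>M M"]
    by simp
  have Q[measurable]: "(\<lambda>p. diff_quot (\<lambda>u. F u (snd p)) (fst p) k) \<in> borel_measurable (borel \<Otimes>\<^sub>M M)" for k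
    unfolding diff_quot_def by measurable
  define W where "W p \<longleftrightarrow> Cauchy (diff_quot (\<lambda>u. F u (snd p)) (fst p)) \<and>
    (\<forall>m. \<exists>k. \<forall>h\<in>D. norm h < 1 / real (Suc k) \<longrightarrow>
      \<bar>F (fst p + h) (snd p) - F (fst p) (snd p) - inner h (lim (diff_quot (\<lambda>u. F u (snd p)) (fst p)))\<bar>
        \<le> 1 / real (Suc m) * norm h)" for p
  have [measurable]: "Measurable.pred (borel \<Otimes>\<^sub>M M) (\<lambda>p. Cauchy (diff_quot (\<lambda>u. F u (snd p)) (fst p)))"
    using sets_Collect_Cauchy[of "\<lambda>k p. diff_quot (\<lambda>u. F u (snd p)) (fst p) k" "borel \<Otimes>\<^sub>M M"] by (simp add: pred_def)
  have L[measurable]: "(\<lambda>p. lim (diff_quot (\<lambda>u. F u (snd p)) (fst p))) \<in> borel_measurable (borel \<Otimes>\<^sub>M M)"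
    by (rule borel_measurable_lim_metric[OF Q])
  have W[measurable]: "Measurable.pred (borel \<Otimes>\<^sub>M M) W"
    unfolding W_def using D(1) by measurable
  have eq: "has_gradient (\<lambda>u. F u (snd p)) (fst p) \<longleftrightarrow> W p" if "p \<in> space (borel \<Otimes>\<^sub>M M)" for p
    unfolding W_def using that
    by (intro has_gradient_iff_countable cont D(2)) (auto simp: space_pair_measure)
  show ?A using W measurable_cong[of "borel \<Otimes>\<^sub>M M" _ W, OF eq] by simp
  \<comment> \<open>Where no gradient exists, the predicate under \<open>THE\<close> is constantly
    false, so \<open>nabla\<close> takes one fixed value there whatever the function and the
    point.\<close>
  define c :: 'a where "c = (THE g. False)"
  have "nabla (\<lambda>u. F u (snd p)) (fst p) = (if W p then lim (diff_quot (\<lambda>u. F u (snd p)) (fst p)) else c)"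
    if p: "p \<in> space (borel \<Otimes>\<^sub>M M)" for p
  proof (cases "W p")
    case True
    then have "has_gradient (\<lambda>u. F u (snd p)) (fst p)" using eq[OF p] by simp
    from limI[OF diff_quot_tendsto[OF GDERIV_nabla[OF this]]] show ?thesis using True by simp
  next
    case False
    then have "\<And>g. \<not> GDERIV (\<lambda>u. F u (snd p)) (fst p) :> g" using eq[OF p] by (auto simp: has_gradient_def)
    then show ?thesis using False by (simp add: nabla_def c_def)
  qed
  then show ?B by (subst measurable_cong[where g="\<lambda>p. if W p then lim (diff_quot (\<lambda>u. F u (snd p)) (fst p)) else c"]) auto
qed

lemma borel_measurable_nabla_param:
  fixes F :: "'a::euclidean_space \<Rightarrow> 'x \<Rightarrow> real"
  assumes meas: "\<And>x. F x \<in> borel_measurable M"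
    and cont: "\<And>\<xi>. \<xi> \<in> space M \<Longrightarrow> continuous_on UNIV (\<lambda>x. F x \<xi>)"
    and "u \<in> borel_measurable N" "v \<in> measurable N M"
  shows "(\<lambda>p. nabla (\<lambda>x. F x (v p)) (u p)) \<in> borel_measurable N"
  using measurable_compose[OF measurable_Pair[OF assms(3,4)] borel_measurable_nabla[OF meas cont]] by simp

lemma borel_measurable_nabla':
  fixes f :: "'a::euclidean_space \<Rightarrow> real"
  assumes "continuous_on UNIV f"
  shows "nabla f \<in> borel_measurable borel"
  using borel_measurable_nabla_param[of "\<lambda>x (_::unit). f x" "count_space UNIV" "\<lambda>x. x" borel "\<lambda>_. ()"] assms
  by simp

section \<open>Smoothing over a ball\<close>

abbreviation unif_ball :: "'a::euclidean_space measure" where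
  "unif_ball \<equiv> uniform_measure lborel (cball 0 1)"

abbreviation unif01 :: "real measure" where
  "unif01 \<equiv> uniform_measure lborel {0..1}"

lemma measure_cball: "0 \<le> r \<Longrightarrow> measure lborel (cball (x::'a::euclidean_space) r) = unit_ball_vol (real DIM('a)) * r ^ DIM('a)"
  by (simp add: measure_def emeasure_cball)

lemma emeasure_unit_cball: "emeasure lborel (cball (x::'a::euclidean_space) 1) = ennreal (unit_ball_vol (real DIM('a)))"
  by (simp add: emeasure_cball)

lemma prob_space_unif_ball: "prob_space (unif_ball :: 'a::euclidean_space measure)"
  by (rule prob_space_uniform_measure) (simp_all add: emeasure_unit_cball less_imp_neq[OF unit_ball_vol_pos, symmetric])

lemma prob_space_unif01: "prob_space unif01"
  by (rule prob_space_uniform_measure) simp_all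

lemma integral_uniform_measure:
  fixes f :: "'b \<Rightarrow> 'c::euclidean_space"
  assumes [measurable]: "A \<in> sets M" "f \<in> borel_measurable M" and A: "emeasure M A \<noteq> \<infinity>" "emeasure M A \<noteq> 0"
  shows "(\<integral>x. f x \<partial>uniform_measure M A) = (1 / measure M A) *\<^sub>R (\<integral>x. indicator A x *\<^sub>R f x \<partial>M)"
proof -
  have pos: "0 < measure M A" using A by (simp add: measure_def enn2real_positive_iff less_top zero_less_iff_neq_zero)
  have "uniform_measure M A = density M (\<lambda>x. ennreal (indicator A x / measure M A))"
    unfolding uniform_measure_def
  proof (intro density_cong AE_I2)
    fix x
    show "indicator A x / emeasure M A = ennreal (indicator A x / measure M A)"
      using A pos by (auto simp: emeasure_eq_ennreal_measure indicator_def divide_ennreal simp flip: ennreal_1)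
  qed auto
  then have "(\<integral>x. f x \<partial>uniform_measure M A) = (\<integral>x. (indicator A x / measure M A) *\<^sub>R f x \<partial>M)"
    by (simp add: integral_density)
  also have "\<dots> = (\<integral>x. (1 / measure M A) *\<^sub>R (indicator A x *\<^sub>R f x) \<partial>M)" by simp
  finally show ?thesis by (simp only: integral_scaleR_right)
qed

lemma AE_lborel_affine:
  fixes x :: "'a::euclidean_space"
  assumes P: "AE x in lborel. P x" and c: "c \<noteq> 0"
  shows "AE z in lborel. P (x + c *\<^sub>R z)"
proof -
  have "AE y in density (distr lborel borel (\<lambda>z. x + c *\<^sub>R z)) (\<lambda>_. \<bar>c\<bar> ^ DIM('a)). P y"
    by (rule subst[OF lborel_affine[OF c, of x], of "\<lambda>M. AE y in M. P y"]) (rule P)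
  then have "AE y in distr lborel borel (\<lambda>z. x + c *\<^sub>R z). P y"
    using c by (simp add: AE_density)
  then show ?thesis by (rule AE_distrD[rotated]) simp
qed

text \<open>Nondegenerate affine maps preserve Lebesgue null sets. Through this lemma a condition
  imposed at almost every point becomes usable at a perturbed point, whatever the centre.\<close>

lemma AE_unif_ball_affine:
  fixes x :: "'a::euclidean_space"
  assumes "AE x in lborel. P x" "c \<noteq> 0"
  shows "AE z in unif_ball. P (x + c *\<^sub>R z)"
  using AE_lborel_affine[OF assms, of x] by (intro AE_uniform_measureI) auto

lemma AE_unif_ball_norm: "AE z in unif_ball. norm z \<le> 1"
  by (intro AE_uniform_measureI) auto

lemma AE_unif01: "AE s in unif01. 0 \<le> s \<and> s \<le> 1"
  by (intro AE_uniform_measureI) auto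

text \<open>The intersection of the balls contains the ball of radius \<open>1 - norm w / 2\<close>
  around the midpoint of the centres, and Bernoulli's inequality bounds its volume from below. If
  the centres are more than 2 apart, the right-hand side is at least the volume of a whole
  ball.\<close>

lemma measure_cball_diff_le:
  fixes w :: "'a::euclidean_space"
  shows "measure lborel (cball 0 1 - cball w 1) \<le> unit_ball_vol (real DIM('a)) * (real DIM('a) * norm w / 2)"
    and "measure lborel (cball w 1 - cball 0 1) \<le> unit_ball_vol (real DIM('a)) * (real DIM('a) * norm w / 2)"
proof -
  let ?v = "unit_ball_vol (real DIM('a))" and ?d = "real DIM('a)"
  have fm: "cball x r \<in> fmeasurable (lborel :: 'a measure)" for x r
    by (rule fmeasurableI) (auto intro: emeasure_bounded_finite[unfolded infinity_ennreal_def])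
  have v: "?v > 0" by simp
  have int: "measure lborel (cball 0 1 \<inter> cball w 1) \<ge> ?v * (1 - ?d * norm w / 2)"
  proof (cases "norm w \<le> 2")
    case True
    have "1 + ?d * (- norm w / 2) \<le> (1 + (- norm w / 2)) ^ DIM('a)"
      using True by (intro Bernoulli_inequality) simp
    then have "?v * (1 - ?d * norm w / 2) \<le> ?v * (1 - norm w / 2) ^ DIM('a)" using v by simp
    also have "\<dots> = measure lborel (cball (w /\<^sub>R 2) (1 - norm w / 2))"
      using True by (subst measure_cball) auto
    also have "\<dots> \<le> measure lborel (cball 0 1 \<inter> cball w 1)"
    proof (intro measure_mono_fmeasurable)
      show "cball (w /\<^sub>R 2) (1 - norm w / 2) \<subseteq> cball 0 1 \<inter> cball w 1"
      proof
        fix x assume x: "x \<in> cball (w /\<^sub>R 2) (1 - norm w / 2)"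
        have "norm (w /\<^sub>R 2 - w) = norm (- (w /\<^sub>R 2))"
          by (rule arg_cong[of _ _ norm]) (simp add: scaleR_left_diff_distrib[symmetric] algebra_simps flip: scaleR_left.add) 
        then have h: "dist (w /\<^sub>R 2) w = norm w / 2" by (simp add: dist_norm)
        have "dist 0 x \<le> dist 0 (w /\<^sub>R 2) + dist (w /\<^sub>R 2) x" by (rule dist_triangle)
        moreover have "dist w x \<le> dist w (w /\<^sub>R 2) + dist (w /\<^sub>R 2) x" by (rule dist_triangle)
        ultimately show "x \<in> cball 0 1 \<inter> cball w 1" using x h by (simp add: dist_commute)
      qed
    qed (auto intro: fmeasurable.Int fm)
    finally show ?thesis .
  next
    case False
    have "1 \<le> ?d" by (simp add: Suc_leI)
    then have "1 * 2 \<le> ?d * norm w" using False by (intro mult_mono) auto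
    then have "?v * (1 - ?d * norm w / 2) \<le> 0" using v by (intro mult_nonneg_nonpos) auto
    then show ?thesis by (rule order.trans) simp
  qed
  have "measure lborel (cball 0 1 - cball 0 1 \<inter> cball w 1) = measure lborel (cball (0::'a) 1) - measure lborel (cball 0 1 \<inter> cball w 1)"
    by (rule measurable_measure_Diff[OF fm]) auto
  moreover have "cball 0 1 - cball 0 1 \<inter> cball w 1 = cball 0 1 - cball w 1" by blast
  ultimately show "measure lborel (cball 0 1 - cball w 1) \<le> ?v * (?d * norm w / 2)"
    using int by (simp add: measure_cball algebra_simps)
  have "measure lborel (cball w 1 - cball w 1 \<inter> cball 0 1) = measure lborel (cball w 1) - measure lborel (cball w 1 \<inter> cball 0 1)"
    by (rule measurable_measure_Diff[OF fm]) auto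
  moreover have "cball w 1 - cball w 1 \<inter> cball 0 1 = cball w 1 - cball 0 1" by blast
  ultimately show "measure lborel (cball w 1 - cball 0 1) \<le> ?v * (?d * norm w / 2)"
    using int by (simp add: measure_cball algebra_simps Int_commute)
qed

lemma integral_lborel_translate:
  fixes f :: "'a::euclidean_space \<Rightarrow> 'b::euclidean_space"
  assumes [measurable]: "f \<in> borel_measurable borel"
  shows "(\<integral>z. f (c + z) \<partial>lborel) = (\<integral>z. f z \<partial>lborel)"
proof -
  have "(\<integral>z. f z \<partial>lborel) = (\<integral>z. f z \<partial>distr lborel borel ((+) c))" by (simp add: lborel_distr_plus)
  also have "\<dots> = (\<integral>z. f (c + z) \<partial>lborel)" by (subst integral_distr) auto
  finally show ?thesis by simp
qed

lemma norm_integral_le_AE: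
  fixes f :: "'b \<Rightarrow> 'c::euclidean_space"
  assumes "prob_space M" "f \<in> borel_measurable M" "AE x in M. norm (f x) \<le> B"
  shows "integrable M f" "norm (\<integral>x. f x \<partial>M) \<le> B"
proof -
  interpret prob_space M by fact
  show i: "integrable M f" using assms by (intro integrable_const_bound[where B=B]) auto
  have "norm (\<integral>x. f x \<partial>M) \<le> (\<integral>x. norm (f x) \<partial>M)" by (rule integral_norm_bound)
  also have "\<dots> \<le> (\<integral>x. B \<partial>M)" using i assms(3) by (intro integral_mono_AE) auto
  finally show "norm (\<integral>x. f x \<partial>M) \<le> B" by (simp add: prob_space)
qed

text \<open>A change of variables moves the displacement from the integrand to the ball, so that the
  two averages differ only on the symmetric difference of two unit balls, where the integrand is
  bounded by \<open>B\<close>.\<close>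

lemma norm_integral_unif_ball_diff_le:
  fixes g :: "'a::euclidean_space \<Rightarrow> 'b::euclidean_space"
  assumes [measurable]: "g \<in> borel_measurable borel" and g: "AE x in lborel. norm (g x) \<le> B" and c: "c > 0"
  shows "norm ((\<integral>z. g (x + c *\<^sub>R z) \<partial>unif_ball) - (\<integral>z. g (y + c *\<^sub>R z) \<partial>unif_ball))
    \<le> B * real DIM('a) * norm (x - y) / c"
proof -
  let ?v = "unit_ball_vol (real DIM('a))"
  \<comment> \<open>The displacement of the centres in units of the smoothing radius.\<close>
  define w where "w = (1 / c) *\<^sub>R (y - x)"
  have nw: "norm w = norm (x - y) / c" using c by (simp add: w_def norm_minus_commute)
  have v: "?v > 0" by simp
  have B0: "0 \<le> B"
  proof (rule ccontr)
    assume "\<not> 0 \<le> B"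
    then have "\<not> norm (g x) \<le> B" for x using norm_ge_zero[of "g x"] by linarith
    then have "AE x in (lborel::'a measure). False" using g by simp
    then have "AE x in (unif_ball::'a measure). False"
      using AE_unif_ball_affine[of "\<lambda>_. False" 1] by simp
    then show False using prob_space.AE_const[OF prob_space_unif_ball] by blast
  qed
  have gb: "AE z in lborel. norm (g (x + c *\<^sub>R z)) \<le> B" for x
    using c by (intro AE_lborel_affine[OF g]) auto
  have [measurable]: "(\<lambda>z. g (x + c *\<^sub>R z)) \<in> borel_measurable borel" for x
    by (rule measurable_compose[OF _ assms(1)]) simp
  have [measurable]: "cball u 1 \<in> sets (borel :: 'a measure)" for u by simp
  have I: "integrable lborel (\<lambda>z. indicator (cball u 1) z *\<^sub>R g (x + c *\<^sub>R z))" for u x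
  proof (rule Bochner_Integration.integrable_bound)
    show "integrable lborel (\<lambda>z. indicator (cball u 1) z *\<^sub>R B)"
      by (intro integrable_scaleR_left integrable_real_indicator) (auto intro: emeasure_bounded_finite[unfolded infinity_ennreal_def])
    show "AE z in lborel. norm (indicator (cball u 1) z *\<^sub>R g (x + c *\<^sub>R z)) \<le> norm (indicator (cball u 1) z *\<^sub>R B)"
      using gb[of x] by eventually_elim (auto simp: indicator_def)
  qed simp
  have form: "(\<integral>z. g (x + c *\<^sub>R z) \<partial>unif_ball) = (1 / ?v) *\<^sub>R (\<integral>z. indicator (cball 0 1) z *\<^sub>R g (x + c *\<^sub>R z) \<partial>lborel)" for x
    by (subst integral_uniform_measure) (simp_all add: emeasure_unit_cball measure_cball less_imp_neq[OF unit_ball_vol_pos, symmetric])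
  have "(\<integral>z. indicator (cball 0 1) z *\<^sub>R g (y + c *\<^sub>R z) \<partial>lborel)
      = (\<integral>z. indicator (cball 0 1) (- w + z) *\<^sub>R g (y + c *\<^sub>R (- w + z)) \<partial>lborel)"
    by (rule integral_lborel_translate[symmetric]) measurable
  also have "\<dots> = (\<integral>z. indicator (cball w 1) z *\<^sub>R g (x + c *\<^sub>R z) \<partial>lborel)"
  proof (rule Bochner_Integration.integral_cong)
    fix z :: 'a
    have "y + c *\<^sub>R (- w + z) = x + c *\<^sub>R z" using c by (simp add: w_def algebra_simps)
    moreover have "- w + z \<in> cball 0 1 \<longleftrightarrow> z \<in> cball w 1" by (simp add: dist_norm norm_minus_commute add.commute)
    ultimately show "indicator (cball 0 1) (- w + z) *\<^sub>R g (y + c *\<^sub>R (- w + z)) = indicator (cball w 1) z *\<^sub>R g (x + c *\<^sub>R z)"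
      by (simp add: indicator_def)
  qed simp
  finally have shift: "(\<integral>z. indicator (cball 0 1) z *\<^sub>R g (y + c *\<^sub>R z) \<partial>lborel)
      = (\<integral>z. indicator (cball w 1) z *\<^sub>R g (x + c *\<^sub>R z) \<partial>lborel)" .
  let ?S = "(cball 0 1 - cball w 1) \<union> (cball w 1 - cball 0 1) :: 'a set"
  have Sfin: "?S \<in> fmeasurable lborel"
    by (intro fmeasurable.Un fmeasurable.Diff fmeasurableI) (auto intro: emeasure_bounded_finite[unfolded infinity_ennreal_def])
  have "norm ((\<integral>z. g (x + c *\<^sub>R z) \<partial>unif_ball) - (\<integral>z. g (y + c *\<^sub>R z) \<partial>unif_ball))
      = (1 / ?v) * norm (\<integral>z. (indicator (cball 0 1) z *\<^sub>R g (x + c *\<^sub>R z) - indicator (cball w 1) z *\<^sub>R g (x + c *\<^sub>R z)) \<partial>lborel)"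
    unfolding form shift using I by (simp add: Bochner_Integration.integral_diff flip: scaleR_diff_right)
  also have "\<dots> \<le> (1 / ?v) * (\<integral>z. norm (indicator (cball 0 1) z *\<^sub>R g (x + c *\<^sub>R z) - indicator (cball w 1) z *\<^sub>R g (x + c *\<^sub>R z)) \<partial>lborel)"
    using v by (intro mult_left_mono integral_norm_bound) auto
  also have "\<dots> \<le> (1 / ?v) * (\<integral>z. indicator ?S z * B \<partial>lborel)"
  proof (intro mult_left_mono integral_mono_AE)
    show "AE z in lborel. norm (indicator (cball 0 1) z *\<^sub>R g (x + c *\<^sub>R z) - indicator (cball w 1) z *\<^sub>R g (x + c *\<^sub>R z)) \<le> indicator ?S z * B"
      using gb[of x] by eventually_elim (auto simp: indicator_def B0)
    show "integrable lborel (\<lambda>z. indicator ?S z * B)"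
      using Sfin by (intro integrable_mult_left integrable_real_indicator) (auto simp: fmeasurable_def)
    show "integrable lborel (\<lambda>z. norm (indicator (cball 0 1) z *\<^sub>R g (x + c *\<^sub>R z) - indicator (cball w 1) z *\<^sub>R g (x + c *\<^sub>R z)))"
      by (intro integrable_norm Bochner_Integration.integrable_diff I)
  qed (use v in auto)
  also have "(\<integral>z. indicator ?S z * B \<partial>lborel) = measure lborel ?S * B" by simp
  also have "(1 / ?v) * (measure lborel ?S * B) \<le> (1 / ?v) * ((?v * (real DIM('a) * norm w)) * B)"
  proof (intro mult_left_mono mult_right_mono B0)
    have "measure lborel ?S \<le> measure lborel (cball 0 1 - cball w 1) + measure lborel (cball w 1 - cball 0 1)"
      by (intro measure_Un_le) auto
    also have "\<dots> \<le> ?v * (real DIM('a) * norm w / 2) + ?v * (real DIM('a) * norm w / 2)"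
      by (intro add_mono measure_cball_diff_le)
    finally show "measure lborel ?S \<le> ?v * (real DIM('a) * norm w)" by (simp add: mult.commute mult.left_commute)
  qed (use v in auto)
  also have "\<dots> = B * real DIM('a) * norm (x - y) / c" by (simp add: nw less_imp_neq[OF unit_ball_vol_pos, symmetric])
  finally show ?thesis .
qed

text \<open>Differentiability almost everywhere is an assumption of the locale; for the objectives
  it is supplied by \<open>stochastic_gradient_oracle\<close>.\<close>

locale lipschitz_ae_differentiable =
  fixes f :: "'a::euclidean_space \<Rightarrow> real" and L :: real
  assumes lip: "\<And>x y. \<bar>f x - f y\<bar> \<le> L * norm (x - y)"
    and ae_gradient: "AE x in lborel. has_gradient f x"
begin

lemma L_nonneg: "0 \<le> L"
proof -
  obtain b :: 'a where b: "b \<in> Basis" using nonempty_Basis by blast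
  have "0 \<le> L * norm (b - 0)" using lip[of b 0] by linarith
  then show ?thesis using b by simp
qed

lemma continuous: "continuous_on S f"
proof (rule lipschitz_on_continuous_on)
  show "L-lipschitz_on S f" using lip L_nonneg by (auto simp: lipschitz_on_def dist_norm)
qed

lemma measurable_f [measurable]: "f \<in> borel_measurable borel"
  by (intro borel_measurable_continuous_onI continuous)

lemma measurable_nabla [measurable]: "nabla f \<in> borel_measurable borel"
  by (intro borel_measurable_nabla' continuous)

lemma ae_norm_nabla: "AE x in lborel. norm (nabla f x) \<le> L"
  using ae_gradient by eventually_elim (rule norm_nabla_le[OF lip])

text \<open>Defined as the average of the gradients; that it is the gradient of the average, along
  lines, is \<open>smooth_has_derivative_along_line\<close>.\<close>

definition sgrad :: "real \<Rightarrow> 'a \<Rightarrow> 'a" where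
  "sgrad c x = (\<integral>z. nabla f (x + c *\<^sub>R z) \<partial>unif_ball)"

definition smooth :: "real \<Rightarrow> 'a \<Rightarrow> real" where
  "smooth c x = (\<integral>z. f (x + c *\<^sub>R z) \<partial>unif_ball)"

context
  fixes c :: real
  assumes c: "0 < c"
begin

lemma sgrad_integrable: "integrable unif_ball (\<lambda>z. nabla f (x + c *\<^sub>R z))"
  and norm_sgrad_le: "norm (sgrad c x) \<le> L"
  unfolding sgrad_def using c
  by (intro norm_integral_le_AE[where B=L] prob_space_unif_ball AE_unif_ball_affine[OF ae_norm_nabla]; simp)+

lemma sgrad_lipschitz: "norm (sgrad c x - sgrad c y) \<le> L * real DIM('a) * norm (x - y) / c"
  unfolding sgrad_def by (intro norm_integral_unif_ball_diff_le measurable_nabla ae_norm_nabla c)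

lemma continuous_sgrad: "continuous_on S (sgrad c)"
proof (rule lipschitz_on_continuous_on)
  show "(L * real DIM('a) / c)-lipschitz_on S (sgrad c)"
    using sgrad_lipschitz L_nonneg c by (auto simp: lipschitz_on_def dist_norm)
qed

lemma smooth_integrable: "integrable unif_ball (\<lambda>z. f (x + c *\<^sub>R z))"
  and smooth_close: "\<bar>smooth c x - f x\<bar> \<le> L * c"
proof -
  interpret U: prob_space "unif_ball :: 'a measure" by (rule prob_space_unif_ball)
  have prob: "U.prob UNIV = 1" using U.prob_space by simp
  have b: "\<bar>f (x + c *\<^sub>R z) - f x\<bar> \<le> L * c" if "norm z \<le> 1" for z
  proof -
    have "\<bar>f (x + c *\<^sub>R z) - f x\<bar> \<le> L * (c * norm z)" using lip[of "x + c *\<^sub>R z" x] c by simp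
    also have "\<dots> \<le> L * (c * 1)" using c L_nonneg that by (intro mult_left_mono) auto
    finally show ?thesis by simp
  qed
  have ae: "AE z in unif_ball. norm (f (x + c *\<^sub>R z) - f x) \<le> L * c"
    using AE_unif_ball_norm by eventually_elim (simp add: b)
  have i: "integrable unif_ball (\<lambda>z. f (x + c *\<^sub>R z) - f x)"
    and n: "norm (\<integral>z. f (x + c *\<^sub>R z) - f x \<partial>unif_ball) \<le> L * c"
    by (intro norm_integral_le_AE[OF prob_space_unif_ball _ ae]; simp)+
  have "integrable unif_ball (\<lambda>z. (f (x + c *\<^sub>R z) - f x) + f x)"
    by (intro Bochner_Integration.integrable_add i) auto
  then show i': "integrable unif_ball (\<lambda>z. f (x + c *\<^sub>R z))" by simp
  have "(\<integral>z. f (x + c *\<^sub>R z) - f x \<partial>unif_ball) = smooth c x - f x"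
    using i' by (subst Bochner_Integration.integral_diff) (auto simp: smooth_def prob)
  with n show "\<bar>smooth c x - f x\<bar> \<le> L * c" by simp
qed

lemma smooth_lipschitz: "\<bar>smooth c x - smooth c y\<bar> \<le> L * norm (x - y)"
proof -
  have "smooth c x - smooth c y = (\<integral>z. f (x + c *\<^sub>R z) - f (y + c *\<^sub>R z) \<partial>unif_ball)"
    unfolding smooth_def by (intro Bochner_Integration.integral_diff[symmetric] smooth_integrable)
  moreover have "norm (\<integral>z. f (x + c *\<^sub>R z) - f (y + c *\<^sub>R z) \<partial>unif_ball) \<le> L * norm (x - y)"
  proof (intro norm_integral_le_AE prob_space_unif_ball AE_I2)
    fix z
    show "norm (f (x + c *\<^sub>R z) - f (y + c *\<^sub>R z)) \<le> L * norm (x - y)"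
      using lip[of "x + c *\<^sub>R z" "y + c *\<^sub>R z"] by simp
  qed simp
  ultimately show ?thesis by simp
qed

text \<open>Dominated convergence: the difference quotients are bounded by
  \<open>L * norm v\<close>, and for almost every \<open>z\<close> they converge because
  \<open>f\<close> is differentiable at the perturbed point.\<close>

lemma smooth_has_derivative_along_line:
  "((\<lambda>s. smooth c (x + s *\<^sub>R v)) has_real_derivative inner (sgrad c (x + s *\<^sub>R v)) v) (at s)"
proof -
  let ?q = "\<lambda>h z. (f (x + (s + h) *\<^sub>R v + c *\<^sub>R z) - f (x + s *\<^sub>R v + c *\<^sub>R z)) / h"
  let ?p = "x + s *\<^sub>R v"
  have qi: "(smooth c (x + (s + h) *\<^sub>R v) - smooth c (x + s *\<^sub>R v)) / h = (\<integral>z. ?q h z \<partial>unif_ball)" for h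
    unfolding smooth_def
    by (simp add: Bochner_Integration.integral_diff[OF smooth_integrable smooth_integrable])
  have "(\<lambda>h. \<integral>z. ?q h z \<partial>unif_ball) \<midarrow>0\<rightarrow> (\<integral>z. inner (nabla f (?p + c *\<^sub>R z)) v \<partial>unif_ball)"
    \<comment> \<open>Passing to sequences makes dominated convergence applicable.\<close>
    unfolding tendsto_at_iff_sequentially comp_def
  proof (intro allI impI)
    fix X :: "nat \<Rightarrow> real" assume X: "\<forall>i. X i \<in> UNIV - {0}" "X \<longlonglongrightarrow> 0"
    show "(\<lambda>i. \<integral>z. ?q (X i) z \<partial>unif_ball) \<longlonglongrightarrow> (\<integral>z. inner (nabla f (?p + c *\<^sub>R z)) v \<partial>unif_ball)"
    proof (rule integral_dominated_convergence[where w="\<lambda>_. L * norm v"])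
      have "AE z in unif_ball. has_gradient f (?p + c *\<^sub>R z)"
        using c by (intro AE_unif_ball_affine[OF ae_gradient]) auto
      then show "AE z in unif_ball. (\<lambda>i. ?q (X i) z) \<longlonglongrightarrow> inner (nabla f (?p + c *\<^sub>R z)) v"
      proof eventually_elim
        fix z assume "has_gradient f (?p + c *\<^sub>R z)"
        from GDERIV_nabla[OF this] have D: "(f has_derivative (\<lambda>h. inner h (nabla f (?p + c *\<^sub>R z)))) (at (?p + c *\<^sub>R z))"
          by (simp add: gderiv_def)
        have "((\<lambda>h. f (?p + c *\<^sub>R z + h *\<^sub>R v)) has_derivative (\<lambda>h. inner (h *\<^sub>R v) (nabla f (?p + c *\<^sub>R z)))) (at 0)"
        proof -
          have "((\<lambda>h. (?p + c *\<^sub>R z) + h *\<^sub>R v) has_derivative (\<lambda>h. 0 + h *\<^sub>R v)) (at 0)"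
            by (intro has_derivative_add has_derivative_const has_derivative_scaleR_left has_derivative_ident)
          moreover have "(f has_derivative (\<lambda>h. inner h (nabla f (?p + c *\<^sub>R z)))) (at ((?p + c *\<^sub>R z) + 0 *\<^sub>R v))"
            using D by simp
          ultimately show ?thesis using has_derivative_compose by fastforce
        qed
        then have "((\<lambda>h. f (?p + c *\<^sub>R z + h *\<^sub>R v)) has_real_derivative inner (nabla f (?p + c *\<^sub>R z)) v) (at 0)"
          by (rule has_derivative_imp_has_field_derivative) (simp add: inner_commute)
        then have "(\<lambda>h. (f (?p + c *\<^sub>R z + h *\<^sub>R v) - f (?p + c *\<^sub>R z)) / h) \<midarrow>0\<rightarrow> inner (nabla f (?p + c *\<^sub>R z)) v"
          by (simp add: DERIV_def)
        then have "(\<lambda>i. (f (?p + c *\<^sub>R z + X i *\<^sub>R v) - f (?p + c *\<^sub>R z)) / X i) \<longlonglongrightarrow> inner (nabla f (?p + c *\<^sub>R z)) v"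
          unfolding tendsto_at_iff_sequentially comp_def using X by blast
        then show "(\<lambda>i. ?q (X i) z) \<longlonglongrightarrow> inner (nabla f (?p + c *\<^sub>R z)) v"
          by (simp add: algebra_simps)
      qed
      show "AE z in unif_ball. norm (?q (X i) z) \<le> L * norm v" for i
      proof (rule AE_I2)
        fix z
        have "\<bar>f (x + (s + X i) *\<^sub>R v + c *\<^sub>R z) - f (x + s *\<^sub>R v + c *\<^sub>R z)\<bar> \<le> L * norm (X i *\<^sub>R v)"
          using lip[of "x + (s + X i) *\<^sub>R v + c *\<^sub>R z" "x + s *\<^sub>R v + c *\<^sub>R z"] by (simp add: algebra_simps)
        moreover have "X i \<noteq> 0" using X(1) by auto
        ultimately show "norm (?q (X i) z) \<le> L * norm v" by (simp add: divide_simps mult.commute mult.left_commute)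
      qed
      interpret U: prob_space "unif_ball :: 'a measure" by (rule prob_space_unif_ball)
      show "integrable (unif_ball :: 'a measure) (\<lambda>_. L * norm v)" by simp
    qed simp_all
  qed
  also have "(\<integral>z. inner (nabla f (?p + c *\<^sub>R z)) v \<partial>unif_ball) = inner (sgrad c ?p) v"
    unfolding sgrad_def by (rule integral_inner_left) (use sgrad_integrable in auto)
  finally show ?thesis unfolding DERIV_def qi .
qed

text \<open>The fundamental theorem of calculus on the segment. \<open>unif01\<close> is the law of
  the algorithm's interpolation weight, so the average on the right is the expected smoothed
  gradient at a random point of the segment.\<close>

lemma smooth_increment:
  "smooth c (x + v) - smooth c x = inner (\<integral>s. sgrad c (x + s *\<^sub>R v) \<partial>unif01) v"
proof -
  have cont: "continuous_on UNIV (\<lambda>s. sgrad c (x + s *\<^sub>R v))"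
    by (intro continuous_on_compose2[OF continuous_sgrad[of UNIV]] continuous_intros) auto
  have [measurable]: "(\<lambda>s. sgrad c (x + s *\<^sub>R v)) \<in> borel_measurable borel"
    by (intro borel_measurable_continuous_onI cont)
  have int: "integrable unif01 (\<lambda>s. sgrad c (x + s *\<^sub>R v))"
    by (intro norm_integral_le_AE[where B=L] prob_space_unif01 AE_I2 norm_sgrad_le) auto
  have "inner (\<integral>s. sgrad c (x + s *\<^sub>R v) \<partial>unif01) v = (\<integral>s. inner (sgrad c (x + s *\<^sub>R v)) v \<partial>unif01)"
    by (rule integral_inner_left[symmetric]) (use int in auto)
  also have "\<dots> = (\<integral>s. indicator {0..1} s *\<^sub>R inner (sgrad c (x + s *\<^sub>R v)) v \<partial>lborel)"
    by (subst integral_uniform_measure) simp_all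
  also have "\<dots> = smooth c (x + 1 *\<^sub>R v) - smooth c (x + 0 *\<^sub>R v)"
  proof (rule integral_FTC_atLeastAtMost)
    show "((\<lambda>s. smooth c (x + s *\<^sub>R v)) has_vector_derivative inner (sgrad c (x + s *\<^sub>R v)) v) (at s within {0..1})" for s
      using smooth_has_derivative_along_line[of x v s]
      by (auto simp: has_real_derivative_iff_has_vector_derivative intro: has_vector_derivative_at_within)
    show "continuous_on {0..1} (\<lambda>s. inner (sgrad c (x + s *\<^sub>R v)) v)"
      by (intro continuous_intros continuous_on_subset[OF cont]) auto
  qed simp
  finally show ?thesis by simp
qed

end

end

section \<open>The Goldstein subdifferential\<close>

text \<open>Otherwise a hyperplane strictly separates the expectation from \<open>C\<close>, and
  integrating the linear functional gives a contradiction.\<close>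

lemma expectation_in_closed_convex:
  fixes X :: "'b \<Rightarrow> 'c::euclidean_space"
  assumes M: "prob_space M" and C: "closed C" "convex C" and X: "integrable M X" "AE x in M. X x \<in> C"
  shows "(\<integral>x. X x \<partial>M) \<in> C"
proof (rule ccontr)
  interpret prob_space M by fact
  assume "(\<integral>x. X x \<partial>M) \<notin> C"
  then obtain a b where ab: "inner a (\<integral>x. X x \<partial>M) < b" "\<forall>x\<in>C. inner a x > b"
    using separating_hyperplane_closed_point[OF C(2,1)] by blast
  have "b \<le> (\<integral>x. inner a (X x) \<partial>M)"
    using X ab(2) by (intro integral_ge_const) (auto elim!: eventually_mono)
  also have "\<dots> = inner a (\<integral>x. X x \<partial>M)" using X(1) by simp
  finally show False using ab(1) by simp
qed

context lipschitz_ae_differentiable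
begin

lemma nabla_in_clarke_subdiff: "has_gradient f y \<Longrightarrow> nabla f y \<in> clarke_subdiff f y"
  unfolding clarke_subdiff_def by (rule hull_inc) (auto intro!: exI[of _ "\<lambda>_. y"])

lemma nabla_in_goldstein_subdiff:
  assumes "has_gradient f y" "dist x y \<le> \<delta>"
  shows "nabla f y \<in> goldstein_subdiff f \<delta> x"
  unfolding goldstein_subdiff_def using nabla_in_clarke_subdiff[OF assms(1)] assms(2)
  by (intro hull_inc) auto

lemma norm_limiting_gradient_le:
  assumes "\<And>k. has_gradient f (X k)" "(\<lambda>k. nabla f (X k)) \<longlonglongrightarrow> g"
  shows "norm g \<le> L"
  using tendsto_norm[OF assms(2)] norm_nabla_le[OF lip assms(1)]
  by (intro LIMSEQ_le_const2[of "\<lambda>k. norm (nabla f (X k))"]) auto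

lemma goldstein_subdiff_norm_le:
  assumes "g \<in> goldstein_subdiff f \<delta> x"
  shows "norm g \<le> L"
proof -
  have "clarke_subdiff f y \<subseteq> cball 0 L" for y
    unfolding clarke_subdiff_def
  proof (rule hull_minimal)
    show "{g. \<exists>X. (\<forall>k. has_gradient f (X k)) \<and> X \<longlonglongrightarrow> y \<and> (\<lambda>k. nabla f (X k)) \<longlonglongrightarrow> g} \<subseteq> cball 0 L"
      using norm_limiting_gradient_le by fastforce
  qed (rule convex_cball)
  then have "goldstein_subdiff f \<delta> x \<subseteq> cball 0 L"
    unfolding goldstein_subdiff_def by (intro hull_minimal convex_cball) blast
  then show ?thesis using assms by auto
qed

lemma convex_goldstein_subdiff: "convex (goldstein_subdiff f \<delta> x)"
  unfolding goldstein_subdiff_def by (rule convex_convex_hull)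

text \<open>The ball has positive volume, hence contains a point of differentiability. The infimum
  in \<open>goldstein_norm\<close> is thus taken over a nonempty set.\<close>

lemma goldstein_subdiff_nonempty:
  assumes "0 < \<delta>"
  shows "goldstein_subdiff f \<delta> x \<noteq> {}"
proof -
  have ae: "AE z in unif_ball. has_gradient f (x + \<delta> *\<^sub>R z) \<and> norm z \<le> 1"
    using AE_unif_ball_affine[OF ae_gradient, of \<delta> x] AE_unif_ball_norm assms by auto
  have "\<exists>z. has_gradient f (x + \<delta> *\<^sub>R z) \<and> norm z \<le> 1"
  proof (rule ccontr)
    assume no: "\<not> ?thesis"
    have "AE z in (unif_ball :: 'a measure). False" using ae by eventually_elim (use no in blast)
    then show False using prob_space.AE_const[OF prob_space_unif_ball] by blast
  qed
  then obtain z where "has_gradient f (x + \<delta> *\<^sub>R z)" "norm z \<le> 1" by blast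
  then show ?thesis
    using nabla_in_goldstein_subdiff[of "x + \<delta> *\<^sub>R z" x \<delta>] assms
    by (auto simp: dist_norm)
qed

lemma goldstein_norm_le_norm:
  assumes "g \<in> goldstein_subdiff f \<delta> x"
  shows "goldstein_norm f \<delta> x \<le> norm g"
  unfolding goldstein_norm_def using assms by (intro cInf_lower) (auto intro!: bdd_belowI[of _ 0])

lemma goldstein_norm_nonneg:
  assumes "0 < \<delta>"
  shows "0 \<le> goldstein_norm f \<delta> x"
  unfolding goldstein_norm_def using goldstein_subdiff_nonempty[OF assms] by (intro cInf_greatest) auto

lemma goldstein_norm_le_L:
  assumes "0 < \<delta>"
  shows "goldstein_norm f \<delta> x \<le> L"
  using goldstein_subdiff_nonempty[OF assms, of x] goldstein_norm_le_norm goldstein_subdiff_norm_le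
  by (meson ex_in_conv order.trans)

text \<open>Averages of gradients are only shown to lie in the closure, and taking the closure does
  not lower the infimum of the norm.\<close>

lemma goldstein_norm_le_norm_closure:
  assumes "g \<in> closure (goldstein_subdiff f \<delta> x)"
  shows "goldstein_norm f \<delta> x \<le> norm g"
proof (rule field_le_epsilon)
  fix e :: real assume "e > 0"
  then obtain g' where g': "g' \<in> goldstein_subdiff f \<delta> x" "dist g' g < e"
    using assms closure_approachable by blast
  have "goldstein_norm f \<delta> x \<le> norm g'" using g'(1) by (rule goldstein_norm_le_norm)
  also have "\<dots> \<le> norm g + e"
    using g'(2) norm_triangle_ineq3[of g' g] by (auto simp: dist_norm)
  finally show "goldstein_norm f \<delta> x \<le> norm g + e" .
qed

text \<open>The radius budget: \<open>\<delta> - c\<close> for the distance from \<open>w\<close> to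
  the centre, \<open>c\<close> for the perturbation.\<close>

lemma sgrad_in_closure_goldstein_subdiff:
  assumes c: "0 < c" and x: "norm (x - w) \<le> \<delta> - c"
  shows "sgrad c x \<in> closure (goldstein_subdiff f \<delta> w)"
  unfolding sgrad_def
proof (rule expectation_in_closed_convex[OF prob_space_unif_ball])
  have "AE z in unif_ball. has_gradient f (x + c *\<^sub>R z)"
    using c by (intro AE_unif_ball_affine[OF ae_gradient]) auto
  then show "AE z in unif_ball. nabla f (x + c *\<^sub>R z) \<in> closure (goldstein_subdiff f \<delta> w)"
    using AE_unif_ball_norm
  proof eventually_elim
    fix z :: 'a assume z: "has_gradient f (x + c *\<^sub>R z)" "norm z \<le> 1"
    have "dist w (x + c *\<^sub>R z) = norm ((x - w) + c *\<^sub>R z)" by (simp add: dist_norm norm_minus_commute algebra_simps)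
    also have "\<dots> \<le> norm (x - w) + c * norm z" using norm_triangle_ineq[of "x - w" "c *\<^sub>R z"] c by simp
    also have "\<dots> \<le> \<delta>"
    proof -
      have "c * norm z \<le> c * 1" using c z(2) by (intro mult_left_mono) auto
      then show ?thesis using x by simp
    qed
    finally show "nabla f (x + c *\<^sub>R z) \<in> closure (goldstein_subdiff f \<delta> w)"
      using z(1) nabla_in_goldstein_subdiff closure_subset by blast
  qed
qed (auto intro: convex_closure convex_goldstein_subdiff sgrad_integrable c)

lemma line_average_in_closure_goldstein_subdiff:
  assumes c: "0 < c" and x: "\<And>s. 0 \<le> s \<Longrightarrow> s \<le> 1 \<Longrightarrow> norm (p + s *\<^sub>R v - w) \<le> \<delta> - c"
  shows "(\<integral>s. sgrad c (p + s *\<^sub>R v) \<partial>unif01) \<in> closure (goldstein_subdiff f \<delta> w)"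
proof (rule expectation_in_closed_convex[OF prob_space_unif01])
  have cont: "continuous_on UNIV (\<lambda>s. sgrad c (p + s *\<^sub>R v))"
    by (intro continuous_on_compose2[OF continuous_sgrad[OF c, of UNIV]] continuous_intros) auto
  have [measurable]: "(\<lambda>s. sgrad c (p + s *\<^sub>R v)) \<in> borel_measurable borel"
    by (intro borel_measurable_continuous_onI cont)
  show "integrable unif01 (\<lambda>s. sgrad c (p + s *\<^sub>R v))"
    by (intro norm_integral_le_AE[where B=L] prob_space_unif01 AE_I2 norm_sgrad_le c) auto
  show "AE s in unif01. sgrad c (p + s *\<^sub>R v) \<in> closure (goldstein_subdiff f \<delta> w)"
    using AE_unif01 by eventually_elim (intro sgrad_in_closure_goldstein_subdiff c x; simp)
qed (auto intro: convex_closure convex_goldstein_subdiff)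

text \<open>Convexity merges the \<open>T\<close> averages, since they all refer to the same point
  \<open>w\<close>.\<close>

lemma goldstein_norm_le_average:
  fixes p v :: "nat \<Rightarrow> 'a"
  assumes c: "0 < c" and T: "1 \<le> T"
    and x: "\<And>t s. t \<in> {1..T} \<Longrightarrow> 0 \<le> s \<Longrightarrow> s \<le> 1 \<Longrightarrow> norm (p t + s *\<^sub>R v t - w) \<le> \<delta> - c"
  shows "goldstein_norm f \<delta> w \<le> norm ((1 / real T) *\<^sub>R (\<Sum>t=1..T. \<integral>s. sgrad c (p t + s *\<^sub>R v t) \<partial>unif01))"
proof (rule goldstein_norm_le_norm_closure)
  have "(\<Sum>t=1..T. (1 / real T) *\<^sub>R (\<integral>s. sgrad c (p t + s *\<^sub>R v t) \<partial>unif01)) \<in> closure (goldstein_subdiff f \<delta> w)"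
    using T by (intro convex_sum convex_closure convex_goldstein_subdiff line_average_in_closure_goldstein_subdiff c x) auto
  then show "(1 / real T) *\<^sub>R (\<Sum>t=1..T. \<integral>s. sgrad c (p t + s *\<^sub>R v t) \<partial>unif01) \<in> closure (goldstein_subdiff f \<delta> w)"
    by (simp add: scaleR_sum_right)
qed

text \<open>If every limiting gradient over the ball exceeded \<open>b\<close> in direction
  \<open>u\<close>, an open half-space would contain both nested convex hulls and hence
  \<open>g\<close>.\<close>

lemma exists_limiting_gradient_inner_le:
  assumes g: "g \<in> goldstein_subdiff f \<delta> x" and u: "inner u g \<le> b"
  obtains y g' X where "y \<in> cball x \<delta>" "\<And>k. has_gradient f (X k)" "X \<longlonglongrightarrow> y"
    "(\<lambda>k. nabla f (X k)) \<longlonglongrightarrow> g'" "inner u g' \<le> b"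
proof (rule ccontr)
  note witness = that
  assume "\<not> thesis"
  then have all: "b < inner u g'" if "y \<in> cball x \<delta>" "\<forall>k. has_gradient f (X k)" "X \<longlonglongrightarrow> y"
      "(\<lambda>k. nabla f (X k)) \<longlonglongrightarrow> g'" for y g' X
    using witness[OF that(1) _ that(3,4)] that(2) by (meson not_le)
  have "clarke_subdiff f y \<subseteq> {g. inner u g > b}" if "y \<in> cball x \<delta>" for y
    unfolding clarke_subdiff_def using all[OF that]
    by (intro hull_minimal convex_halfspace_gt) auto
  then have "goldstein_subdiff f \<delta> x \<subseteq> {g. inner u g > b}"
    unfolding goldstein_subdiff_def by (intro hull_minimal convex_halfspace_gt) blast
  then show False using g u by auto
qed

text \<open>Sublevel sets are closed: a vector separating 0 from the subdifferential at the limit point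
  contradicts a limit of almost minimal gradients at points converging into the ball.\<close>
lemma goldstein_norm_limit_le:
  assumes \<delta>: "0 < \<delta>" and X: "X \<longlonglongrightarrow> w" and a: "\<And>k. goldstein_norm f \<delta> (X k) \<le> a"
  shows "goldstein_norm f \<delta> w \<le> a"
proof (rule ccontr)
  assume neg: "\<not> goldstein_norm f \<delta> w \<le> a"
  have a0: "0 \<le> a" using a[of 0] goldstein_norm_nonneg[OF \<delta>, of "X 0"] by linarith
  let ?C = "closure (goldstein_subdiff f \<delta> w)"
  \<comment> \<open>The element of least norm in the closed convex set; its direction
    \<open>u\<close> is the separating vector.\<close>
  define p where "p = closest_point ?C 0"
  have C: "convex ?C" "closed ?C" "?C \<noteq> {}"
    using goldstein_subdiff_nonempty[OF \<delta>] by (auto intro: convex_closure convex_goldstein_subdiff)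
  have p: "p \<in> ?C" unfolding p_def by (rule closest_point_in_set[OF C(2,3)])
  have np: "a < norm p" using goldstein_norm_le_norm_closure[OF p] neg by linarith
  define u where "u = (1 / norm p) *\<^sub>R p"
  have nu: "norm u = 1" proof -
    have "0 < norm p" using np a0 by linarith
    then show ?thesis by (simp add: u_def)
  qed
  have sep: "norm p \<le> inner u g" if "g \<in> ?C" for g
  proof -
    have "inner (0 - p) (g - p) \<le> 0" unfolding p_def by (rule closest_point_dot[OF C(1,2) that])
    then have "norm p * norm p \<le> inner p g"
      by (simp add: inner_diff_right flip: power2_norm_eq_inner power2_eq_square)
    then have "norm p * norm p / norm p \<le> inner p g / norm p" by (rule divide_right_mono) simp
    then show ?thesis by (simp add: u_def split: if_splits)
  qed
  \<comment> \<open>Three approximations are chained within the slack \<open>2 / (k + 1)\<close>: an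
    almost minimal element of the subdifferential, a limiting gradient that stays below its bound in
    direction \<open>u\<close>, and an actual gradient close to the limiting one.\<close>
  have "\<exists>z. has_gradient f z \<and> dist (X k) z \<le> \<delta> + 1 / real (Suc k) \<and> inner u (nabla f z) \<le> a + 2 / real (Suc k)" for k
  proof -
    let ?e = "1 / real (Suc k)"
    have e: "?e > 0" by simp
    have lt: "Inf (norm ` goldstein_subdiff f \<delta> (X k)) < a + ?e"
      using a[of k] e unfolding goldstein_norm_def by linarith
    have ne: "norm ` goldstein_subdiff f \<delta> (X k) \<noteq> {}"
      using goldstein_subdiff_nonempty[OF \<delta>] by simp
    from cInf_lessD[OF ne lt] obtain g where g: "g \<in> goldstein_subdiff f \<delta> (X k)" "norm g < a + ?e"
      by auto
    have "inner u g \<le> norm u * norm g" by (rule norm_cauchy_schwarz)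
    then have le: "inner u g \<le> a + ?e" using g(2) nu by simp
    obtain y g' Z where Z: "y \<in> cball (X k) \<delta>" "\<And>j. has_gradient f (Z j)" "Z \<longlonglongrightarrow> y"
      "(\<lambda>j. nabla f (Z j)) \<longlonglongrightarrow> g'" "inner u g' \<le> a + ?e"
      by (rule exists_limiting_gradient_inner_le[OF g(1) le]) (rule that; assumption)
    have ev1: "eventually (\<lambda>j. dist (Z j) y < ?e) sequentially" using Z(3) e by (rule tendstoD)
    have "(\<lambda>j. inner u (nabla f (Z j))) \<longlonglongrightarrow> inner u g'" by (intro tendsto_intros Z(4))
    moreover have "inner u g' < a + 2 * ?e" using Z(5) e by linarith
    ultimately have "eventually (\<lambda>j. inner u (nabla f (Z j)) < a + 2 * ?e) sequentially"
      by (rule order_tendstoD(2))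
    with ev1 have "eventually (\<lambda>j. dist (Z j) y < ?e \<and> inner u (nabla f (Z j)) < a + 2 * ?e) sequentially"
      by (rule eventually_conj)
    then obtain j where j: "dist (Z j) y < ?e" "inner u (nabla f (Z j)) < a + 2 * ?e"
      using eventually_happens'[OF sequentially_bot] by blast
    have "dist (X k) (Z j) \<le> dist (X k) y + dist (Z j) y" by (metis dist_commute dist_triangle)
    then have "dist (X k) (Z j) \<le> \<delta> + ?e" using j(1) Z(1) by simp
    then show ?thesis using j(2) Z(2) by (intro exI[of _ "Z j"]) auto
  qed
  then obtain z where z: "\<And>k. has_gradient f (z k)" "\<And>k. dist (X k) (z k) \<le> \<delta> + 1 / real (Suc k)"
    "\<And>k. inner u (nabla f (z k)) \<le> a + 2 / real (Suc k)" by metis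
  \<comment> \<open>Points and gradients are bounded, so one subsequence makes both converge; the
    limits form a limiting gradient inside the closed ball around \<open>w\<close>.\<close>
  have "bounded (range z)"
  proof -
    obtain B where B: "\<And>k. norm (X k) \<le> B"
      using convergent_imp_bounded[OF X] by (auto simp: bounded_iff)
    have "norm (z k) \<le> B + (\<delta> + 1)" for k
    proof -
      have "norm (z k) \<le> norm (X k) + dist (X k) (z k)"
        using norm_triangle_ineq2[of "z k" "X k"] by (simp add: dist_norm norm_minus_commute)
      moreover have "1 / real (Suc k) \<le> 1" by simp
      ultimately show ?thesis using B[of k] z(2)[of k] by linarith
    qed
    then show ?thesis by (auto simp: bounded_iff)
  qed
  moreover have "bounded (range (\<lambda>k. nabla f (z k)))"
    using norm_nabla_le[OF lip z(1)] by (auto simp: bounded_iff)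
  ultimately have "bounded (range z \<times> range (\<lambda>k. nabla f (z k)))" by (rule bounded_Times)
  then have "bounded (range (\<lambda>k. (z k, nabla f (z k))))" by (rule bounded_subset) auto
  then obtain l r where r: "strict_mono (r :: nat \<Rightarrow> nat)" "((\<lambda>k. (z k, nabla f (z k))) \<circ> r) \<longlonglongrightarrow> l"
    using bounded_imp_convergent_subsequence[of "\<lambda>k. (z k, nabla f (z k))"] by blast
  obtain y g where l: "l = (y, g)" by (cases l)
  have ly: "(\<lambda>k. z (r k)) \<longlonglongrightarrow> y" using tendsto_fst[OF r(2)] by (simp add: l o_def)
  have lg: "(\<lambda>k. nabla f (z (r k))) \<longlonglongrightarrow> g" using tendsto_snd[OF r(2)] by (simp add: l o_def)
  have inv: "(\<lambda>k. c / real (Suc (r k))) \<longlonglongrightarrow> 0" for c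
  proof -
    have "(\<lambda>k. c * inverse (real (Suc k))) \<longlonglongrightarrow> c * 0" by (intro tendsto_intros LIMSEQ_inverse_real_of_nat)
    from LIMSEQ_subseq_LIMSEQ[OF this r(1)] show ?thesis by (simp add: o_def divide_inverse)
  qed
  have "dist w y \<le> \<delta>"
  proof (rule tendsto_le[OF sequentially_bot])
    show "(\<lambda>k. dist (X (r k)) (z (r k))) \<longlonglongrightarrow> dist w y"
      using LIMSEQ_subseq_LIMSEQ[OF X r(1)] ly by (intro tendsto_intros) (simp_all add: o_def)
    show "(\<lambda>k. \<delta> + 1 / real (Suc (r k))) \<longlonglongrightarrow> \<delta>"
      using tendsto_add[OF tendsto_const inv[of 1], of \<delta>] by simp
  qed (use z(2) in simp)
  moreover have "g \<in> clarke_subdiff f y"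
    unfolding clarke_subdiff_def using z(1) ly lg by (intro hull_inc) (auto intro!: exI[of _ "\<lambda>k. z (r k)"])
  ultimately have "g \<in> goldstein_subdiff f \<delta> w"
    unfolding goldstein_subdiff_def by (intro hull_inc) auto
  then have "norm p \<le> inner u g" using closure_subset by (intro sep) blast
  moreover have "inner u g \<le> a"
  proof (rule tendsto_le[OF sequentially_bot])
    show "(\<lambda>k. inner u (nabla f (z (r k)))) \<longlonglongrightarrow> inner u g" by (intro tendsto_intros lg)
    show "(\<lambda>k. a + 2 / real (Suc (r k))) \<longlonglongrightarrow> a"
      using tendsto_add[OF tendsto_const inv[of 2], of a] by simp
  qed (use z(3) in simp)
  ultimately show False using np by linarith
qed

text \<open>Lower semicontinuity suffices: sublevel sets are closed, hence Borel.\<close>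

lemma measurable_goldstein_norm [measurable]:
  assumes "0 < \<delta>"
  shows "goldstein_norm f \<delta> \<in> borel_measurable borel"
proof (rule borel_measurableI_le)
  fix a
  have "closed {w. goldstein_norm f \<delta> w \<le> a}"
    unfolding closed_sequential_limits using goldstein_norm_limit_le[OF assms] by blast
  then show "{w \<in> space borel. goldstein_norm f \<delta> w \<le> a} \<in> sets borel" by simp
qed

end

section \<open>Online learning along one epoch\<close>

lemma norm_clip_le:
  fixes v :: "'a::euclidean_space"
  assumes "0 \<le> D"
  shows "norm (clip D v) \<le> D"
proof (cases "v = 0")
  case False
  have "norm (clip D v) = min 1 (D / norm v) * norm v" using assms by (simp add: clip_def)
  also have "\<dots> \<le> D / norm v * norm v" by (intro mult_right_mono) auto
  finally show ?thesis using False by simp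
qed (simp add: clip_def assms)

text \<open>\<open>clip\<close> is the metric projection onto the ball of radius \<open>D\<close>,
  and a projection onto a convex set does not increase the distance to its points.\<close>

lemma norm_clip_diff_le:
  fixes v :: "'a::euclidean_space"
  assumes D: "0 \<le> D" and u: "norm u \<le> D"
  shows "norm (clip D v - u) \<le> norm (v - u)"
proof (cases "norm v \<le> D")
  case True
  then have "clip D v = v" by (cases "v = 0") (auto simp: clip_def)
  then show ?thesis by simp
next
  case False
  define l where "l = D / norm v"
  have nv: "0 < norm v" using False D by linarith
  have l: "0 \<le> l" "l < 1" "l * norm v = D" using False D nv by (auto simp: l_def)
  have c: "clip D v = l *\<^sub>R v" using l by (simp add: clip_def l_def[symmetric])
  have "inner v u \<le> norm v * D" using norm_cauchy_schwarz[of v u] u by (meson mult_left_mono norm_ge_zero order.trans)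
  moreover have "norm v * D \<le> norm v * norm v" using False by (intro mult_left_mono) auto
  moreover have "(1 + l) * (norm v * norm v) = norm v * norm v + norm v * D" using l(3) by (simp add: algebra_simps)
  ultimately have "0 \<le> (1 + l) * (norm v * norm v) - 2 * inner v u" by linarith
  then have "0 \<le> (1 - l) * ((1 + l) * (norm v * norm v) - 2 * inner v u)" using l by (intro mult_nonneg_nonneg) auto
  \<comment> \<open>The difference of the squared distances factors, and both factors are
    nonnegative since \<open>inner v u\<close> is at most \<open>norm v * D\<close>.\<close>
  moreover have "(norm (v - u))\<^sup>2 - (norm (l *\<^sub>R v - u))\<^sup>2 = (1 - l) * ((1 + l) * (norm v * norm v) - 2 * inner v u)"
    by (simp add: power2_norm_eq_inner inner_diff_left inner_diff_right inner_commute algebra_simps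
        flip: power2_eq_square)
  ultimately have "(norm (l *\<^sub>R v - u))\<^sup>2 \<le> (norm (v - u))\<^sup>2" by linarith
  then show ?thesis unfolding c by (rule power2_le_imp_le) simp
qed

text \<open>One step of projected gradient descent, started from the perturbed point
  \<open>\<Delta>\<close> instead of \<open>d\<close>. The term \<open>4 * D * e\<close> comes from
  \<open>norm (d - u) \<le> 2 * D\<close>, the remaining ones from
  \<open>(a + b)^2 \<le> 2 * a^2 + 2 * b^2\<close>.\<close>

lemma clipped_descent_step:
  fixes d \<Delta> g u :: "'a::euclidean_space"
  assumes D: "0 \<le> D" and u: "norm u \<le> D" and d: "norm d \<le> D" and e: "norm (\<Delta> - d) \<le> e"
  shows "2 * \<eta> * inner g (d - u)
    \<le> (norm (d - u))\<^sup>2 - (norm (clip D (\<Delta> - \<eta> *\<^sub>R g) - u))\<^sup>2 + (4 * D * e + 2 * e\<^sup>2) + 2 * \<eta>\<^sup>2 * (norm g)\<^sup>2"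
proof -
  define p where "p = d - u"
  define r where "r = \<Delta> - d"
  have np: "norm p \<le> 2 * D" using norm_triangle_ineq4[of d u] d u by (simp add: p_def)
  have nr: "norm r \<le> e" using e by (simp add: r_def)
  have "norm (clip D (\<Delta> - \<eta> *\<^sub>R g) - u) \<le> norm (p + (r - \<eta> *\<^sub>R g))"
    using norm_clip_diff_le[OF D u, of "\<Delta> - \<eta> *\<^sub>R g"] by (simp add: p_def r_def algebra_simps)
  then have le: "(norm (clip D (\<Delta> - \<eta> *\<^sub>R g) - u))\<^sup>2 \<le> (norm (p + (r - \<eta> *\<^sub>R g)))\<^sup>2" by (rule power_mono) simp
  have ex: "(norm (p + (r - \<eta> *\<^sub>R g)))\<^sup>2 = (norm p)\<^sup>2 + 2 * inner p (r - \<eta> *\<^sub>R g) + (norm (r - \<eta> *\<^sub>R g))\<^sup>2"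
    unfolding power2_norm_eq_inner by (simp add: inner_add_left inner_add_right inner_commute)
  have ip: "inner p (r - \<eta> *\<^sub>R g) = inner p r - \<eta> * inner g p"
    by (simp add: inner_diff_right inner_commute)
  have sq: "(norm (r - \<eta> *\<^sub>R g))\<^sup>2 \<le> 2 * e\<^sup>2 + 2 * \<eta>\<^sup>2 * (norm g)\<^sup>2"
  proof -
    have "(norm (r - \<eta> *\<^sub>R g))\<^sup>2 \<le> (norm r + norm (\<eta> *\<^sub>R g))\<^sup>2"
      by (intro power_mono norm_triangle_ineq4) simp
    also have "\<dots> \<le> 2 * (norm r)\<^sup>2 + 2 * (norm (\<eta> *\<^sub>R g))\<^sup>2"
      using sum_squares_bound[of "norm r" "norm (\<eta> *\<^sub>R g)"] by (simp add: power2_sum)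
    also have "\<dots> \<le> 2 * e\<^sup>2 + 2 * (norm (\<eta> *\<^sub>R g))\<^sup>2"
      using nr by (simp add: power_mono)
    finally show ?thesis by (simp add: power_mult_distrib)
  qed
  have pr: "inner p r \<le> 2 * D * e"
  proof -
    have "inner p r \<le> norm p * norm r" by (rule norm_cauchy_schwarz)
    also have "\<dots> \<le> 2 * D * e" using np nr D by (intro mult_mono) auto
    finally show ?thesis .
  qed
  have "2 * \<eta> * inner g p = 2 * (\<eta> * inner g p)" by simp
  then show ?thesis using le ex ip sq pr unfolding p_def[symmetric] by linarith
qed

lemma sum_telescope_const:
  fixes a b :: "nat \<Rightarrow> real"
  shows "(\<Sum>t<T. (a t - a (Suc t)) + c + b t) = (a 0 - a T) + real T * c + (\<Sum>t<T. b t)"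
  by (simp add: sum.distrib sum_lessThan_telescope')

text \<open>Summation of the one-step inequalities against the comparator that points against the sum of the
  averaged gradients.\<close>
lemma epoch_inequality:
  fixes y d \<Delta> g m a :: "nat \<Rightarrow> 'a::euclidean_space" and h :: "'a \<Rightarrow> real"
  assumes D: "0 \<le> D" and \<eta>: "0 < \<eta>" and e0: "0 \<le> e"
    and y: "\<And>t. t < T \<Longrightarrow> y (Suc t) = y t + \<Delta> t"
    and d0: "d 0 = 0" and d: "\<And>t. t < T \<Longrightarrow> d (Suc t) = clip D (\<Delta> t - \<eta> *\<^sub>R g t)"
    and nd: "\<And>t. t < T \<Longrightarrow> norm (d t) \<le> D"
    and e: "\<And>t. t < T \<Longrightarrow> norm (\<Delta> t - d t) \<le> e"
    and h: "\<And>t. t < T \<Longrightarrow> h (y t + d t) - h (y t) = inner (m t) (d t)"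
    and lip: "\<And>x z. \<bar>h x - h z\<bar> \<le> L * norm (x - z)" and L: "0 \<le> L"
    and B: "\<And>t. t < T \<Longrightarrow> norm (a t - m t) \<le> B"
  shows "D * norm (\<Sum>t<T. m t) \<le> h (y 0) - h (y T) + real T * (L * e) + 2 * D * (real T * B)
    - (\<Sum>t<T. inner (g t - a t) (d t)) + D * norm (\<Sum>t<T. g t - a t)
    + D\<^sup>2 / (2 * \<eta>) + real T * (2 * D * e + e\<^sup>2) / \<eta> + \<eta> * (\<Sum>t<T. (norm (g t))\<^sup>2)"
proof -
  define M where "M = (\<Sum>t<T. m t)"
  \<comment> \<open>If \<open>M\<close> vanishes, the quotient is 0 by convention and so is the
    comparator.\<close>
  define u where "u = - (D / norm M) *\<^sub>R M"
  have nu: "norm u \<le> D" using D by (cases "M = 0") (auto simp: u_def)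
  have Mu: "inner M u = - D * norm M"
    by (cases "M = 0") (auto simp: u_def power2_norm_eq_inner[symmetric] power2_eq_square)
  have tel: "(\<Sum>t<T. f (Suc t) - f t) = f T - f 0" for f :: "nat \<Rightarrow> real" by (rule sum_lessThan_telescope)
  have regret: "(\<Sum>t<T. inner (g t) (d t - u))
      \<le> D\<^sup>2 / (2 * \<eta>) + real T * (2 * D * e + e\<^sup>2) / \<eta> + \<eta> * (\<Sum>t<T. (norm (g t))\<^sup>2)"
  proof -
    have "(\<Sum>t<T. 2 * \<eta> * inner (g t) (d t - u))
      \<le> (\<Sum>t<T. ((norm (d t - u))\<^sup>2 - (norm (d (Suc t) - u))\<^sup>2) + (4 * D * e + 2 * e\<^sup>2) + 2 * \<eta>\<^sup>2 * (norm (g t))\<^sup>2)"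
      using clipped_descent_step[OF D nu nd e] by (intro sum_mono) (simp add: d)
    also have "\<dots> = ((norm (d 0 - u))\<^sup>2 - (norm (d T - u))\<^sup>2) + real T * (4 * D * e + 2 * e\<^sup>2) + 2 * \<eta>\<^sup>2 * (\<Sum>t<T. (norm (g t))\<^sup>2)"
      unfolding sum_distrib_left by (rule sum_telescope_const)
    also have "\<dots> \<le> D\<^sup>2 + real T * (4 * D * e + 2 * e\<^sup>2) + 2 * \<eta>\<^sup>2 * (\<Sum>t<T. (norm (g t))\<^sup>2)"
    proof -
      have "(norm u)\<^sup>2 \<le> D\<^sup>2" using nu by (intro power_mono) auto
      moreover have "0 \<le> (norm (d T - u))\<^sup>2" by simp
      ultimately show ?thesis unfolding d0 diff_0 norm_minus_cancel by linarith
    qed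
    finally have "(\<Sum>t<T. inner (g t) (d t - u)) * (2 * \<eta>)
        \<le> D\<^sup>2 + real T * (4 * D * e + 2 * e\<^sup>2) + 2 * \<eta>\<^sup>2 * (\<Sum>t<T. (norm (g t))\<^sup>2)"
      by (simp add: sum_distrib_left mult.commute)
    then have "(\<Sum>t<T. inner (g t) (d t - u))
        \<le> (D\<^sup>2 + real T * (4 * D * e + 2 * e\<^sup>2) + 2 * \<eta>\<^sup>2 * (\<Sum>t<T. (norm (g t))\<^sup>2)) / (2 * \<eta>)"
      using \<eta> by (simp add: pos_le_divide_eq)
    also have "\<dots> = D\<^sup>2 / (2 * \<eta>) + real T * (2 * D * e + e\<^sup>2) / \<eta> + \<eta> * (\<Sum>t<T. (norm (g t))\<^sup>2)"
      using \<eta> by (simp add: field_simps power2_eq_square)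
    finally show ?thesis .
  qed
  have "h (y T) - h (y 0) = (\<Sum>t<T. h (y (Suc t)) - h (y t))" using tel[of "\<lambda>t. h (y t)"] by simp
  also have "\<dots> \<le> (\<Sum>t<T. inner (m t) (d t) + L * e)"
  proof (intro sum_mono)
    fix t assume "t \<in> {..<T}"
    then have t: "t < T" by simp
    have "h (y (Suc t)) - h (y t + d t) \<le> L * norm (\<Delta> t - d t)"
      using lip[of "y (Suc t)" "y t + d t"] y[OF t] by simp
    also have "\<dots> \<le> L * e" using e[OF t] L by (rule mult_left_mono)
    finally show "h (y (Suc t)) - h (y t) \<le> inner (m t) (d t) + L * e" using h[OF t] by linarith
  qed
  also have "\<dots> = (\<Sum>t<T. inner (m t) (d t)) + real T * (L * e)" by (simp add: sum.distrib)
  finally have desc: "h (y T) - h (y 0) \<le> (\<Sum>t<T. inner (m t) (d t)) + real T * (L * e)" .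
  \<comment> \<open>Five parts: the comparator, the bias \<open>m - a\<close>, the noise
    \<open>g - a\<close> against \<open>d\<close> and against \<open>u\<close>, and the regret. The
    noise against \<open>d\<close> will have mean zero; \<open>u\<close> depends on the whole epoch,
    so its product with the noise is bounded by norms.\<close>
  have "(\<Sum>t<T. inner (m t) (d t)) = inner M u + (\<Sum>t<T. inner (m t - a t) (d t - u))
      - (\<Sum>t<T. inner (g t - a t) (d t)) + inner (\<Sum>t<T. g t - a t) u + (\<Sum>t<T. inner (g t) (d t - u))"
    unfolding M_def inner_sum_left sum.distrib[symmetric] sum_subtractf[symmetric]
    by (intro sum.cong refl) (simp add: inner_diff_left inner_diff_right)
  also have "\<dots> \<le> - D * norm M + 2 * D * (real T * B) - (\<Sum>t<T. inner (g t - a t) (d t))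
      + D * norm (\<Sum>t<T. g t - a t) + (\<Sum>t<T. inner (g t) (d t - u))"
  proof -
    have "inner (m t - a t) (d t - u) \<le> 2 * D * B" if t: "t < T" for t
    proof -
      have "inner (m t - a t) (d t - u) \<le> norm (m t - a t) * norm (d t - u)" by (rule norm_cauchy_schwarz)
      also have "\<dots> \<le> B * (2 * D)"
        using B[OF t] norm_triangle_ineq4[of "d t" u] nd[OF t] nu order.trans[OF norm_ge_zero B[OF t]]
        by (intro mult_mono) (auto simp: norm_minus_commute)
      finally show ?thesis by (simp add: mult.commute)
    qed
    then have "(\<Sum>t<T. inner (m t - a t) (d t - u)) \<le> (\<Sum>t<T. 2 * D * B)" by (intro sum_mono) auto
    moreover have "inner (\<Sum>t<T. g t - a t) u \<le> D * norm (\<Sum>t<T. g t - a t)"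
      using norm_cauchy_schwarz[of "\<Sum>t<T. g t - a t" u] nu
      by (smt (verit, best) mult.commute mult_left_mono norm_ge_zero)
    ultimately show ?thesis unfolding Mu by (simp add: mult.left_commute)
  qed
  finally show ?thesis using desc regret unfolding M_def[symmetric] by linarith
qed

section \<open>The trajectory\<close>

text \<open>The sample as a function of the state and of the current draw, so that the state can be
  frozen while the draw is integrated out.\<close>

definition grad_sample :: "(nat \<Rightarrow> 'a::euclidean_space \<Rightarrow> 'x \<Rightarrow> real) \<Rightarrow> real \<Rightarrow> 'a state \<Rightarrow> ('x, 'a) draw \<Rightarrow> 'a" where
  "grad_sample F c S \<rho> = (case \<rho> of (it, s, \<xi>, z) \<Rightarrow>
      first_order_estimator (F it) c (pos S it + s it *\<^sub>R dir S it) (\<xi> it) (z it))"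

lemma doc2s_step_fields:
  fixes S :: "'a::euclidean_space state" and F :: "nat \<Rightarrow> 'a \<Rightarrow> 'x \<Rightarrow> real"
  shows "pos (doc2s_step n P F \<delta>' R \<eta> D \<rho> S)
      = fst (fast_gossip n P R (\<lambda>i. if i = fst \<rho> then pos S i + real n *\<^sub>R dir S i else pos S i))"
    and "dir (doc2s_step n P F \<delta>' R \<eta> D \<rho> S)
      = fst (fast_gossip n P R (\<lambda>i. if i = fst \<rho> then real n *\<^sub>R clip D (dir S i - \<eta> *\<^sub>R grad_sample F \<delta>' S \<rho>) else 0))"
    and "wpt (doc2s_step n P F \<delta>' R \<eta> D \<rho> S) = (\<lambda>i. pos S i + fst (snd \<rho>) i *\<^sub>R dir S i)"
    and "oracle_calls (doc2s_step n P F \<delta>' R \<eta> D \<rho> S)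
      = (oracle_calls S)(fst \<rho> := oracle_calls S (fst \<rho>) + 1)"
    and "comp_rounds (doc2s_step n P F \<delta>' R \<eta> D \<rho> S) = comp_rounds S + 1"
  by (auto simp: doc2s_step_def grad_sample_def Let_def case_prod_unfold cong: if_cong)

abbreviation ball_grad :: "('a::euclidean_space \<Rightarrow> real) \<Rightarrow> real \<Rightarrow> 'a \<Rightarrow> 'a" where
  "ball_grad f c x \<equiv> \<integral>z. nabla f (x + c *\<^sub>R z) \<partial>unif_ball"

context
  fixes n adj P and D e \<kappa> c \<eta> :: real and R :: nat and F :: "nat \<Rightarrow> 'a::euclidean_space \<Rightarrow> 'x \<Rightarrow> real"
  assumes P: "gossip_matrix n adj P" and n: "2 \<le> n" and D: "0 \<le> D"
    and \<kappa>: "5 * exp (- sqrt (spectral_gap P) * real R / 4) \<le> \<kappa>" "\<kappa> \<le> 1/2"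
    and e: "e = \<kappa> * (real n * D)"
begin

text \<open>An invariant of the iteration. Before gossip a single client carries a direction, of
  norm at most \<open>n * D\<close>, so afterwards the disagreement is at most
  \<open>\<kappa> * n * D\<close>, which is \<open>e\<close>. The disagreement \<open>x\<close> of
  the positions becomes at most \<open>\<kappa> * (x + n * (D + e))\<close>, and for
  \<open>\<kappa> \<le> 1/2\<close> the bound \<open>2 * \<kappa> * n * (D + e)\<close> reproduces
  itself.\<close>

definition consensus :: "'a state \<Rightarrow> bool" where
  "consensus S \<longleftrightarrow> norm (mean n (dir S)) \<le> D \<and>
     stack_norm n (\<lambda>i. dir S i - mean n (dir S)) \<le> e \<and>
     stack_norm n (\<lambda>i. pos S i - mean n (pos S)) \<le> 2 * \<kappa> * (real n * (D + e))"

lemma kappa_nonneg: "0 \<le> \<kappa>"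
  using \<kappa>(1) by (rule order.trans[rotated]) simp

lemma drift_nonneg: "0 \<le> e"
  using kappa_nonneg D by (simp add: e)

lemma contraction: "stack_norm n (\<lambda>i. fst (fast_gossip n P R z) i - mean n z) \<le> \<kappa> * stack_norm n (\<lambda>i. z i - mean n z)"
  using fast_gossip_contraction[OF P n, of R z] \<kappa>(1) by (meson mult_right_mono order.trans stack_norm_nonneg)

lemma consensusD:
  assumes "consensus S" "i < n"
  shows "norm (mean n (dir S)) \<le> D" "norm (dir S i - mean n (dir S)) \<le> e" "norm (dir S i) \<le> D + e"
    "norm (pos S i - mean n (pos S)) \<le> 2 * \<kappa> * (real n * (D + e))"
proof -
  show a: "norm (mean n (dir S)) \<le> D" and b: "norm (dir S i - mean n (dir S)) \<le> e"
    and "norm (pos S i - mean n (pos S)) \<le> 2 * \<kappa> * (real n * (D + e))"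
    using assms norm_le_stack_norm[OF assms(2), of "\<lambda>i. dir S i - mean n (dir S)"]
      norm_le_stack_norm[OF assms(2), of "\<lambda>i. pos S i - mean n (pos S)"]
    unfolding consensus_def by linarith+
  show "norm (dir S i) \<le> D + e"
    using norm_triangle_ineq[of "mean n (dir S)" "dir S i - mean n (dir S)"] a b by simp
qed

text \<open>The factor \<open>n\<close> in the algorithm compensates the \<open>1 / n\<close> in the
  mean, so the sampled client acts with full weight.\<close>

lemma mean_single:
  assumes "it < n"
  shows "mean n (\<lambda>i. if i = it then real n *\<^sub>R v else 0) = v"
  using assms n by (simp add: mean_def)

lemma mean_add: "mean n (\<lambda>i. x i + y i) = mean n x + mean n y"
  by (simp add: mean_def sum.distrib scaleR_add_right)

lemma doc2s_step_means:
  assumes "fst \<rho> < n"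
  shows "mean n (pos (doc2s_step n P F c R \<eta> D \<rho> S)) = mean n (pos S) + dir S (fst \<rho>)"
    and "mean n (dir (doc2s_step n P F c R \<eta> D \<rho> S)) = clip D (dir S (fst \<rho>) - \<eta> *\<^sub>R grad_sample F c S \<rho>)"
proof -
  have "(\<lambda>i. if i = fst \<rho> then pos S i + real n *\<^sub>R dir S i else pos S i)
      = (\<lambda>i. pos S i + (if i = fst \<rho> then real n *\<^sub>R dir S (fst \<rho>) else 0))" by auto
  then show "mean n (pos (doc2s_step n P F c R \<eta> D \<rho> S)) = mean n (pos S) + dir S (fst \<rho>)"
    using assms by (simp add: doc2s_step_fields mean_fast_gossip[OF P n] mean_add mean_single)
  have "(\<lambda>i. if i = fst \<rho> then real n *\<^sub>R clip D (dir S i - \<eta> *\<^sub>R grad_sample F c S \<rho>) else 0)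
      = (\<lambda>i. if i = fst \<rho> then real n *\<^sub>R clip D (dir S (fst \<rho>) - \<eta> *\<^sub>R grad_sample F c S \<rho>) else 0)" by auto
  then show "mean n (dir (doc2s_step n P F c R \<eta> D \<rho> S)) = clip D (dir S (fst \<rho>) - \<eta> *\<^sub>R grad_sample F c S \<rho>)"
    using assms by (simp add: doc2s_step_fields(2) mean_fast_gossip[OF P n] mean_single)
qed

lemma consensus_step:
  assumes it: "fst \<rho> < n" and S: "consensus S"
  shows "consensus (doc2s_step n P F c R \<eta> D \<rho> S)" (is "consensus ?S'")
proof -
  let ?it = "fst \<rho>"
  let ?v = "clip D (dir S ?it - \<eta> *\<^sub>R grad_sample F c S \<rho>)"
  have 1: "norm (mean n (dir ?S')) \<le> D"
    unfolding doc2s_step_means[OF it] by (rule norm_clip_le[OF D])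
  let ?x = "\<lambda>i. if i = ?it then real n *\<^sub>R clip D (dir S i - \<eta> *\<^sub>R grad_sample F c S \<rho>) else 0"
  have dx: "dir ?S' = fst (fast_gossip n P R ?x)" by (simp only: doc2s_step_fields(2))
  have "stack_norm n (\<lambda>i. dir ?S' i - mean n (dir ?S')) \<le> \<kappa> * stack_norm n (\<lambda>i. ?x i - mean n ?x)"
    unfolding dx mean_fast_gossip[OF P n] by (rule contraction)
  also have "\<dots> \<le> \<kappa> * stack_norm n ?x" by (intro mult_left_mono stack_norm_sub_mean_le kappa_nonneg)
  also have "stack_norm n ?x = real n * norm ?v" using it by (subst stack_norm_single[OF it]) auto
  also have "\<kappa> * (real n * norm ?v) \<le> e"
    unfolding e by (intro mult_left_mono norm_clip_le D kappa_nonneg) auto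
  finally have 2: "stack_norm n (\<lambda>i. dir ?S' i - mean n (dir ?S')) \<le> e" .
  let ?y = "\<lambda>i. if i = ?it then pos S i + real n *\<^sub>R dir S i else pos S i"
  let ?u = "\<lambda>i. if i = ?it then real n *\<^sub>R dir S ?it else 0"
  have y: "?y = (\<lambda>i. pos S i + ?u i)" by auto
  have py: "pos ?S' = fst (fast_gossip n P R ?y)" by (simp only: doc2s_step_fields(1))
  have "stack_norm n (\<lambda>i. pos ?S' i - mean n (pos ?S')) \<le> \<kappa> * stack_norm n (\<lambda>i. ?y i - mean n ?y)"
    unfolding py mean_fast_gossip[OF P n] by (rule contraction)
  also have "(\<lambda>i. ?y i - mean n ?y) = (\<lambda>i. (pos S i - mean n (pos S)) + (?u i - mean n ?u))"
    unfolding y mean_add by (auto simp: algebra_simps)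
  also have "\<kappa> * stack_norm n (\<lambda>i. (pos S i - mean n (pos S)) + (?u i - mean n ?u))
      \<le> \<kappa> * (stack_norm n (\<lambda>i. pos S i - mean n (pos S)) + stack_norm n (\<lambda>i. ?u i - mean n ?u))"
    by (intro mult_left_mono stack_norm_triangle kappa_nonneg)
  also have "\<dots> \<le> \<kappa> * (2 * \<kappa> * (real n * (D + e)) + real n * (D + e))"
  proof (intro mult_left_mono add_mono kappa_nonneg)
    show "stack_norm n (\<lambda>i. pos S i - mean n (pos S)) \<le> 2 * \<kappa> * (real n * (D + e))"
      using S by (simp add: consensus_def)
    have "stack_norm n (\<lambda>i. ?u i - mean n ?u) \<le> stack_norm n ?u" by (rule stack_norm_sub_mean_le)
    also have "\<dots> = real n * norm (dir S ?it)" by (subst stack_norm_single[OF it]) auto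
    also have "\<dots> \<le> real n * (D + e)" by (intro mult_left_mono consensusD(3)[OF S it]) auto
    finally show "stack_norm n (\<lambda>i. ?u i - mean n ?u) \<le> real n * (D + e)" .
  qed
  \<comment> \<open>Here \<open>\<kappa> \<le> 1/2\<close> enters: the old disagreement counts for
    no more than one new step.\<close>
  also have "\<dots> \<le> \<kappa> * (1 * (real n * (D + e)) + real n * (D + e))"
    using \<kappa>(2) D drift_nonneg kappa_nonneg by (intro mult_left_mono add_mono mult_right_mono) auto
  finally have 3: "stack_norm n (\<lambda>i. pos ?S' i - mean n (pos ?S')) \<le> 2 * \<kappa> * (real n * (D + e))" by simp
  show ?thesis using 1 2 3 by (simp add: consensus_def)
qed

lemma stack_norm_zero: "stack_norm n (\<lambda>i. 0 :: 'a) = 0"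
  by (simp add: stack_norm_def L2_set_def)

lemma mean_zero: "mean n (\<lambda>i. 0 :: 'a) = 0"
  by (simp add: mean_def)

lemma consensus_reset: "consensus S \<Longrightarrow> consensus (S\<lparr>dir := \<lambda>i. 0\<rparr>)"
  using D drift_nonneg by (simp add: consensus_def mean_zero stack_norm_zero)

end

section \<open>The stochastic gradient of one iteration\<close>

text \<open>The hypothesis is on the nonnegative integral, which Tonelli's theorem handles before
  integrability is known.\<close>

lemma L2_bound:
  fixes f :: "'b \<Rightarrow> 'c::euclidean_space"
  assumes M: "prob_space M" and f: "f \<in> borel_measurable M"
    and le: "(\<integral>\<^sup>+x. ennreal ((norm (f x))\<^sup>2) \<partial>M) \<le> ennreal C" and C: "0 \<le> C"
  shows "integrable M (\<lambda>x. (norm (f x))\<^sup>2)" "(\<integral>x. (norm (f x))\<^sup>2 \<partial>M) \<le> C" "integrable M f"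
proof -
  interpret prob_space M by fact
  note [measurable] = f
  show i: "integrable M (\<lambda>x. (norm (f x))\<^sup>2)"
  proof (rule integrableI_bounded)
    have "(\<integral>\<^sup>+x. ennreal (norm ((norm (f x))\<^sup>2)) \<partial>M) \<le> ennreal C" using le by simp
    also have "\<dots> < \<infinity>" by simp
    finally show "(\<integral>\<^sup>+x. ennreal (norm ((norm (f x))\<^sup>2)) \<partial>M) < \<infinity>" .
  qed simp
  have "ennreal (\<integral>x. (norm (f x))\<^sup>2 \<partial>M) = (\<integral>\<^sup>+x. ennreal ((norm (f x))\<^sup>2) \<partial>M)"
    using i by (intro nn_integral_eq_integral[symmetric]) auto
  then have "ennreal (\<integral>x. (norm (f x))\<^sup>2 \<partial>M) \<le> ennreal C" using le by (simp only:)
  then show "(\<integral>x. (norm (f x))\<^sup>2 \<partial>M) \<le> C" by (simp only: ennreal_le_iff[OF C])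
  show "integrable M f"
  proof (rule Bochner_Integration.integrable_bound)
    show "integrable M (\<lambda>x. 1 + (norm (f x))\<^sup>2)" using i by simp
    have "norm (f x) \<le> norm (1 + (norm (f x))\<^sup>2)" for x
      using sum_squares_bound[of 1 "norm (f x)"] by (simp add: algebra_simps power2_eq_square)
        (smt (verit) mult_nonneg_nonneg norm_ge_zero)
    then show "AE x in M. norm (f x) \<le> norm (1 + (norm (f x))\<^sup>2)" by simp
  qed fact
qed

lemma integrable_inner_L2:
  fixes f g :: "'b \<Rightarrow> 'c::euclidean_space"
  assumes [measurable]: "f \<in> borel_measurable M" "g \<in> borel_measurable M"
    and f: "integrable M (\<lambda>x. (norm (f x))\<^sup>2)" and g: "integrable M (\<lambda>x. (norm (g x))\<^sup>2)"
  shows "integrable M (\<lambda>x. inner (f x) (g x))"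
proof (rule Bochner_Integration.integrable_bound)
  show "integrable M (\<lambda>x. (norm (f x))\<^sup>2 + (norm (g x))\<^sup>2)" using f g by simp
  have "\<bar>inner (f x) (g x)\<bar> \<le> (norm (f x))\<^sup>2 + (norm (g x))\<^sup>2" for x
  proof -
    have "\<bar>inner (f x) (g x)\<bar> \<le> norm (f x) * norm (g x)" by (rule Cauchy_Schwarz_ineq2)
    moreover have "2 * (norm (f x) * norm (g x)) \<le> (norm (f x))\<^sup>2 + (norm (g x))\<^sup>2"
      using sum_squares_bound[of "norm (f x)" "norm (g x)"] by (simp add: mult.assoc)
    moreover have "0 \<le> norm (f x) * norm (g x)" by simp
    ultimately show ?thesis by linarith
  qed
  then show "AE x in M. norm (inner (f x) (g x)) \<le> norm ((norm (f x))\<^sup>2 + (norm (g x))\<^sup>2)" by simp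
qed measurable

text \<open>Pointwise, \<open>norm y \<le> (norm y)^2 / (2 * b) + b / 2\<close>; integrating this
  gives Jensen's bound.\<close>

lemma expectation_norm_le_L2:
  fixes f :: "'b \<Rightarrow> 'c::euclidean_space"
  assumes M: "prob_space M" and f: "integrable M f" "integrable M (\<lambda>x. (norm (f x))\<^sup>2)"
    and le: "(\<integral>x. (norm (f x))\<^sup>2 \<partial>M) \<le> b\<^sup>2" and b: "0 < b"
  shows "(\<integral>x. norm (f x) \<partial>M) \<le> b"
proof -
  interpret prob_space M by fact
  have "norm (f x) \<le> (norm (f x))\<^sup>2 / (2 * b) + b / 2" for x
  proof -
    have "norm (f x) * (2 * b) \<le> (norm (f x))\<^sup>2 + b\<^sup>2"
      using sum_squares_bound[of "norm (f x)" b] by (simp add: mult.assoc mult.left_commute)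
    then have "norm (f x) \<le> ((norm (f x))\<^sup>2 + b\<^sup>2) / (2 * b)" using b by (simp add: pos_le_divide_eq)
    also have "\<dots> = (norm (f x))\<^sup>2 / (2 * b) + b / 2" using b by (simp add: field_simps power2_eq_square)
    finally show ?thesis .
  qed
  then have "(\<integral>x. norm (f x) \<partial>M) \<le> (\<integral>x. (norm (f x))\<^sup>2 / (2 * b) + b / 2 \<partial>M)"
    using f by (intro integral_mono) auto
  also have "\<dots> = (\<integral>x. (norm (f x))\<^sup>2 \<partial>M) / (2 * b) + b / 2" using f(2) by (simp add: prob_space)
  also have "\<dots> \<le> b\<^sup>2 / (2 * b) + b / 2" using le b by (intro add_mono divide_right_mono) auto
  also have "\<dots> = b" using b by (simp add: power2_eq_square)
  finally show ?thesis .
qed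

section \<open>The objectives of the clients and their average\<close>

locale stochastic_problem =
  fixes n :: nat and Dist :: "nat \<Rightarrow> 'x measure" and F :: "nat \<Rightarrow> 'a::euclidean_space \<Rightarrow> 'x \<Rightarrow> real"
    and Lip :: "nat \<Rightarrow> 'x \<Rightarrow> real" and L \<sigma> G :: real
  assumes n: "2 \<le> n" and problem: "well_posed n Dist F"
    and A1: "stochastic_Lipschitz n Dist F Lip L"
    and A3: "stochastic_gradient_oracle n Dist F \<sigma> G"
begin

lemma prob_Dist: "i < n \<Longrightarrow> prob_space (Dist i)"
  using problem by (auto simp: well_posed_def)

lemma F_integrable: "i < n \<Longrightarrow> integrable (Dist i) (F i x)"
  using problem by (auto simp: well_posed_def)

lemma F_measurable: "i < n \<Longrightarrow> F i x \<in> borel_measurable (Dist i)"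
  using F_integrable by auto

lemma F_lip: "i < n \<Longrightarrow> \<xi> \<in> space (Dist i) \<Longrightarrow> \<bar>F i x \<xi> - F i y \<xi>\<bar> \<le> Lip i \<xi> * norm (x - y)"
  using A1 by (auto simp: stochastic_Lipschitz_def)

lemma Lip_nonneg: "i < n \<Longrightarrow> \<xi> \<in> space (Dist i) \<Longrightarrow> 0 \<le> Lip i \<xi>"
proof -
  assume i: "i < n" "\<xi> \<in> space (Dist i)"
  obtain b :: 'a where b: "b \<in> Basis" using nonempty_Basis by blast
  have "0 \<le> Lip i \<xi> * norm (b - 0)" using F_lip[OF i, of b 0] by linarith
  then show ?thesis using b by simp
qed

lemma Lip_L2:
  assumes "i < n"
  shows "Lip i \<in> borel_measurable (Dist i)" "integrable (Dist i) (\<lambda>\<xi>. (Lip i \<xi>)\<^sup>2)" "(\<integral>\<xi>. (Lip i \<xi>)\<^sup>2 \<partial>Dist i) \<le> L\<^sup>2"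
  using A1 assms by (auto simp: stochastic_Lipschitz_def)

lemma L_pos: "0 < L"
  using A1 by (auto simp: stochastic_Lipschitz_def)

lemma F_continuous: "i < n \<Longrightarrow> \<xi> \<in> space (Dist i) \<Longrightarrow> continuous_on UNIV (\<lambda>x. F i x \<xi>)"
proof (rule lipschitz_on_continuous_on)
  assume "i < n" "\<xi> \<in> space (Dist i)"
  then show "(Lip i \<xi>)-lipschitz_on UNIV (\<lambda>x. F i x \<xi>)"
    using F_lip Lip_nonneg by (auto simp: lipschitz_on_def dist_norm)
qed

lemma oracle_AE:
  assumes "i < n"
  shows "AE x in lborel. has_gradient (local_obj Dist F i) x \<and>
      (AE \<xi> in Dist i. has_gradient (\<lambda>u. F i u \<xi>) x) \<and>
      (\<integral>\<xi>. nabla (\<lambda>u. F i u \<xi>) x \<partial>Dist i) = nabla (local_obj Dist F i) x"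
  using A3 assms unfolding stochastic_gradient_oracle_def Let_def by (auto elim!: eventually_mono)

text \<open>The mean Lipschitz modulus is at most \<open>L\<close> by the bound on its second
  moment.\<close>

lemma local_obj_lipschitz:
  assumes i: "i < n"
  shows "\<bar>local_obj Dist F i x - local_obj Dist F i y\<bar> \<le> L * norm (x - y)"
proof -
  interpret prob_space "Dist i" by (rule prob_Dist[OF i])
  have int: "integrable (Dist i) (Lip i)"
    by (rule square_integrable_imp_integrable[OF Lip_L2(1,2)[OF i]])
  have "(\<integral>\<xi>. norm (Lip i \<xi>) \<partial>Dist i) \<le> L"
    using Lip_L2[OF i] L_pos by (intro expectation_norm_le_L2 prob_Dist[OF i] int) auto
  moreover have "(\<integral>\<xi>. Lip i \<xi> \<partial>Dist i) \<le> (\<integral>\<xi>. norm (Lip i \<xi>) \<partial>Dist i)"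
    using int by (intro integral_mono) auto
  ultimately have EL: "(\<integral>\<xi>. Lip i \<xi> \<partial>Dist i) \<le> L" by linarith
  have "\<bar>local_obj Dist F i x - local_obj Dist F i y\<bar> = norm (\<integral>\<xi>. F i x \<xi> - F i y \<xi> \<partial>Dist i)"
    unfolding local_obj_def using F_integrable[OF i] by simp
  also have "\<dots> \<le> (\<integral>\<xi>. norm (F i x \<xi> - F i y \<xi>) \<partial>Dist i)" by (rule integral_norm_bound)
  also have "\<dots> \<le> (\<integral>\<xi>. Lip i \<xi> * norm (x - y) \<partial>Dist i)"
    using F_integrable[OF i] int F_lip[OF i] by (intro integral_mono) auto
  also have "\<dots> = (\<integral>\<xi>. Lip i \<xi> \<partial>Dist i) * norm (x - y)" by simp
  also have "\<dots> \<le> L * norm (x - y)" using EL by (intro mult_right_mono) auto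
  finally show ?thesis .
qed

lemma local_smooth:
  assumes i: "i < n"
  shows "lipschitz_ae_differentiable (local_obj Dist F i) L"
  using local_obj_lipschitz[OF i] oracle_AE[OF i] by unfold_locales (auto elim!: eventually_mono)

abbreviation "f \<equiv> global_obj n Dist F"

lemma AE_all_has_gradient: "AE x in lborel. \<forall>i<n. has_gradient (local_obj Dist F i) x"
proof -
  have "AE x in lborel. \<forall>i\<in>{..<n}. has_gradient (local_obj Dist F i) x"
    using oracle_AE by (intro AE_finite_allI) (auto elim!: eventually_mono)
  then show ?thesis by (simp only: Ball_def lessThan_iff)
qed

lemma GDERIV_global_obj:
  assumes "\<forall>i<n. has_gradient (local_obj Dist F i) x"
  shows "GDERIV f x :> (1 / real n) *\<^sub>R (\<Sum>i<n. nabla (local_obj Dist F i) x)"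
proof -
  have "((\<lambda>y. (1 / real n) * (\<Sum>i<n. local_obj Dist F i y)) has_derivative
      (\<lambda>h. (1 / real n) * (\<Sum>i<n. inner h (nabla (local_obj Dist F i) x)))) (at x)"
    using assms GDERIV_nabla unfolding gderiv_def
    by (intro has_derivative_mult_right has_derivative_sum) auto
  then show ?thesis
    unfolding gderiv_def global_obj_def[abs_def] by (simp add: inner_sum_right)
qed

lemma global_smooth: "lipschitz_ae_differentiable f L"
proof
  fix x y
  have "\<bar>f x - f y\<bar> = (1 / real n) * \<bar>\<Sum>i<n. local_obj Dist F i x - local_obj Dist F i y\<bar>"
    by (simp add: global_obj_def sum_subtractf abs_mult flip: right_diff_distrib diff_divide_distrib)
  also have "\<dots> \<le> (1 / real n) * (\<Sum>i<n. L * norm (x - y))"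
    by (intro mult_left_mono order.trans[OF sum_abs] sum_mono local_obj_lipschitz) auto
  also have "\<dots> = L * norm (x - y)" using n by simp
  finally show "\<bar>f x - f y\<bar> \<le> L * norm (x - y)" .
next
  show "AE x in lborel. has_gradient f x"
    using AE_all_has_gradient by eventually_elim (use GDERIV_global_obj has_gradient_def in blast)
qed

sublocale f: lipschitz_ae_differentiable f L
  by (rule global_smooth)

text \<open>At points where all local objectives are differentiable the gradient of \<open>f\<close>
  is the mean of theirs; the perturbation hits such points almost surely.\<close>

lemma sgrad_global:
  assumes c: "0 < c"
  shows "f.sgrad c x = (1 / real n) *\<^sub>R (\<Sum>i<n. ball_grad (local_obj Dist F i) c x)"
proof -
  have "AE z in unif_ball. \<forall>i<n. has_gradient (local_obj Dist F i) (x + c *\<^sub>R z)"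
    using AE_unif_ball_affine[OF AE_all_has_gradient, of c x] c by simp
  then have ae: "AE z in unif_ball. nabla f (x + c *\<^sub>R z) = (1 / real n) *\<^sub>R (\<Sum>i<n. nabla (local_obj Dist F i) (x + c *\<^sub>R z))"
    by eventually_elim (use GDERIV_global_obj nabla_eqI in blast)
  have int: "integrable unif_ball (\<lambda>z. nabla (local_obj Dist F i) (x + c *\<^sub>R z))" if "i < n" for i
    by (rule lipschitz_ae_differentiable.sgrad_integrable[OF local_smooth[OF that] c])
  have [measurable]: "nabla (local_obj Dist F i) \<in> borel_measurable borel" if "i < n" for i
    by (rule lipschitz_ae_differentiable.measurable_nabla[OF local_smooth[OF that]])
  have "f.sgrad c x = (\<integral>z. (1 / real n) *\<^sub>R (\<Sum>i<n. nabla (local_obj Dist F i) (x + c *\<^sub>R z)) \<partial>unif_ball)"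
    unfolding f.sgrad_def using ae
    by (intro integral_cong_AE borel_measurable_scaleR borel_measurable_sum) auto
  also have "\<dots> = (1 / real n) *\<^sub>R (\<Sum>i<n. ball_grad (local_obj Dist F i) c x)"
    using int by simp
  finally show ?thesis .
qed

section \<open>Expected and sampled gradients along a segment\<close>

context
  fixes c :: real
  assumes c: "0 < c"
begin

lemma ball_grad_facts:
  assumes "i < n"
  shows "norm (ball_grad (local_obj Dist F i) c x) \<le> L"
    and "norm (ball_grad (local_obj Dist F i) c x - ball_grad (local_obj Dist F i) c y) \<le> L * real DIM('a) * norm (x - y) / c"
    and "continuous_on UNIV (ball_grad (local_obj Dist F i) c)"
  using lipschitz_ae_differentiable.norm_sgrad_le[OF local_smooth[OF assms] c]
    lipschitz_ae_differentiable.sgrad_lipschitz[OF local_smooth[OF assms] c]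
    lipschitz_ae_differentiable.continuous_sgrad[OF local_smooth[OF assms] c, of UNIV]
  unfolding lipschitz_ae_differentiable.sgrad_def[OF local_smooth[OF assms], abs_def] by auto

text \<open>What client \<open>i\<close> reports in expectation when queried at a perturbed random
  point of the segment; \<open>samp_mean\<close> establishes this.\<close>

definition line_grad :: "nat \<Rightarrow> 'a \<Rightarrow> 'a \<Rightarrow> 'a" where
  "line_grad i y v = (\<integral>s. ball_grad (local_obj Dist F i) c (y + s *\<^sub>R v) \<partial>unif01)"

lemma line_grad_integrable:
  assumes "i < n"
  shows "integrable unif01 (\<lambda>s. ball_grad (local_obj Dist F i) c (y + s *\<^sub>R v))"
    and "norm (line_grad i y v) \<le> L"
proof -
  have "continuous_on UNIV (\<lambda>s. ball_grad (local_obj Dist F i) c (y + s *\<^sub>R v))"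
    by (intro continuous_on_compose2[OF ball_grad_facts(3)[OF assms]] continuous_intros) auto
  then have [measurable]: "(\<lambda>s. ball_grad (local_obj Dist F i) c (y + s *\<^sub>R v)) \<in> borel_measurable borel"
    by (rule borel_measurable_continuous_onI)
  have m: "(\<lambda>s. ball_grad (local_obj Dist F i) c (y + s *\<^sub>R v)) \<in> borel_measurable unif01"
    by measurable
  show "integrable unif01 (\<lambda>s. ball_grad (local_obj Dist F i) c (y + s *\<^sub>R v))" "norm (line_grad i y v) \<le> L"
    unfolding line_grad_def
    by (intro norm_integral_le_AE[where B=L] prob_space_unif01 m AE_I2 ball_grad_facts(1)[OF assms])+
qed

text \<open>Turns disagreement of positions and directions into a bias of the gradient. The
  dimension enters through the Lipschitz constant of the smoothed gradient.\<close>

lemma line_grad_diff_le: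
  assumes i: "i < n"
  shows "norm (line_grad i y v - line_grad i y' v') \<le> L * real DIM('a) * (norm (y - y') + norm (v - v')) / c"
proof -
  note int = line_grad_integrable(1)[OF i]
  have "line_grad i y v - line_grad i y' v'
      = (\<integral>s. ball_grad (local_obj Dist F i) c (y + s *\<^sub>R v) - ball_grad (local_obj Dist F i) c (y' + s *\<^sub>R v') \<partial>unif01)"
    unfolding line_grad_def using int by simp
  moreover have "norm \<dots> \<le> L * real DIM('a) * (norm (y - y') + norm (v - v')) / c"
  proof (rule norm_integral_le_AE[OF prob_space_unif01])
    show "AE s in unif01. norm (ball_grad (local_obj Dist F i) c (y + s *\<^sub>R v) - ball_grad (local_obj Dist F i) c (y' + s *\<^sub>R v'))
        \<le> L * real DIM('a) * (norm (y - y') + norm (v - v')) / c"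
      using AE_unif01
    proof eventually_elim
      fix s :: real assume s: "0 \<le> s \<and> s \<le> 1"
      have "norm (y + s *\<^sub>R v - (y' + s *\<^sub>R v')) = norm ((y - y') + s *\<^sub>R (v - v'))"
        by (simp add: algebra_simps)
      also have "\<dots> \<le> norm (y - y') + s * norm (v - v')"
        using norm_triangle_ineq[of "y - y'" "s *\<^sub>R (v - v')"] s by simp
      also have "\<dots> \<le> norm (y - y') + 1 * norm (v - v')" using s by (intro add_left_mono mult_right_mono) auto
      finally have "L * real DIM('a) * norm (y + s *\<^sub>R v - (y' + s *\<^sub>R v')) / c
          \<le> L * real DIM('a) * (norm (y - y') + norm (v - v')) / c"
        using L_pos c by (intro divide_right_mono mult_left_mono) auto
      then show "norm (ball_grad (local_obj Dist F i) c (y + s *\<^sub>R v) - ball_grad (local_obj Dist F i) c (y' + s *\<^sub>R v'))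
        \<le> L * real DIM('a) * (norm (y - y') + norm (v - v')) / c"
        using ball_grad_facts(2)[OF i, of "y + s *\<^sub>R v" "y' + s *\<^sub>R v'"] by linarith
    qed
  qed (use int in auto)
  ultimately show ?thesis by simp
qed

lemma line_grad_measurable:
  assumes i: "i < n" and [measurable]: "y \<in> borel_measurable N" "v \<in> borel_measurable N"
  shows "(\<lambda>\<omega>. line_grad i (y \<omega>) (v \<omega>)) \<in> borel_measurable N"
proof -
  interpret unif01: prob_space unif01 by (rule prob_space_unif01)
  have [measurable]: "ball_grad (local_obj Dist F i) c \<in> borel_measurable borel"
    by (intro borel_measurable_continuous_onI ball_grad_facts(3)[OF i])
  have "(\<lambda>p. ball_grad (local_obj Dist F i) c (y (fst p) + snd p *\<^sub>R v (fst p))) \<in> borel_measurable (N \<Otimes>\<^sub>M unif01)"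
    by (rule measurable_compose[where g="ball_grad (local_obj Dist F i) c"]) measurable
  then show ?thesis
    unfolding line_grad_def
    by (intro unif01.borel_measurable_lebesgue_integral) (simp add: case_prod_unfold)
qed

lemma sample_measurable:
  assumes i: "i < n" and [measurable]: "u \<in> borel_measurable N" and v: "v \<in> measurable N (Dist i)"
  shows "(\<lambda>p. nabla (\<lambda>x. F i x (v p)) (u p)) \<in> borel_measurable N"
  using F_measurable[OF i] F_continuous[OF i] assms by (intro borel_measurable_nabla_param) auto

context
  fixes j :: nat and y v :: 'a
  assumes j: "j < n"
begin

text \<open>The sample of client \<open>j\<close> as a function of interpolation weight, data and
  perturbation, in this order, with the state frozen in \<open>y\<close> and
  \<open>v\<close>.\<close>

definition samp :: "real \<times> 'x \<times> 'a \<Rightarrow> 'a" where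
  "samp p = nabla (\<lambda>u. F j u (fst (snd p))) (y + fst p *\<^sub>R v + c *\<^sub>R snd (snd p))"

lemma samp_measurable: "samp \<in> borel_measurable (unif01 \<Otimes>\<^sub>M (Dist j \<Otimes>\<^sub>M unif_ball))"
proof -
  have "(\<lambda>p. y + fst p *\<^sub>R v + c *\<^sub>R snd (snd p)) \<in> borel_measurable (unif01 \<Otimes>\<^sub>M (Dist j \<Otimes>\<^sub>M (unif_ball :: 'a measure)))"
    by measurable
  then show ?thesis unfolding samp_def[abs_def] by (intro sample_measurable[OF j]) auto
qed

text \<open>For a fixed weight the oracle condition fails on a null set of points, hence for a null
  set of perturbations.\<close>

lemma samp_AE:
  "AE z in unif_ball. (AE \<xi> in Dist j. has_gradient (\<lambda>u. F j u \<xi>) (y + s *\<^sub>R v + c *\<^sub>R z)) \<and>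
      (\<integral>\<xi>. samp (s, \<xi>, z) \<partial>Dist j) = nabla (local_obj Dist F j) (y + s *\<^sub>R v + c *\<^sub>R z)"
proof -
  have "AE x in lborel. (AE \<xi> in Dist j. has_gradient (\<lambda>u. F j u \<xi>) x) \<and>
      (\<integral>\<xi>. nabla (\<lambda>u. F j u \<xi>) x \<partial>Dist j) = nabla (local_obj Dist F j) x"
    using oracle_AE[OF j] by eventually_elim auto
  from AE_unif_ball_affine[OF this, of c "y + s *\<^sub>R v"] c show ?thesis by (simp add: samp_def)
qed

text \<open>A gradient is bounded by the Lipschitz modulus of the same sample, whose second moment
  is at most \<open>L^2\<close>.\<close>

lemma samp_sq_nn: "(\<integral>\<^sup>+p. ennreal ((norm (samp p))\<^sup>2) \<partial>(unif01 \<Otimes>\<^sub>M (Dist j \<Otimes>\<^sub>M unif_ball))) \<le> ennreal (L\<^sup>2)"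
proof -
  interpret U: prob_space unif01 by (rule prob_space_unif01)
  interpret B: prob_space "unif_ball :: 'a measure" by (rule prob_space_unif_ball)
  interpret J: prob_space "Dist j" by (rule prob_Dist[OF j])
  interpret JB: prob_space "Dist j \<Otimes>\<^sub>M (unif_ball :: 'a measure)"
    by (intro prob_space_pair prob_Dist[OF j] prob_space_unif_ball)
  interpret P: pair_sigma_finite "Dist j" "unif_ball :: 'a measure" ..
  note [measurable] = samp_measurable
  have [measurable]: "(\<lambda>q. samp (s, q)) \<in> borel_measurable (Dist j \<Otimes>\<^sub>M unif_ball)" if "s \<in> space unif01" for s
    using that by (intro measurable_compose[OF _ samp_measurable]) auto
  have inner: "(\<integral>\<^sup>+q. ennreal ((norm (samp (s, q)))\<^sup>2) \<partial>(Dist j \<Otimes>\<^sub>M unif_ball)) \<le> ennreal (L\<^sup>2)" for s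
  proof -
    have "(\<integral>\<^sup>+q. ennreal ((norm (samp (s, q)))\<^sup>2) \<partial>(Dist j \<Otimes>\<^sub>M unif_ball))
        = (\<integral>\<^sup>+z. \<integral>\<^sup>+\<xi>. ennreal ((norm (samp (s, \<xi>, z)))\<^sup>2) \<partial>Dist j \<partial>unif_ball)"
      by (subst P.nn_integral_snd[symmetric]) (auto simp: case_prod_unfold)
    \<comment> \<open>The perturbation is the outer variable: the oracle condition holds for almost
      every point, and then for almost every sample at that point.\<close>
    also have "\<dots> \<le> (\<integral>\<^sup>+z. ennreal (L\<^sup>2) \<partial>(unif_ball :: 'a measure))"
    proof (rule nn_integral_mono_AE)
      show "AE z in unif_ball. (\<integral>\<^sup>+\<xi>. ennreal ((norm (samp (s, \<xi>, z)))\<^sup>2) \<partial>Dist j) \<le> ennreal (L\<^sup>2)"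
        using samp_AE[of s]
      proof eventually_elim
        fix z assume z: "(AE \<xi> in Dist j. has_gradient (\<lambda>u. F j u \<xi>) (y + s *\<^sub>R v + c *\<^sub>R z)) \<and>
          (\<integral>\<xi>. samp (s, \<xi>, z) \<partial>Dist j) = nabla (local_obj Dist F j) (y + s *\<^sub>R v + c *\<^sub>R z)"
        have "(\<integral>\<^sup>+\<xi>. ennreal ((norm (samp (s, \<xi>, z)))\<^sup>2) \<partial>Dist j) \<le> (\<integral>\<^sup>+\<xi>. ennreal ((Lip j \<xi>)\<^sup>2) \<partial>Dist j)"
        proof (rule nn_integral_mono_AE)
          show "AE \<xi> in Dist j. ennreal ((norm (samp (s, \<xi>, z)))\<^sup>2) \<le> ennreal ((Lip j \<xi>)\<^sup>2)"
            using conjunct1[OF z] AE_space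
          proof eventually_elim
            fix \<xi> assume "has_gradient (\<lambda>u. F j u \<xi>) (y + s *\<^sub>R v + c *\<^sub>R z)" "\<xi> \<in> space (Dist j)"
            then have "norm (samp (s, \<xi>, z)) \<le> Lip j \<xi>"
              unfolding samp_def fst_conv snd_conv by (intro norm_nabla_le F_lip[OF j])
            then show "ennreal ((norm (samp (s, \<xi>, z)))\<^sup>2) \<le> ennreal ((Lip j \<xi>)\<^sup>2)"
              by (intro ennreal_leI power_mono) auto
          qed
        qed
        also have "\<dots> = ennreal (\<integral>\<xi>. (Lip j \<xi>)\<^sup>2 \<partial>Dist j)"
          using Lip_L2(2)[OF j] by (intro nn_integral_eq_integral) auto
        also have "\<dots> \<le> ennreal (L\<^sup>2)" by (intro ennreal_leI Lip_L2(3)[OF j])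
        finally show "(\<integral>\<^sup>+\<xi>. ennreal ((norm (samp (s, \<xi>, z)))\<^sup>2) \<partial>Dist j) \<le> ennreal (L\<^sup>2)" .
      qed
    qed
    also have "\<dots> = ennreal (L\<^sup>2)" using B.emeasure_space_1 by simp
    finally show ?thesis .
  qed
  have "(\<integral>\<^sup>+p. ennreal ((norm (samp p))\<^sup>2) \<partial>(unif01 \<Otimes>\<^sub>M (Dist j \<Otimes>\<^sub>M unif_ball)))
      = (\<integral>\<^sup>+s. \<integral>\<^sup>+q. ennreal ((norm (samp (s, q)))\<^sup>2) \<partial>(Dist j \<Otimes>\<^sub>M unif_ball) \<partial>unif01)"
    by (rule JB.nn_integral_fst[symmetric]) measurable
  also have "\<dots> \<le> (\<integral>\<^sup>+s. ennreal (L\<^sup>2) \<partial>unif01)" by (intro nn_integral_mono inner)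
  also have "\<dots> = ennreal (L\<^sup>2)" using U.emeasure_space_1 by simp
  finally show ?thesis .
qed

text \<open>Fubini with the data innermost: unbiasedness at almost every point yields the gradient
  of the local objective, the perturbation its smoothing, and the weight the average over the
  segment.\<close>

lemma samp_mean: "(\<integral>p. samp p \<partial>(unif01 \<Otimes>\<^sub>M (Dist j \<Otimes>\<^sub>M unif_ball))) = line_grad j y v"
proof -
  interpret U: prob_space unif01 by (rule prob_space_unif01)
  interpret B: prob_space "unif_ball :: 'a measure" by (rule prob_space_unif_ball)
  interpret J: prob_space "Dist j" by (rule prob_Dist[OF j])
  interpret JB: prob_space "Dist j \<Otimes>\<^sub>M (unif_ball :: 'a measure)"
    by (intro prob_space_pair prob_Dist[OF j] prob_space_unif_ball)
  interpret P: pair_sigma_finite "Dist j" "unif_ball :: 'a measure" ..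
  interpret Q: pair_sigma_finite unif01 "Dist j \<Otimes>\<^sub>M (unif_ball :: 'a measure)" ..
  have int: "integrable (unif01 \<Otimes>\<^sub>M (Dist j \<Otimes>\<^sub>M unif_ball)) samp"
    using L2_bound(3)[OF prob_space_pair[OF prob_space_unif01 JB.prob_space_axioms] samp_measurable samp_sq_nn] by simp
  have "(\<integral>p. samp p \<partial>(unif01 \<Otimes>\<^sub>M (Dist j \<Otimes>\<^sub>M unif_ball))) = (\<integral>s. \<integral>q. samp (s, q) \<partial>(Dist j \<Otimes>\<^sub>M unif_ball) \<partial>unif01)"
    by (rule Q.integral_fst'[OF int, symmetric])
  also have "\<dots> = (\<integral>s. ball_grad (local_obj Dist F j) c (y + s *\<^sub>R v) \<partial>unif01)"
  proof (rule integral_cong_AE)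
    show "AE s in unif01. (\<integral>q. samp (s, q) \<partial>(Dist j \<Otimes>\<^sub>M unif_ball)) = ball_grad (local_obj Dist F j) c (y + s *\<^sub>R v)"
      using Q.AE_integrable_fst'[OF int]
    proof eventually_elim
      fix s assume s: "integrable (Dist j \<Otimes>\<^sub>M unif_ball) (\<lambda>q. samp (s, q))"
      have s': "integrable (Dist j \<Otimes>\<^sub>M unif_ball) (case_prod (\<lambda>\<xi> z. samp (s, \<xi>, z)))"
        using s by (simp add: case_prod_unfold)
      have "(\<integral>q. samp (s, q) \<partial>(Dist j \<Otimes>\<^sub>M unif_ball)) = (\<integral>z. \<integral>\<xi>. samp (s, \<xi>, z) \<partial>Dist j \<partial>unif_ball)"
        using P.integral_snd[OF s'] by (simp add: case_prod_unfold)
      also have "\<dots> = ball_grad (local_obj Dist F j) c (y + s *\<^sub>R v)"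
      proof (rule integral_cong_AE)
        show "(\<lambda>z. \<integral>\<xi>. samp (s, \<xi>, z) \<partial>Dist j) \<in> borel_measurable unif_ball"
          using P.integrable_snd[OF s'] by simp
        show "(\<lambda>z. nabla (local_obj Dist F j) (y + s *\<^sub>R v + c *\<^sub>R z)) \<in> borel_measurable unif_ball"
          using lipschitz_ae_differentiable.sgrad_integrable[OF local_smooth[OF j] c] by auto
        show "AE z in unif_ball. (\<integral>\<xi>. samp (s, \<xi>, z) \<partial>Dist j) = nabla (local_obj Dist F j) (y + s *\<^sub>R v + c *\<^sub>R z)"
          using samp_AE[of s] by eventually_elim simp
      qed
      finally show "(\<integral>q. samp (s, q) \<partial>(Dist j \<Otimes>\<^sub>M unif_ball)) = ball_grad (local_obj Dist F j) c (y + s *\<^sub>R v)" .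
    qed
  qed (use Q.integrable_fst'[OF int] line_grad_integrable(1)[OF j] in auto)
  finally show ?thesis by (simp add: line_grad_def)
qed

end

end

end

section \<open>Independence of the draws\<close>

text \<open>Overwriting one coordinate by a fresh independent copy is invisible in law. Integrating
  out the copy then acts as conditional expectation given all other draws; the martingale property
  of the noise is obtained in this way.\<close>

lemma distr_update_PiM:
  fixes M :: "'i \<Rightarrow> 'b measure"
  assumes M: "\<And>i. i \<in> I \<Longrightarrow> prob_space (M i)" and j: "j \<in> I"
  shows "distr (M j \<Otimes>\<^sub>M PiM I M) (PiM I M) (\<lambda>(x, X). X(j := x)) = PiM I M"
  using distr_pair_PiM_eq_PiM[of I M j, OF M M[OF j]] j by (simp add: insert_absorb)

lemma measurable_update_PiM:
  assumes j: "j \<in> I"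
  shows "(\<lambda>(x, X). X(j := x)) \<in> measurable (M j \<Otimes>\<^sub>M PiM I M) (PiM I M)"
proof -
  have "(\<lambda>p. (snd p)(j := fst p)) \<in> measurable (M j \<Otimes>\<^sub>M PiM I M) (PiM (insert j I) M)"
    by (rule measurable_fun_upd[where J=I]) auto
  then show ?thesis using j by (simp add: insert_absorb case_prod_unfold)
qed

lemma nn_integral_resample:
  fixes M :: "'i \<Rightarrow> 'b measure"
  assumes M: "\<And>i. i \<in> I \<Longrightarrow> prob_space (M i)" and j: "j \<in> I" and f: "f \<in> borel_measurable (PiM I M)"
  shows "(\<integral>\<^sup>+\<omega>. f \<omega> \<partial>PiM I M) = (\<integral>\<^sup>+\<omega>. \<integral>\<^sup>+x. f (fun_upd \<omega> j x) \<partial>M j \<partial>PiM I M)"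
proof -
  interpret J: prob_space "M j" by (rule M[OF j])
  interpret I: prob_space "PiM I M" by (rule prob_space_PiM[OF M])
  interpret pair_sigma_finite "M j" "PiM I M" ..
  have "(\<integral>\<^sup>+\<omega>. f \<omega> \<partial>PiM I M) = (\<integral>\<^sup>+\<omega>. f \<omega> \<partial>distr (M j \<Otimes>\<^sub>M PiM I M) (PiM I M) (\<lambda>(x, X). X(j := x)))"
    by (subst distr_update_PiM[OF M j]) auto
  also have "\<dots> = (\<integral>\<^sup>+p. f ((\<lambda>(x, X). X(j := x)) p) \<partial>(M j \<Otimes>\<^sub>M PiM I M))"
    by (rule nn_integral_distr[OF measurable_update_PiM[OF j]]) (use f in simp)
  also have "\<dots> = (\<integral>\<^sup>+\<omega>. \<integral>\<^sup>+x. f (fun_upd \<omega> j x) \<partial>M j \<partial>PiM I M)"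
    using nn_integral_snd[of "\<lambda>p. f ((\<lambda>(x, X). X(j := x)) p)"]
      measurable_compose[OF measurable_update_PiM[OF j] f]
    by (simp add: case_prod_unfold)
  finally show ?thesis .
qed

lemma integral_resample:
  fixes M :: "'i \<Rightarrow> 'b measure" and f :: "('i \<Rightarrow> 'b) \<Rightarrow> 'c::euclidean_space"
  assumes M: "\<And>i. i \<in> I \<Longrightarrow> prob_space (M i)" and j: "j \<in> I" and f: "integrable (PiM I M) f"
  shows "(\<integral>\<omega>. f \<omega> \<partial>PiM I M) = (\<integral>\<omega>. \<integral>x. f (fun_upd \<omega> j x) \<partial>M j \<partial>PiM I M)"
proof -
  interpret J: prob_space "M j" by (rule M[OF j])
  interpret I: prob_space "PiM I M" by (rule prob_space_PiM[OF M])
  interpret pair_sigma_finite "M j" "PiM I M" ..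
  have meas: "f \<in> borel_measurable (PiM I M)" using f by auto
  have "integrable (distr (M j \<Otimes>\<^sub>M PiM I M) (PiM I M) (\<lambda>(x, X). X(j := x))) f"
    using f by (subst distr_update_PiM[OF M j]) auto
  then have int: "integrable (M j \<Otimes>\<^sub>M PiM I M) (\<lambda>p. f ((\<lambda>(x, X). X(j := x)) p))"
    by (subst (asm) integrable_distr_eq[OF measurable_update_PiM[OF j] meas])
  have "(\<integral>\<omega>. f \<omega> \<partial>PiM I M) = (\<integral>\<omega>. f \<omega> \<partial>distr (M j \<Otimes>\<^sub>M PiM I M) (PiM I M) (\<lambda>(x, X). X(j := x)))"
    by (subst distr_update_PiM[OF M j]) auto
  also have "\<dots> = (\<integral>p. f ((\<lambda>(x, X). X(j := x)) p) \<partial>(M j \<Otimes>\<^sub>M PiM I M))"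
    by (rule integral_distr[OF measurable_update_PiM[OF j] meas])
  also have "\<dots> = (\<integral>\<omega>. \<integral>x. f (fun_upd \<omega> j x) \<partial>M j \<partial>PiM I M)"
    using integral_snd[of "\<lambda>x X. f (X(j := x))"] int by (simp add: case_prod_unfold)
  finally show ?thesis .
qed

section \<open>The randomness of one iteration\<close>

context stochastic_problem
begin

abbreviation noise :: "((nat \<Rightarrow> real) \<times> (nat \<Rightarrow> 'x) \<times> (nat \<Rightarrow> 'a)) measure" where
  "noise \<equiv> PiM {..<n} (\<lambda>_. unif01) \<Otimes>\<^sub>M PiM {..<n} Dist \<Otimes>\<^sub>M PiM {..<n} (\<lambda>_. unif_ball)"

lemma draw_space_eq: "draw_space n Dist = uniform_count_measure {..<n} \<Otimes>\<^sub>M noise"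
  by (simp add: draw_space_def)

lemma prob_space_noise: "prob_space noise"
  by (intro prob_space_pair prob_space_PiM prob_space_unif01 prob_space_unif_ball prob_Dist) auto

lemma prob_space_clients: "prob_space (uniform_count_measure {..<n})"
  using n by (intro prob_space_uniform_count_measure) (auto simp: lessThan_empty_iff)

lemma prob_space_draw: "prob_space (draw_space n Dist :: ('x, 'a) draw measure)"
  unfolding draw_space_eq by (intro prob_space_pair prob_space_clients prob_space_noise)

lemma draw_measurable:
  assumes \<rho>: "\<rho> \<in> measurable N (draw_space n Dist :: ('x, 'a) draw measure)"
  shows "(\<lambda>p. fst (\<rho> p)) \<in> measurable N (count_space {..<n})"
    and "i < n \<Longrightarrow> (\<lambda>p. fst (snd (\<rho> p)) i) \<in> borel_measurable N"
    and "i < n \<Longrightarrow> (\<lambda>p. fst (snd (snd (\<rho> p))) i) \<in> measurable N (Dist i)"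
    and "i < n \<Longrightarrow> (\<lambda>p. snd (snd (snd (\<rho> p))) i) \<in> borel_measurable N"
proof -
  note [measurable] = \<rho>[unfolded draw_space_eq]
  have "(\<lambda>p. fst (\<rho> p)) \<in> measurable N (uniform_count_measure {..<n})" by measurable
  then show "(\<lambda>p. fst (\<rho> p)) \<in> measurable N (count_space {..<n})"
    by (simp only: measurable_cong_sets[OF refl sets_uniform_count_measure_count_space])
  assume i: "i < n"
  then have i': "i \<in> {..<n}" by simp
  have sU: "sets unif01 = sets borel" and sB: "sets (unif_ball :: 'a measure) = sets borel" by simp_all
  have "(\<lambda>p. fst (snd (\<rho> p))) \<in> measurable N (PiM {..<n} (\<lambda>_. unif01))" by measurable
  from measurable_compose[OF this measurable_component_singleton[OF i']]
  show "(\<lambda>p. fst (snd (\<rho> p)) i) \<in> borel_measurable N" by (simp only: measurable_cong_sets[OF refl sU])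
  have "(\<lambda>p. fst (snd (snd (\<rho> p)))) \<in> measurable N (PiM {..<n} Dist)" by measurable
  from measurable_compose[OF this measurable_component_singleton[OF i']]
  show "(\<lambda>p. fst (snd (snd (\<rho> p))) i) \<in> measurable N (Dist i)" .
  have "(\<lambda>p. snd (snd (snd (\<rho> p)))) \<in> measurable N (PiM {..<n} (\<lambda>_. unif_ball :: 'a measure))" by measurable
  from measurable_compose[OF this measurable_component_singleton[OF i']]
  show "(\<lambda>p. snd (snd (snd (\<rho> p))) i) \<in> borel_measurable N" by (simp only: measurable_cong_sets[OF refl sB])
qed

text \<open>The families of weights, data and perturbations are independent of each other, and so
  are the entries of each; the three entries of client \<open>j\<close> thus have the product law
  under which \<open>samp\<close> was studied.\<close>

lemma noise_component:
  assumes j: "j < n"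
  shows "(\<lambda>q. (fst q j, fst (snd q) j, snd (snd q) j)) \<in> measurable noise (unif01 \<Otimes>\<^sub>M Dist j \<Otimes>\<^sub>M (unif_ball :: 'a measure))"
    and "distr noise (unif01 \<Otimes>\<^sub>M Dist j \<Otimes>\<^sub>M (unif_ball :: 'a measure)) (\<lambda>q. (fst q j, fst (snd q) j, snd (snd q) j))
      = unif01 \<Otimes>\<^sub>M Dist j \<Otimes>\<^sub>M unif_ball"
proof -
  have c1: "(\<lambda>\<omega>. \<omega> j) \<in> measurable (PiM {..<n} (\<lambda>_. unif01)) unif01"
    and c2: "(\<lambda>\<omega>. \<omega> j) \<in> measurable (PiM {..<n} Dist) (Dist j)"
    and c3: "(\<lambda>\<omega>. \<omega> j) \<in> measurable (PiM {..<n} (\<lambda>_. unif_ball :: 'a measure)) unif_ball"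
    using j by (auto intro: measurable_component_singleton)
  have d1: "distr (PiM {..<n} (\<lambda>_. unif01)) unif01 (\<lambda>\<omega>. \<omega> j) = unif01"
    using distr_PiM_component[of "{..<n}" "\<lambda>_. unif01" j] prob_space_unif01 j by simp
  have d2: "distr (PiM {..<n} Dist) (Dist j) (\<lambda>\<omega>. \<omega> j) = Dist j"
    using distr_PiM_component[of "{..<n}" Dist j] prob_Dist j by simp
  have d3: "distr (PiM {..<n} (\<lambda>_. unif_ball :: 'a measure)) unif_ball (\<lambda>\<omega>. \<omega> j) = unif_ball"
    using distr_PiM_component[of "{..<n}" "\<lambda>_. unif_ball" j] prob_space_unif_ball j by simp
  have pB: "prob_space (unif_ball :: 'a measure)" by (rule prob_space_unif_ball)
  have pJB: "prob_space (Dist j \<Otimes>\<^sub>M (unif_ball :: 'a measure))"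
    by (intro prob_space_pair prob_Dist[OF j] prob_space_unif_ball)
  have e2: "Dist j \<Otimes>\<^sub>M unif_ball = distr (PiM {..<n} Dist \<Otimes>\<^sub>M PiM {..<n} (\<lambda>_. unif_ball :: 'a measure)) (Dist j \<Otimes>\<^sub>M unif_ball) (\<lambda>(x, y). (x j, y j))"
    using pair_measure_distr[OF c2 c3] d2 d3 prob_space_imp_sigma_finite[OF pB] by simp
  have m2: "(\<lambda>(x, y). (x j, y j)) \<in> measurable (PiM {..<n} Dist \<Otimes>\<^sub>M PiM {..<n} (\<lambda>_. unif_ball :: 'a measure)) (Dist j \<Otimes>\<^sub>M unif_ball)"
    using measurable_Pair[OF measurable_compose[OF measurable_fst c2] measurable_compose[OF measurable_snd c3]]
    by (simp add: case_prod_unfold)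
  have "distr (PiM {..<n} (\<lambda>_. unif01)) unif01 (\<lambda>\<omega>. \<omega> j)
      \<Otimes>\<^sub>M distr (PiM {..<n} Dist \<Otimes>\<^sub>M PiM {..<n} (\<lambda>_. unif_ball :: 'a measure)) (Dist j \<Otimes>\<^sub>M unif_ball) (\<lambda>(x, y). (x j, y j))
    = distr noise (unif01 \<Otimes>\<^sub>M (Dist j \<Otimes>\<^sub>M unif_ball)) (\<lambda>(x, y). (x j, (\<lambda>(x, y). (x j, y j)) y))"
    by (rule pair_measure_distr[OF c1 m2]) (simp add: prob_space_imp_sigma_finite[OF pJB] flip: e2)
  then show "distr noise (unif01 \<Otimes>\<^sub>M Dist j \<Otimes>\<^sub>M (unif_ball :: 'a measure)) (\<lambda>q. (fst q j, fst (snd q) j, snd (snd q) j))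
      = unif01 \<Otimes>\<^sub>M Dist j \<Otimes>\<^sub>M unif_ball"
    unfolding d1 e2[symmetric] by (simp add: case_prod_unfold)
  show "(\<lambda>q. (fst q j, fst (snd q) j, snd (snd q) j)) \<in> measurable noise (unif01 \<Otimes>\<^sub>M Dist j \<Otimes>\<^sub>M (unif_ball :: 'a measure))"
    using measurable_Pair[OF measurable_compose[OF measurable_fst c1] measurable_compose[OF measurable_snd m2]]
    by (simp add: case_prod_unfold)
qed

context
  fixes c :: real
  assumes c: "0 < c"
begin

definition avg_line_grad :: "'a state \<Rightarrow> 'a" where
  "avg_line_grad S = (1 / real n) *\<^sub>R (\<Sum>i<n. line_grad c i (pos S i) (dir S i))"

lemma norm_avg_line_grad_le: "norm (avg_line_grad S) \<le> L"
proof -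
  have "norm (\<Sum>i<n. line_grad c i (pos S i) (dir S i)) \<le> (\<Sum>i<n. L)"
    by (intro order.trans[OF norm_sum] sum_mono line_grad_integrable(2)[OF c]) auto
  then show ?thesis using n by (simp add: avg_line_grad_def divide_simps mult.commute)
qed

lemma grad_sample_eq_samp: "j < n \<Longrightarrow> grad_sample F c S (j, q) = samp c j (pos S j) (dir S j) (fst q j, fst (snd q) j, snd (snd q) j)"
  by (simp add: grad_sample_def samp_def[OF c] first_order_estimator_def case_prod_unfold)

text \<open>The queried client is itself random. Its index takes finitely many values, so
  measurability can be checked client by client.\<close>

lemma grad_sample_measurable:
  assumes S: "\<And>i. i < n \<Longrightarrow> (\<lambda>p. pos (S p) i) \<in> borel_measurable N"
      "\<And>i. i < n \<Longrightarrow> (\<lambda>p. dir (S p) i) \<in> borel_measurable N"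
    and \<rho>: "\<rho> \<in> measurable N (draw_space n Dist :: ('x, 'a) draw measure)"
  shows "(\<lambda>p. grad_sample F c (S p) (\<rho> p)) \<in> borel_measurable N"
proof -
  note m = draw_measurable[OF \<rho>]
  define h where "h = (\<lambda>i p. nabla (\<lambda>u. F i u (fst (snd (snd (\<rho> p))) i))
      (pos (S p) i + fst (snd (\<rho> p)) i *\<^sub>R dir (S p) i + c *\<^sub>R snd (snd (snd (\<rho> p))) i))"
  have h: "(\<lambda>p. h i p) \<in> borel_measurable N" if i: "i \<in> {..<n}" for i
  proof -
    have i': "i < n" using i by simp
    note [measurable] = S[OF i'] m(2)[OF i'] m(4)[OF i']
    show ?thesis unfolding h_def by (intro sample_measurable[OF c i'] m(3)[OF i']) measurable
  qed
  have "(\<lambda>p. h (fst (\<rho> p)) p) \<in> borel_measurable N"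
    by (rule measurable_compose_countable'[where f=h and g="\<lambda>p. fst (\<rho> p)" and I="{..<n}", OF h m(1)])
      auto
  then show ?thesis
    by (simp add: grad_sample_def first_order_estimator_def case_prod_unfold h_def)
qed

lemma grad_sample_measurable_draw: "grad_sample F c S \<in> borel_measurable (draw_space n Dist)"
  using grad_sample_measurable[of "\<lambda>_. S" "draw_space n Dist" "\<lambda>\<rho>. \<rho>"] by simp

lemma grad_sample_sq_nn: "(\<integral>\<^sup>+\<rho>. ennreal ((norm (grad_sample F c S \<rho>))\<^sup>2) \<partial>draw_space n Dist) \<le> ennreal (L\<^sup>2)"
proof -
  interpret Q: prob_space noise by (rule prob_space_noise)
  note [measurable] = grad_sample_measurable_draw[unfolded draw_space_eq]
  have "(\<integral>\<^sup>+\<rho>. ennreal ((norm (grad_sample F c S \<rho>))\<^sup>2) \<partial>draw_space n Dist)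
      = (\<integral>\<^sup>+j. \<integral>\<^sup>+q. ennreal ((norm (grad_sample F c S (j, q)))\<^sup>2) \<partial>noise \<partial>uniform_count_measure {..<n})"
    unfolding draw_space_eq by (rule Q.nn_integral_fst[symmetric]) measurable
  also have "\<dots> \<le> (\<integral>\<^sup>+j. ennreal (L\<^sup>2) \<partial>uniform_count_measure {..<n})"
  proof (rule nn_integral_mono)
    fix j assume "j \<in> space (uniform_count_measure {..<n})"
    then have j: "j < n" by (simp add: space_uniform_count_measure)
    have "(\<integral>\<^sup>+q. ennreal ((norm (grad_sample F c S (j, q)))\<^sup>2) \<partial>noise)
        = (\<integral>\<^sup>+p. ennreal ((norm (samp c j (pos S j) (dir S j) p))\<^sup>2)
            \<partial>distr noise (unif01 \<Otimes>\<^sub>M Dist j \<Otimes>\<^sub>M (unif_ball :: 'a measure)) (\<lambda>q. (fst q j, fst (snd q) j, snd (snd q) j)))"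
      using samp_measurable[OF c j, of "pos S j" "dir S j"]
      by (subst nn_integral_distr[OF noise_component(1)[OF j]]) (simp_all add: grad_sample_eq_samp[OF j])
    also have "\<dots> \<le> ennreal (L\<^sup>2)"
      unfolding noise_component(2)[OF j] by (rule samp_sq_nn[OF c j])
    finally show "(\<integral>\<^sup>+q. ennreal ((norm (grad_sample F c S (j, q)))\<^sup>2) \<partial>noise) \<le> ennreal (L\<^sup>2)" .
  qed
  also have "\<dots> = ennreal (L\<^sup>2)" using prob_space.emeasure_space_1[OF prob_space_clients] by simp
  finally show ?thesis .
qed

lemma grad_sample_integrable: "integrable (draw_space n Dist) (grad_sample F c S)"
  by (rule L2_bound(3)[OF prob_space_draw grad_sample_measurable_draw grad_sample_sq_nn]) simp

text \<open>The client is uniform and independent of the rest, which turns the expectation into the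
  mean of the expected samples \<open>line_grad\<close>.\<close>

lemma grad_sample_mean: "(\<integral>\<rho>. grad_sample F c S \<rho> \<partial>draw_space n Dist) = avg_line_grad S"
proof -
  interpret Q: prob_space noise by (rule prob_space_noise)
  interpret C: prob_space "uniform_count_measure {..<n}" by (rule prob_space_clients)
  interpret pair_sigma_finite "uniform_count_measure {..<n}" noise ..
  have "(\<integral>\<rho>. grad_sample F c S \<rho> \<partial>draw_space n Dist)
      = (\<integral>j. \<integral>q. grad_sample F c S (j, q) \<partial>noise \<partial>uniform_count_measure {..<n})"
    unfolding draw_space_eq by (rule integral_fst'[symmetric]) (rule grad_sample_integrable[unfolded draw_space_eq])
  also have "\<dots> = (\<Sum>j<n. (1 / real n) *\<^sub>R (\<integral>q. grad_sample F c S (j, q) \<partial>noise))"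
    unfolding uniform_count_measure_def by (subst lebesgue_integral_point_measure_finite) auto
  also have "\<dots> = (\<Sum>j<n. (1 / real n) *\<^sub>R line_grad c j (pos S j) (dir S j))"
  proof (intro sum.cong refl arg_cong2[of _ _ _ _ scaleR])
    fix j assume "j \<in> {..<n}"
    then have j: "j < n" by simp
    have "(\<integral>q. grad_sample F c S (j, q) \<partial>noise)
        = (\<integral>p. samp c j (pos S j) (dir S j) p
            \<partial>distr noise (unif01 \<Otimes>\<^sub>M Dist j \<Otimes>\<^sub>M (unif_ball :: 'a measure)) (\<lambda>q. (fst q j, fst (snd q) j, snd (snd q) j)))"
      using samp_measurable[OF c j, of "pos S j" "dir S j"]
      by (subst integral_distr[OF noise_component(1)[OF j]]) (simp_all add: grad_sample_eq_samp[OF j])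
    then show "(\<integral>q. grad_sample F c S (j, q) \<partial>noise) = line_grad c j (pos S j) (dir S j)"
      unfolding noise_component(2)[OF j] samp_mean[OF c j] .
  qed
  finally show ?thesis by (simp add: avg_line_grad_def scaleR_sum_right)
qed

lemma avg_line_grad_measurable:
  assumes S: "\<And>i. i < n \<Longrightarrow> (\<lambda>p. pos (S p) i) \<in> borel_measurable N"
      "\<And>i. i < n \<Longrightarrow> (\<lambda>p. dir (S p) i) \<in> borel_measurable N"
  shows "(\<lambda>p. avg_line_grad (S p)) \<in> borel_measurable N"
  unfolding avg_line_grad_def
  by (intro borel_measurable_scaleR borel_measurable_sum borel_measurable_const line_grad_measurable[OF c] S) auto

end

end

section \<open>Measurability and adaptedness of the trajectory\<close>

lemma fast_gossip_measurable:
  fixes x :: "'p \<Rightarrow> nat \<Rightarrow> 'a::euclidean_space"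
  assumes x: "\<And>i. i < n \<Longrightarrow> (\<lambda>p. x p i) \<in> borel_measurable N" and i: "i < n"
  shows "(\<lambda>p. fst (fast_gossip n P R (x p)) i) \<in> borel_measurable N"
proof -
  have "\<forall>i<n. (\<lambda>p. fst (fast_gossip_iter n P (x p) r) i) \<in> borel_measurable N \<and>
      (\<lambda>p. fst (snd (fast_gossip_iter n P (x p) r)) i) \<in> borel_measurable N" for r
  proof (induction r)
    case (Suc r)
    then show ?case
      by (auto simp: Let_def case_prod_unfold
          intro!: borel_measurable_diff borel_measurable_scaleR borel_measurable_sum borel_measurable_const)
  qed (use x in auto)
  then show ?thesis using i by (simp add: fast_gossip_def)
qed

lemma (in stochastic_problem) doc2s_step_measurable:
  assumes c: "0 < c"
    and S: "\<And>i. i < n \<Longrightarrow> (\<lambda>p. pos (S p) i) \<in> borel_measurable N"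
      "\<And>i. i < n \<Longrightarrow> (\<lambda>p. dir (S p) i) \<in> borel_measurable N"
    and \<rho>: "\<rho> \<in> measurable N (draw_space n Dist :: ('x, 'a) draw measure)" and i: "i < n"
  shows "(\<lambda>p. pos (doc2s_step n P F c R \<eta> D (\<rho> p) (S p)) i) \<in> borel_measurable N"
    and "(\<lambda>p. dir (doc2s_step n P F c R \<eta> D (\<rho> p) (S p)) i) \<in> borel_measurable N"
    and "(\<lambda>p. wpt (doc2s_step n P F c R \<eta> D (\<rho> p) (S p)) i) \<in> borel_measurable N"
proof -
  note m = draw_measurable[OF \<rho>]
  have eq[measurable]: "Measurable.pred N (\<lambda>p. j = fst (\<rho> p))" for j
    using measurable_compose[OF m(1), of "\<lambda>k. j = k" "count_space UNIV"] by simp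
  have [measurable]: "(\<lambda>p. grad_sample F c (S p) (\<rho> p)) \<in> borel_measurable N"
    by (rule grad_sample_measurable[OF c S \<rho>])
  have [measurable]: "clip D \<in> borel_measurable (borel :: 'a measure)"
    unfolding clip_def[abs_def] by measurable
  show "(\<lambda>p. pos (doc2s_step n P F c R \<eta> D (\<rho> p) (S p)) i) \<in> borel_measurable N"
    unfolding doc2s_step_fields
  proof (intro fast_gossip_measurable i)
    fix j assume "j < n"
    note [measurable] = S[OF this]
    show "(\<lambda>p. if j = fst (\<rho> p) then pos (S p) j + real n *\<^sub>R dir (S p) j else pos (S p) j) \<in> borel_measurable N"
      by measurable
  qed
  show "(\<lambda>p. dir (doc2s_step n P F c R \<eta> D (\<rho> p) (S p)) i) \<in> borel_measurable N"
    unfolding doc2s_step_fields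
  proof (intro fast_gossip_measurable i)
    fix j assume "j < n"
    note [measurable] = S[OF this]
    show "(\<lambda>p. if j = fst (\<rho> p) then real n *\<^sub>R clip D (dir (S p) j - \<eta> *\<^sub>R grad_sample F c (S p) (\<rho> p)) else 0) \<in> borel_measurable N"
      by measurable
  qed
  note [measurable] = S[OF i] m(2)[OF i]
  show "(\<lambda>p. wpt (doc2s_step n P F c R \<eta> D (\<rho> p) (S p)) i) \<in> borel_measurable N"
    unfolding doc2s_step_fields by measurable
qed

text \<open>A state is built from the draws of its past alone. Combined with the redrawing of a
  coordinate, this makes the noise of an iteration centred given its past.\<close>

lemma doc2s_state_upd:
  assumes "k < k1 \<or> k = k1 \<and> t < t1"
  shows "doc2s_state n P F c T R \<eta> D (fun_upd \<rho> (k1, t1) x) k t = doc2s_state n P F c T R \<eta> D \<rho> k t"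
  using assms
proof (induction k arbitrary: t)
  case 0
  show ?case by simp
next
  case (Suc k)
  have IH: "doc2s_state n P F c T R \<eta> D (fun_upd \<rho> (k1, t1) x) k T = doc2s_state n P F c T R \<eta> D \<rho> k T"
    by (rule Suc.IH) (use Suc.prems in auto)
  show ?case using Suc.prems
  proof (induction t)
    case 0
    show ?case by (simp only: doc2s_state.simps IH)
  next
    case (Suc t)
    then have "(Suc k, Suc t) \<noteq> (k1, t1)" "Suc k < k1 \<or> Suc k = k1 \<and> t < t1" by auto
    then show ?case by (simp only: doc2s_state.simps Suc.IH fun_upd_other not_False_eq_True)
  qed
qed

text \<open>\<open>c\<close> is half the Goldstein radius and also the smoothing radius. The
  hypothesis \<open>location\<close> is what the triangle inequality in
  \<open>goldstein_epoch\<close> demands: two walks of the mean, two single steps and one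
  disagreement of positions must fit into \<open>c\<close>.\<close>

locale doc2s_run = stochastic_problem n Dist F Lip L \<sigma> G
  for n :: nat and Dist :: "nat \<Rightarrow> 'x measure" and F :: "nat \<Rightarrow> 'a::euclidean_space \<Rightarrow> 'x \<Rightarrow> real"
    and Lip :: "nat \<Rightarrow> 'x \<Rightarrow> real" and L \<sigma> G :: real +
  fixes adj :: "nat \<Rightarrow> nat \<Rightarrow> bool" and P :: "real mat" and c D \<eta> \<kappa> e :: real and K T R :: nat
  assumes P: "gossip_matrix n adj P" and c: "0 < c" and D: "0 < D" and \<eta>: "0 < \<eta>"
    and \<kappa>: "5 * exp (- sqrt (spectral_gap P) * real R / 4) \<le> \<kappa>" "\<kappa> \<le> 1/2"
    and e: "e = \<kappa> * (real n * D)" and K: "1 \<le> K" and T: "1 \<le> T"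
    and location: "(2 * real T + 2) * (D + e) + 2 * \<kappa> * (real n * (D + e)) \<le> c"
begin

abbreviation St :: "nat \<Rightarrow> nat \<Rightarrow> (nat \<times> nat \<Rightarrow> ('x, 'a) draw) \<Rightarrow> 'a state" where
  "St k t \<omega> \<equiv> doc2s_state n P F c T R \<eta> D \<omega> k t"

abbreviation Om :: "(nat \<times> nat \<Rightarrow> ('x, 'a) draw) measure" where
  "Om \<equiv> PiM ({1..K} \<times> {1..T}) (\<lambda>_. draw_space n Dist)"

text \<open>Epochs are counted from 0 here: index \<open>k\<close> refers to epoch \<open>k + 1\<close> of the algorithm, and \<open>t\<close> to the
  state before its iteration \<open>t + 1\<close>. The conditional expectation of the sample \<open>gr\<close> is \<open>ag\<close>, and \<open>mg\<close> is what
  \<open>ag\<close> would be at exact consensus.\<close>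
definition "ybar k t \<omega> = mean n (pos (St (Suc k) t \<omega>))"
definition "dbar k t \<omega> = mean n (dir (St (Suc k) t \<omega>))"
definition "gr k t \<omega> = grad_sample F c (St (Suc k) t \<omega>) (\<omega> (Suc k, Suc t))"
definition "ag k t \<omega> = avg_line_grad c (St (Suc k) t \<omega>)"
definition "mg k t \<omega> = (\<integral>s. f.sgrad c (ybar k t \<omega> + s *\<^sub>R dbar k t \<omega>) \<partial>unif01)"
definition "zt k t \<omega> = gr k t \<omega> - ag k t \<omega>"
definition "wout k i \<omega> = (1 / real T) *\<^sub>R (\<Sum>t=1..T. wpt (St k t \<omega>) i)"

section \<open>Consensus and progress along a trajectory\<close>

lemma prob_Om: "prob_space Om"
  by (intro prob_space_PiM prob_space_draw)

lemma e_nonneg: "0 \<le> e" and kappa0: "0 \<le> \<kappa>"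
  using drift_nonneg[OF P n less_imp_le[OF D] \<kappa> e] kappa_nonneg[OF P n less_imp_le[OF D] \<kappa> e] by auto

lemma space_Om_fst:
  assumes \<omega>: "\<omega> \<in> space Om" and "k \<in> {1..K}" "t \<in> {1..T}"
  shows "fst (\<omega> (k, t)) < n"
proof -
  have "\<omega> (k, t) \<in> space (draw_space n Dist)" using assms by (auto simp: space_PiM PiE_iff)
  then show ?thesis by (auto simp: draw_space_def space_pair_measure space_uniform_count_measure)
qed

text \<open>Holds at every sample point and not just almost surely, because the gradient enters only
  through \<open>clip\<close>, whose norm is bounded whatever its argument.\<close>

lemma consensus_St:
  assumes \<omega>: "\<omega> \<in> space Om" and "k \<le> K" "t \<le> T"
  shows "consensus n D e \<kappa> (St k t \<omega>)"
  using assms(2,3)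
proof (induction k arbitrary: t)
  case 0
  show ?case using D e_nonneg kappa0
    by (simp add: consensus_def[OF P n less_imp_le[OF D] \<kappa> e] mean_def stack_norm_def L2_set_def)
next
  case (Suc k)
  then have IH: "consensus n D e \<kappa> (St k T \<omega>)" by simp
  show ?case using Suc.prems(2)
  proof (induction t)
    case 0
    show ?case using consensus_reset[OF P n less_imp_le[OF D] \<kappa> e IH] by simp
  next
    case (Suc t)
    have "fst (\<omega> (Suc k, Suc t)) < n" using Suc.prems \<open>Suc k \<le> K\<close> by (intro space_Om_fst[OF \<omega>]) auto
    then show ?case using consensus_step[OF P n less_imp_le[OF D] \<kappa> e] Suc by simp
  qed
qed

lemma mg_eq: "mg k t \<omega> = (1 / real n) *\<^sub>R (\<Sum>i<n. line_grad c i (ybar k t \<omega>) (dbar k t \<omega>))"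
  unfolding mg_def sgrad_global[OF c] line_grad_def[OF c]
  using line_grad_integrable(1)[OF c] by simp

lemma bias_bound:
  assumes \<omega>: "\<omega> \<in> space Om" and "k < K" "t < T"
  shows "norm (ag k t \<omega> - mg k t \<omega>) \<le> L * real DIM('a) * (2 * \<kappa> * (real n * (D + e)) + e) / c"
proof -
  let ?S = "St (Suc k) t \<omega>" and ?b = "L * real DIM('a) * (2 * \<kappa> * (real n * (D + e)) + e) / c"
  have S: "consensus n D e \<kappa> ?S" using assms by (intro consensus_St) auto
  have eq: "ag k t \<omega> - mg k t \<omega> = (1 / real n) *\<^sub>R (\<Sum>i<n. line_grad c i (pos ?S i) (dir ?S i) - line_grad c i (ybar k t \<omega>) (dbar k t \<omega>))"
    unfolding ag_def mg_eq avg_line_grad_def[OF c] by (simp add: sum_subtractf scaleR_diff_right)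
  have "norm (ag k t \<omega> - mg k t \<omega>) = (1 / real n) * norm (\<Sum>i<n. line_grad c i (pos ?S i) (dir ?S i) - line_grad c i (ybar k t \<omega>) (dbar k t \<omega>))"
    unfolding eq by simp
  also have "\<dots> \<le> (1 / real n) * (\<Sum>i<n. ?b)"
  proof (intro mult_left_mono order.trans[OF norm_sum] sum_mono)
    fix i assume "i \<in> {..<n}"
    then have i: "i < n" by simp
    have "norm (line_grad c i (pos ?S i) (dir ?S i) - line_grad c i (ybar k t \<omega>) (dbar k t \<omega>))
        \<le> L * real DIM('a) * (norm (pos ?S i - ybar k t \<omega>) + norm (dir ?S i - dbar k t \<omega>)) / c"
      by (rule line_grad_diff_le[OF c i])
    also have "\<dots> \<le> ?b"
      using consensusD[OF P n less_imp_le[OF D] \<kappa> e S i] L_pos c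
      by (intro divide_right_mono mult_left_mono add_mono) (auto simp: ybar_def dbar_def)
    finally show "norm (line_grad c i (pos ?S i) (dir ?S i) - line_grad c i (ybar k t \<omega>) (dbar k t \<omega>)) \<le> ?b" .
  qed simp
  also have "\<dots> = ?b" using n by simp
  finally show ?thesis .
qed

lemma St_step:
  assumes \<omega>: "\<omega> \<in> space Om" and "k < K" "t < T"
  shows "ybar k (Suc t) \<omega> = ybar k t \<omega> + dir (St (Suc k) t \<omega>) (fst (\<omega> (Suc k, Suc t)))"
    and "dbar k (Suc t) \<omega> = clip D (dir (St (Suc k) t \<omega>) (fst (\<omega> (Suc k, Suc t))) - \<eta> *\<^sub>R gr k t \<omega>)"
    and "norm (dbar k t \<omega>) \<le> D"
    and "norm (dir (St (Suc k) t \<omega>) (fst (\<omega> (Suc k, Suc t))) - dbar k t \<omega>) \<le> e"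
    and "norm (dir (St (Suc k) t \<omega>) (fst (\<omega> (Suc k, Suc t)))) \<le> D + e"
proof -
  have it: "fst (\<omega> (Suc k, Suc t)) < n" using assms by (intro space_Om_fst) auto
  have S: "consensus n D e \<kappa> (St (Suc k) t \<omega>)" using assms by (intro consensus_St) auto
  note m = doc2s_step_means[OF P n less_imp_le[OF D] \<kappa> e it]
  note d = consensusD[OF P n less_imp_le[OF D] \<kappa> e S it]
  show "ybar k (Suc t) \<omega> = ybar k t \<omega> + dir (St (Suc k) t \<omega>) (fst (\<omega> (Suc k, Suc t)))"
    by (simp add: ybar_def m)
  show "dbar k (Suc t) \<omega> = clip D (dir (St (Suc k) t \<omega>) (fst (\<omega> (Suc k, Suc t))) - \<eta> *\<^sub>R gr k t \<omega>)"
    by (simp add: dbar_def m gr_def)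
  show "norm (dbar k t \<omega>) \<le> D" using d(1) by (simp add: dbar_def)
  show "norm (dir (St (Suc k) t \<omega>) (fst (\<omega> (Suc k, Suc t))) - dbar k t \<omega>) \<le> e" using d(2) by (simp add: dbar_def)
  show "norm (dir (St (Suc k) t \<omega>) (fst (\<omega> (Suc k, Suc t)))) \<le> D + e" by (rule d(3))
qed

lemma epoch_bound:
  assumes \<omega>: "\<omega> \<in> space Om" and k: "k < K"
  shows "D * norm (\<Sum>t<T. mg k t \<omega>) \<le> f.smooth c (ybar k 0 \<omega>) - f.smooth c (ybar k T \<omega>)
    + real T * (L * e) + 2 * D * (real T * (L * real DIM('a) * (2 * \<kappa> * (real n * (D + e)) + e) / c))
    - (\<Sum>t<T. inner (zt k t \<omega>) (dbar k t \<omega>)) + D * norm (\<Sum>t<T. zt k t \<omega>)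
    + D\<^sup>2 / (2 * \<eta>) + real T * (2 * D * e + e\<^sup>2) / \<eta> + \<eta> * (\<Sum>t<T. (norm (gr k t \<omega>))\<^sup>2)"
  unfolding zt_def
proof (rule epoch_inequality[where \<Delta>="\<lambda>t. dir (St (Suc k) t \<omega>) (fst (\<omega> (Suc k, Suc t)))"])
  show "dbar k 0 \<omega> = 0" by (simp add: dbar_def mean_def)
  show "f.smooth c (ybar k t \<omega> + dbar k t \<omega>) - f.smooth c (ybar k t \<omega>) = inner (mg k t \<omega>) (dbar k t \<omega>)" for t
    unfolding mg_def by (rule f.smooth_increment[OF c])
qed (use St_step[OF \<omega> k] bias_bound[OF \<omega> k] D \<eta> e_nonneg L_pos f.smooth_lipschitz[OF c] in \<open>auto simp: less_imp_le\<close>)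

lemma ybar_diff:
  assumes \<omega>: "\<omega> \<in> space Om" and k: "k < K"
  shows "t \<le> T \<Longrightarrow> norm (ybar k t \<omega> - ybar k 0 \<omega>) \<le> real t * (D + e)"
proof (induction t)
  case (Suc t)
  then have t: "t < T" by simp
  have "norm (ybar k (Suc t) \<omega> - ybar k 0 \<omega>)
      = norm ((ybar k t \<omega> - ybar k 0 \<omega>) + dir (St (Suc k) t \<omega>) (fst (\<omega> (Suc k, Suc t))))"
    unfolding St_step(1)[OF \<omega> k t] by (simp add: algebra_simps)
  also have "\<dots> \<le> real t * (D + e) + (D + e)"
    using Suc St_step(5)[OF \<omega> k t] by (intro norm_triangle_mono) auto
  finally show ?case by (simp add: algebra_simps)
qed simp

text \<open>\<open>unif01\<close> is a measure on the whole real line, so that the weights lie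
  between 0 and 1 is an almost sure event and not a property of the sample space.\<close>

definition good :: "(nat \<times> nat \<Rightarrow> ('x, 'a) draw) \<Rightarrow> bool" where
  "good \<omega> \<longleftrightarrow> (\<forall>kt\<in>{1..K} \<times> {1..T}. \<forall>i\<in>{..<n}. 0 \<le> fst (snd (\<omega> kt)) i \<and> fst (snd (\<omega> kt)) i \<le> 1)"

lemma goldstein_epoch:
  assumes \<omega>: "\<omega> \<in> space Om" "good \<omega>" and k: "k < K" and i: "i < n"
  shows "goldstein_norm f (2 * c) (wout (Suc k) i \<omega>) \<le> (1 / real T) * norm (\<Sum>t<T. mg k t \<omega>)"
proof -
  let ?w = "wout (Suc k) i \<omega>"
  have close: "norm (ybar k t \<omega> + s *\<^sub>R dbar k t \<omega> - wpt (St (Suc k) (Suc t') \<omega>) i) \<le> c"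
    if t: "t < T" "t' < T" and s: "0 \<le> s" "s \<le> 1" for t t' s
  proof -
    let ?S = "St (Suc k) t' \<omega>" and ?s = "fst (snd (\<omega> (Suc k, Suc t'))) i"
    have s': "0 \<le> ?s" "?s \<le> 1" using \<omega>(2) k t i by (auto simp: good_def)
    have S: "consensus n D e \<kappa> ?S" using k t \<omega> by (intro consensus_St) auto
    note d = consensusD[OF P n less_imp_le[OF D] \<kappa> e S i]
    have w: "wpt (St (Suc k) (Suc t') \<omega>) i = pos ?S i + ?s *\<^sub>R dir ?S i" by (simp add: doc2s_step_fields)
    \<comment> \<open>The path from one segment to the query point of another iteration runs through
      the mean position at the start of the epoch.\<close>
    have eq: "ybar k t \<omega> + s *\<^sub>R dbar k t \<omega> - wpt (St (Suc k) (Suc t') \<omega>) i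
        = (ybar k t \<omega> - ybar k 0 \<omega>) - (ybar k t' \<omega> - ybar k 0 \<omega>) + s *\<^sub>R dbar k t \<omega>
          - (pos ?S i - ybar k t' \<omega>) - ?s *\<^sub>R dir ?S i"
      unfolding w by simp
    have tri: "norm (a - b + u - v - w) \<le> norm a + norm b + norm u + norm v + norm w" for a b u v w :: 'a
      using norm_triangle_ineq4[of "a - b + u - v" w] norm_triangle_ineq4[of "a - b + u" v]
        norm_triangle_ineq[of "a - b" u] norm_triangle_ineq4[of a b] by linarith
    have "norm (ybar k t \<omega> + s *\<^sub>R dbar k t \<omega> - wpt (St (Suc k) (Suc t') \<omega>) i)
        \<le> norm (ybar k t \<omega> - ybar k 0 \<omega>) + norm (ybar k t' \<omega> - ybar k 0 \<omega>) + norm (s *\<^sub>R dbar k t \<omega>)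
        + norm (pos ?S i - ybar k t' \<omega>) + norm (?s *\<^sub>R dir ?S i)"
      unfolding eq by (rule tri)
    also have "\<dots> \<le> real T * (D + e) + real T * (D + e) + D + 2 * \<kappa> * (real n * (D + e)) + (D + e)"
    proof (intro add_mono)
      have De: "0 \<le> D + e" using D e_nonneg by simp
      show "norm (ybar k t \<omega> - ybar k 0 \<omega>) \<le> real T * (D + e)" "norm (ybar k t' \<omega> - ybar k 0 \<omega>) \<le> real T * (D + e)"
        using t by (intro order.trans[OF ybar_diff[OF \<omega>(1) k]] mult_right_mono De; simp)+
      show "norm (s *\<^sub>R dbar k t \<omega>) \<le> D"
        using s St_step(3)[OF \<omega>(1) k t(1)] mult_mono[of s 1 "norm (dbar k t \<omega>)" D] by simp
      show "norm (pos ?S i - ybar k t' \<omega>) \<le> 2 * \<kappa> * (real n * (D + e))" using d(4) by (simp add: ybar_def)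
      show "norm (?s *\<^sub>R dir ?S i) \<le> D + e"
        using s' d(3) mult_mono[of ?s 1 "norm (dir ?S i)" "D + e"] by simp
    qed
    also have "\<dots> \<le> c" using location e_nonneg by (simp add: algebra_simps)
    finally show ?thesis .
  qed
  have w: "?w = (1 / real T) *\<^sub>R (\<Sum>t'<T. wpt (St (Suc k) (Suc t') \<omega>) i)"
    unfolding wout_def One_nat_def sum.atLeast1_atMost_eq ..
  \<comment> \<open>The output is an average of query points, and a bound on the distance to each of
    them passes to the average.\<close>
  have near: "norm (p - ?w) \<le> c" if "\<And>t'. t' < T \<Longrightarrow> norm (p - wpt (St (Suc k) (Suc t') \<omega>) i) \<le> c" for p
  proof -
    have pp: "(1 / real T) *\<^sub>R (\<Sum>t'<T. p) = p" using T by (simp add: sum_constant_scaleR)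
    have eq: "p - ?w = (1 / real T) *\<^sub>R (\<Sum>t'<T. p - wpt (St (Suc k) (Suc t') \<omega>) i)"
      unfolding w sum_subtractf scaleR_diff_right pp ..
    have "norm (p - ?w) = (1 / real T) * norm (\<Sum>t'<T. p - wpt (St (Suc k) (Suc t') \<omega>) i)" unfolding eq by simp
    also have "\<dots> \<le> (1 / real T) * (\<Sum>t'<T. c)"
      using that by (intro mult_left_mono order.trans[OF norm_sum] sum_mono) auto
    also have "\<dots> = c" using T by simp
    finally show ?thesis .
  qed
  \<comment> \<open>Iterations run from 1 to \<open>T\<close> in the averaging lemma, whereas
    \<open>ybar\<close> and \<open>dbar\<close> are indexed by the state before the
    iteration.\<close>
  have "goldstein_norm f (2 * c) ?w
      \<le> norm ((1 / real T) *\<^sub>R (\<Sum>t=1..T. \<integral>s. f.sgrad c (ybar k (t - 1) \<omega> + s *\<^sub>R dbar k (t - 1) \<omega>) \<partial>unif01))"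
  proof (rule f.goldstein_norm_le_average[OF c T])
    fix t s assume t: "t \<in> {1..T}" and s: "0 \<le> (s::real)" "s \<le> 1"
    have "norm (ybar k (t - 1) \<omega> + s *\<^sub>R dbar k (t - 1) \<omega> - ?w) \<le> c"
      using t s T by (intro near close) auto
    then show "norm (ybar k (t - 1) \<omega> + s *\<^sub>R dbar k (t - 1) \<omega> - ?w) \<le> 2 * c - c" by simp
  qed
  also have "\<dots> = norm ((1 / real T) *\<^sub>R (\<Sum>t<T. mg k t \<omega>))"
    unfolding mg_def by (simp add: sum.atLeast1_atMost_eq)
  finally show ?thesis by simp
qed

text \<open>Only finitely many weights occur, and the almost sure bound on a single one is carried
  outwards through the nested products.\<close>

lemma AE_good: "AE \<omega> in Om. good \<omega>"
proof -
  have ae: "AE \<omega> in Om. 0 \<le> fst (snd (\<omega> kt)) i \<and> fst (snd (\<omega> kt)) i \<le> 1"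
    if kt: "kt \<in> {1..K} \<times> {1..T}" and i: "i \<in> {..<n}" for kt i
  proof -
    have i': "i < n" using i by simp
    interpret N: prob_space noise by (rule prob_space_noise)
    interpret C: prob_space "uniform_count_measure {..<n}" by (rule prob_space_clients)
    interpret PU: pair_prob_space "uniform_count_measure {..<n}" noise ..
    have "AE s in distr (PiM {..<n} (\<lambda>_. unif01)) unif01 (\<lambda>\<omega>. \<omega> i). 0 \<le> s \<and> s \<le> 1"
      using AE_unif01 by (subst distr_PiM_component[OF prob_space_unif01 i])
    then have "AE s in PiM {..<n} (\<lambda>_. unif01). 0 \<le> s i \<and> s i \<le> 1"
      by (rule AE_distrD[OF measurable_component_singleton[OF i], rotated])
    then have "AE q in noise. 0 \<le> fst q i \<and> fst q i \<le> 1"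
    proof -
      have p: "prob_space (PiM {..<n} Dist \<Otimes>\<^sub>M PiM {..<n} (\<lambda>_. unif_ball :: 'a measure))"
        by (intro prob_space_pair prob_space_PiM prob_space_unif_ball prob_Dist) auto
      assume "AE s in PiM {..<n} (\<lambda>_. unif01). 0 \<le> s i \<and> s i \<le> 1"
      then have "AE s in distr noise (PiM {..<n} (\<lambda>_. unif01)) fst. 0 \<le> s i \<and> s i \<le> 1"
        by (subst prob_space.distr_pair_fst[OF p])
      then show ?thesis by (rule AE_distrD[OF measurable_fst, rotated])
    qed
    then have "AE \<rho> in (draw_space n Dist :: ('x, 'a) draw measure). 0 \<le> fst (snd \<rho>) i \<and> fst (snd \<rho>) i \<le> 1"
    proof -
      assume q: "AE q in noise. 0 \<le> fst q i \<and> fst q i \<le> 1"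
      have "(\<lambda>\<rho>. \<rho>) \<in> measurable (draw_space n Dist) (draw_space n Dist :: ('x, 'a) draw measure)" by simp
      from draw_measurable(2)[OF this i']
      have [measurable]: "(\<lambda>\<rho>. fst (snd \<rho>) i) \<in> borel_measurable (uniform_count_measure {..<n} \<Otimes>\<^sub>M noise)"
        by (simp only: draw_space_eq)
      show ?thesis unfolding draw_space_eq
      proof (rule PU.AE_pair_measure)
        show "{\<rho> \<in> space (uniform_count_measure {..<n} \<Otimes>\<^sub>M noise). 0 \<le> fst (snd \<rho>) i \<and> fst (snd \<rho>) i \<le> 1}
            \<in> sets (uniform_count_measure {..<n} \<Otimes>\<^sub>M noise)" by measurable
      qed (use q in simp)
    qed
    then have "AE \<rho> in distr Om (draw_space n Dist :: ('x, 'a) draw measure) (\<lambda>\<omega>. \<omega> kt). 0 \<le> fst (snd \<rho>) i \<and> fst (snd \<rho>) i \<le> 1"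
      by (subst distr_PiM_component[OF prob_space_draw kt])
    then show ?thesis
      by (rule AE_distrD[OF measurable_component_singleton[OF kt], rotated])
  qed
  show ?thesis unfolding good_def
    by (intro AE_finite_allI ae) auto
qed

section \<open>Moments of the gradient noise\<close>

lemma St_measurable:
  assumes k: "k \<le> K"
  shows "t \<le> T \<Longrightarrow> i < n \<Longrightarrow> (\<lambda>\<omega>. pos (St k t \<omega>) i) \<in> borel_measurable Om"
    and "t \<le> T \<Longrightarrow> i < n \<Longrightarrow> (\<lambda>\<omega>. dir (St k t \<omega>) i) \<in> borel_measurable Om"
    and "t \<le> T \<Longrightarrow> i < n \<Longrightarrow> (\<lambda>\<omega>. wpt (St k t \<omega>) i) \<in> borel_measurable Om"
proof -
  have "\<forall>t\<le>T. \<forall>i<n. (\<lambda>\<omega>. pos (St k t \<omega>) i) \<in> borel_measurable Om \<and> (\<lambda>\<omega>. dir (St k t \<omega>) i) \<in> borel_measurable Om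
      \<and> (\<lambda>\<omega>. wpt (St k t \<omega>) i) \<in> borel_measurable Om"
    using k
  proof (induction k)
    case 0
    show ?case by simp
  next
    case (Suc k)
    note IH = Suc.IH[OF Suc_leD[OF Suc.prems]]
    show ?case
    proof (intro allI impI)
      fix t i assume "t \<le> T" "i < n"
      then show "(\<lambda>\<omega>. pos (St (Suc k) t \<omega>) i) \<in> borel_measurable Om \<and> (\<lambda>\<omega>. dir (St (Suc k) t \<omega>) i) \<in> borel_measurable Om
          \<and> (\<lambda>\<omega>. wpt (St (Suc k) t \<omega>) i) \<in> borel_measurable Om"
      proof (induction t arbitrary: i)
        case 0
        then show ?case using IH by simp
      next
        case (Suc t)
        have "(\<lambda>\<omega>. \<omega> (Suc k, Suc t)) \<in> measurable Om (draw_space n Dist)"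
          using Suc.prems(1) \<open>Suc k \<le> K\<close> by (intro measurable_component_singleton) auto
        then show ?case
          using Suc doc2s_step_measurable[OF c _ _ _ \<open>i < n\<close>, of "\<lambda>\<omega>. St (Suc k) t \<omega>" Om "\<lambda>\<omega>. \<omega> (Suc k, Suc t)"]
          by simp
      qed
    qed
  qed
  then show "t \<le> T \<Longrightarrow> i < n \<Longrightarrow> (\<lambda>\<omega>. pos (St k t \<omega>) i) \<in> borel_measurable Om"
    and "t \<le> T \<Longrightarrow> i < n \<Longrightarrow> (\<lambda>\<omega>. dir (St k t \<omega>) i) \<in> borel_measurable Om"
    and "t \<le> T \<Longrightarrow> i < n \<Longrightarrow> (\<lambda>\<omega>. wpt (St k t \<omega>) i) \<in> borel_measurable Om" by blast+
qed

lemma wout_measurable: "k \<in> {1..K} \<Longrightarrow> i < n \<Longrightarrow> wout k i \<in> borel_measurable Om"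
  unfolding wout_def[abs_def]
  by (intro borel_measurable_scaleR borel_measurable_sum borel_measurable_const St_measurable) auto

context
  fixes k :: nat
  assumes k: "k < K"
begin

context
  fixes t :: nat
  assumes t: "t < T"
begin

lemma index: "(Suc k, Suc t) \<in> {1..K} \<times> {1..T}"
  using k t by auto

lemma ag_measurable: "ag k t \<in> borel_measurable Om"
  unfolding ag_def[abs_def] using k t by (intro avg_line_grad_measurable[OF c] St_measurable) auto

lemma gr_measurable: "gr k t \<in> borel_measurable Om"
  unfolding gr_def[abs_def] using k t
  by (intro grad_sample_measurable[OF c] St_measurable measurable_component_singleton[OF index]) auto

lemma zt_measurable: "zt k t \<in> borel_measurable Om"
  unfolding zt_def[abs_def] using ag_measurable gr_measurable by simp

lemma dbar_measurable: "dbar k t \<in> borel_measurable Om"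
  unfolding dbar_def[abs_def] mean_def using k t
  by (intro borel_measurable_scaleR borel_measurable_sum borel_measurable_const St_measurable) auto

text \<open>Redrawing this iteration leaves its starting state as it is, so the bound for a frozen
  state applies under the outer integral.\<close>

lemma gr_sq_nn: "(\<integral>\<^sup>+\<omega>. ennreal ((norm (gr k t \<omega>))\<^sup>2) \<partial>Om) \<le> ennreal (L\<^sup>2)"
proof -
  interpret Om: prob_space Om by (rule prob_Om)
  have "(\<integral>\<^sup>+\<omega>. ennreal ((norm (gr k t \<omega>))\<^sup>2) \<partial>Om)
      = (\<integral>\<^sup>+\<omega>. \<integral>\<^sup>+x. ennreal ((norm (gr k t (fun_upd \<omega> (Suc k, Suc t) x)))\<^sup>2) \<partial>draw_space n Dist \<partial>Om)"
    using gr_measurable by (intro nn_integral_resample prob_space_draw index) simp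
  also have "\<dots> \<le> (\<integral>\<^sup>+\<omega>. ennreal (L\<^sup>2) \<partial>Om)"
    by (intro nn_integral_mono) (simp add: gr_def doc2s_state_upd grad_sample_sq_nn[OF c])
  also have "\<dots> = ennreal (L\<^sup>2)" using Om.emeasure_space_1 by simp
  finally show ?thesis .
qed

lemma gr_L2: "integrable Om (\<lambda>\<omega>. (norm (gr k t \<omega>))\<^sup>2)" "(\<integral>\<omega>. (norm (gr k t \<omega>))\<^sup>2 \<partial>Om) \<le> L\<^sup>2"
  using L2_bound[OF prob_Om gr_measurable gr_sq_nn] by auto

lemma ag_le: "norm (ag k t \<omega>) \<le> L"
  unfolding ag_def by (rule norm_avg_line_grad_le[OF c])

lemma bounded_sq_integrable:
  assumes V: "V \<in> borel_measurable Om" and b: "\<And>\<omega>. \<omega> \<in> space Om \<Longrightarrow> norm (V \<omega> :: 'a) \<le> b"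
  shows "integrable Om (\<lambda>\<omega>. (norm (V \<omega>))\<^sup>2)"
proof -
  interpret Om: prob_space Om by (rule prob_Om)
  have "norm ((norm (V \<omega>))\<^sup>2) \<le> b\<^sup>2" if "\<omega> \<in> space Om" for \<omega>
    using b[OF that] by (simp add: power_mono)
  then show ?thesis using V by (intro Om.integrable_const_bound[where B="b\<^sup>2"]) auto
qed

lemma ag_L2: "integrable Om (\<lambda>\<omega>. (norm (ag k t \<omega>))\<^sup>2)"
  by (rule bounded_sq_integrable[OF ag_measurable ag_le])

lemma zt_L2: "integrable Om (\<lambda>\<omega>. (norm (zt k t \<omega>))\<^sup>2)"
proof -
  have "(norm (zt k t \<omega>))\<^sup>2 = (norm (gr k t \<omega>))\<^sup>2 - 2 * inner (gr k t \<omega>) (ag k t \<omega>) + (norm (ag k t \<omega>))\<^sup>2" for \<omega>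
    unfolding zt_def power2_norm_eq_inner by (simp add: inner_diff_left inner_diff_right inner_commute)
  then show ?thesis
    using integrable_inner_L2[OF gr_measurable ag_measurable gr_L2(1) ag_L2] gr_L2(1) ag_L2 by simp
qed

text \<open>The noise is centred given all draws but its own. The index is \<open>Suc t\<close>
  because iteration \<open>t + 1\<close> starts from the state at \<open>t\<close>.\<close>

lemma zt_orthogonal:
  assumes V: "V \<in> borel_measurable Om" "integrable Om (\<lambda>\<omega>. (norm (V \<omega>))\<^sup>2)"
    and indep: "\<And>\<omega> x. V (fun_upd \<omega> (Suc k, Suc t) x) = V \<omega>"
  shows "integrable Om (\<lambda>\<omega>. inner (V \<omega>) (zt k t \<omega>))" "(\<integral>\<omega>. inner (V \<omega>) (zt k t \<omega>) \<partial>Om) = 0"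
proof -
  interpret dr: prob_space "draw_space n Dist :: ('x, 'a) draw measure" by (rule prob_space_draw)
  show i: "integrable Om (\<lambda>\<omega>. inner (V \<omega>) (zt k t \<omega>))"
    by (rule integrable_inner_L2[OF V(1) zt_measurable V(2) zt_L2])
  have "(\<integral>\<omega>. inner (V \<omega>) (zt k t \<omega>) \<partial>Om)
      = (\<integral>\<omega>. \<integral>x. inner (V (fun_upd \<omega> (Suc k, Suc t) x)) (zt k t (fun_upd \<omega> (Suc k, Suc t) x)) \<partial>draw_space n Dist \<partial>Om)"
    by (rule integral_resample[OF prob_space_draw index i])
  also have "\<dots> = (\<integral>\<omega>. \<integral>x. inner (V \<omega>) (grad_sample F c (St (Suc k) t \<omega>) x - avg_line_grad c (St (Suc k) t \<omega>)) \<partial>draw_space n Dist \<partial>Om)"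
    by (simp add: indep zt_def gr_def ag_def doc2s_state_upd)
  also have "\<dots> = (\<integral>\<omega>. 0 \<partial>Om)"
  proof (rule Bochner_Integration.integral_cong)
    fix \<omega>
    let ?S = "St (Suc k) t \<omega>"
    have "integrable (draw_space n Dist) (\<lambda>x. grad_sample F c ?S x - avg_line_grad c ?S)"
      using grad_sample_integrable[OF c] by simp
    then have "(\<integral>x. inner (V \<omega>) (grad_sample F c ?S x - avg_line_grad c ?S) \<partial>draw_space n Dist)
        = inner (V \<omega>) (\<integral>x. grad_sample F c ?S x - avg_line_grad c ?S \<partial>draw_space n Dist)" by simp
    also have "(\<integral>x. grad_sample F c ?S x - avg_line_grad c ?S \<partial>draw_space n Dist) = 0"
      using grad_sample_integrable[OF c, of ?S] grad_sample_mean[OF c, of ?S] by (simp add: dr.prob_space)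
    finally show "(\<integral>x. inner (V \<omega>) (grad_sample F c ?S x - avg_line_grad c ?S) \<partial>draw_space n Dist) = 0" by simp
  qed simp
  finally show "(\<integral>\<omega>. inner (V \<omega>) (zt k t \<omega>) \<partial>Om) = 0" by simp
qed

text \<open>Pythagoras: the noise is orthogonal to the conditional mean \<open>ag\<close>, so its
  variance is at most the second moment of the sample.\<close>

lemma zt_sq_le: "(\<integral>\<omega>. (norm (zt k t \<omega>))\<^sup>2 \<partial>Om) \<le> L\<^sup>2"
proof -
  have "ag k t (fun_upd \<omega> (Suc k, Suc t) x) = ag k t \<omega>" for \<omega> x
    by (simp add: ag_def doc2s_state_upd)
  note o = zt_orthogonal[OF ag_measurable ag_L2 this]
  have "(norm (gr k t \<omega>))\<^sup>2 = (norm (zt k t \<omega>))\<^sup>2 + 2 * inner (ag k t \<omega>) (zt k t \<omega>) + (norm (ag k t \<omega>))\<^sup>2" for \<omega>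
    unfolding zt_def power2_norm_eq_inner by (simp add: inner_diff_left inner_diff_right inner_commute algebra_simps)
  then have "(\<integral>\<omega>. (norm (gr k t \<omega>))\<^sup>2 \<partial>Om) = (\<integral>\<omega>. (norm (zt k t \<omega>))\<^sup>2 \<partial>Om) + (\<integral>\<omega>. (norm (ag k t \<omega>))\<^sup>2 \<partial>Om)"
    using zt_L2 ag_L2 o by simp
  moreover have "0 \<le> (\<integral>\<omega>. (norm (ag k t \<omega>))\<^sup>2 \<partial>Om)" by simp
  ultimately show ?thesis using gr_L2(2) by linarith
qed

lemma zt_dbar: "integrable Om (\<lambda>\<omega>. inner (zt k t \<omega>) (dbar k t \<omega>))" "(\<integral>\<omega>. inner (zt k t \<omega>) (dbar k t \<omega>) \<partial>Om) = 0"
proof -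
  have i: "integrable Om (\<lambda>\<omega>. (norm (dbar k t \<omega>))\<^sup>2)"
    using St_step(3)[OF _ k t] by (intro bounded_sq_integrable[OF dbar_measurable]) auto
  have u: "dbar k t (fun_upd \<omega> (Suc k, Suc t) x) = dbar k t \<omega>" for \<omega> x
    by (simp add: dbar_def doc2s_state_upd)
  show "integrable Om (\<lambda>\<omega>. inner (zt k t \<omega>) (dbar k t \<omega>))" "(\<integral>\<omega>. inner (zt k t \<omega>) (dbar k t \<omega>) \<partial>Om) = 0"
    using zt_orthogonal[OF dbar_measurable i u] by (simp_all add: inner_commute)
qed

end

text \<open>The noise of an iteration is orthogonal to the sum of the earlier ones, so variances add
  and the norm of the sum grows only like \<open>sqrt T\<close>.\<close>

lemma noise_sum_L2:
  "t \<le> T \<Longrightarrow> integrable Om (\<lambda>\<omega>. (norm (\<Sum>\<tau><t. zt k \<tau> \<omega>))\<^sup>2) \<and> (\<integral>\<omega>. (norm (\<Sum>\<tau><t. zt k \<tau> \<omega>))\<^sup>2 \<partial>Om) \<le> real t * L\<^sup>2"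
proof (induction t)
  case (Suc t)
  then have t: "t < T" and IH: "integrable Om (\<lambda>\<omega>. (norm (\<Sum>\<tau><t. zt k \<tau> \<omega>))\<^sup>2)"
    "(\<integral>\<omega>. (norm (\<Sum>\<tau><t. zt k \<tau> \<omega>))\<^sup>2 \<partial>Om) \<le> real t * L\<^sup>2" by auto
  have m: "(\<lambda>\<omega>. \<Sum>\<tau><t. zt k \<tau> \<omega>) \<in> borel_measurable Om"
    using t by (intro borel_measurable_sum zt_measurable) auto
  have u: "(\<Sum>\<tau><t. zt k \<tau> (fun_upd \<omega> (Suc k, Suc t) x)) = (\<Sum>\<tau><t. zt k \<tau> \<omega>)" for \<omega> x
    by (intro sum.cong refl) (simp add: zt_def gr_def ag_def doc2s_state_upd)
  note o = zt_orthogonal[OF t m IH(1) u]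
  have ex: "(norm (\<Sum>\<tau><Suc t. zt k \<tau> \<omega>))\<^sup>2 = (norm (\<Sum>\<tau><t. zt k \<tau> \<omega>))\<^sup>2
      + 2 * inner (\<Sum>\<tau><t. zt k \<tau> \<omega>) (zt k t \<omega>) + (norm (zt k t \<omega>))\<^sup>2" for \<omega>
    unfolding sum.lessThan_Suc power2_norm_eq_inner
    by (simp only: inner_add_left inner_add_right inner_commute[of "zt k t \<omega>" "\<Sum>\<tau><t. zt k \<tau> \<omega>"])
  show ?case
    unfolding ex using IH o zt_L2[OF t] zt_sq_le[OF t] by (simp add: algebra_simps)
qed simp

lemma noise_sum:
  shows "integrable Om (\<lambda>\<omega>. norm (\<Sum>t<T. zt k t \<omega>))" "(\<integral>\<omega>. norm (\<Sum>t<T. zt k t \<omega>) \<partial>Om) \<le> L * sqrt (real T)"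
proof -
  have m: "(\<lambda>\<omega>. \<Sum>t<T. zt k t \<omega>) \<in> borel_measurable Om"
    by (intro borel_measurable_sum zt_measurable) auto
  have "(\<integral>\<^sup>+\<omega>. ennreal ((norm (\<Sum>t<T. zt k t \<omega>))\<^sup>2) \<partial>Om) \<le> ennreal (real T * L\<^sup>2)"
    using noise_sum_L2[of T] by (subst nn_integral_eq_integral) (auto intro: ennreal_leI)
  from L2_bound(3)[OF prob_Om m this] have i: "integrable Om (\<lambda>\<omega>. \<Sum>t<T. zt k t \<omega>)" by simp
  then show "integrable Om (\<lambda>\<omega>. norm (\<Sum>t<T. zt k t \<omega>))" by simp
  show "(\<integral>\<omega>. norm (\<Sum>t<T. zt k t \<omega>) \<partial>Om) \<le> L * sqrt (real T)"
    using noise_sum_L2[of T] i T L_pos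
    by (intro expectation_norm_le_L2[OF prob_Om]) (auto simp: power_mult_distrib mult.commute)
qed

end

end

section \<open>Summation over the epochs\<close>

context doc2s_run
begin

text \<open>Bounds what one epoch costs in expectation beyond the decrease of the smoothed
  objective.\<close>

definition epoch_error :: real where
  "epoch_error = real T * (L * e) + 2 * D * (real T * (L * real DIM('a) * (2 * \<kappa> * (real n * (D + e)) + e) / c))
    + D * (L * sqrt (real T)) + D\<^sup>2 / (2 * \<eta>) + real T * (2 * D * e + e\<^sup>2) / \<eta> + \<eta> * (real T * L\<^sup>2)"

definition gnorm :: "nat \<Rightarrow> nat \<Rightarrow> (nat \<times> nat \<Rightarrow> ('x, 'a) draw) \<Rightarrow> real" where
  "gnorm i k \<omega> = goldstein_norm f (2 * c) (wout k i \<omega>)"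

lemma gnorm_bounds: "0 \<le> gnorm i k \<omega>" "gnorm i k \<omega> \<le> L"
  unfolding gnorm_def using c by (auto intro: f.goldstein_norm_nonneg f.goldstein_norm_le_L)

lemma gnorm_measurable: "k \<in> {1..K} \<Longrightarrow> i < n \<Longrightarrow> gnorm i k \<in> borel_measurable Om"
  unfolding gnorm_def[abs_def] using c
  by (intro measurable_compose[OF wout_measurable f.measurable_goldstein_norm]) auto

lemma gnorm_integrable:
  assumes "k \<in> {1..K}" "i < n"
  shows "integrable Om (gnorm i k)"
proof -
  interpret Om: prob_space Om by (rule prob_Om)
  show ?thesis
    using gnorm_bounds by (intro Om.integrable_const_bound[where B=L] gnorm_measurable[OF assms]) auto
qed

text \<open>The decreases of the smoothed objective telescope across epochs as well; replacing it by
  \<open>f\<close> at both ends costs \<open>L * c\<close> each, hence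
  \<open>2 * L * c\<close>.\<close>

lemma sum_expected_gnorm_le:
  assumes i: "i < n" and lower: "bdd_below (range f)"
  shows "D * real T * (\<Sum>k=1..K. \<integral>\<omega>. gnorm i k \<omega> \<partial>Om) \<le> f 0 - (INF x. f x) + 2 * L * c + real K * epoch_error"
proof -
  interpret Om: prob_space Om by (rule prob_Om)
  define c1 where "c1 = real T * (L * e) + 2 * D * (real T * (L * real DIM('a) * (2 * \<kappa> * (real n * (D + e)) + e) / c))
    + D\<^sup>2 / (2 * \<eta>) + real T * (2 * D * e + e\<^sup>2) / \<eta>"
  define W where "W k \<omega> = D * norm (\<Sum>t<T. zt k t \<omega>) - (\<Sum>t<T. inner (zt k t \<omega>) (dbar k t \<omega>))
    + \<eta> * (\<Sum>t<T. (norm (gr k t \<omega>))\<^sup>2)" for k \<omega>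
  define g0 where "g0 = f 0 - (INF x. f x) + 2 * L * c"
  have W_int: "integrable Om (W k)" if "k < K" for k
    unfolding W_def[abs_def] using that
    by (intro Bochner_Integration.integrable_add Bochner_Integration.integrable_diff integrable_mult_right
        Bochner_Integration.integrable_sum noise_sum(1) zt_dbar(1) gr_L2(1)) auto
  have W_E: "(\<integral>\<omega>. W k \<omega> \<partial>Om) \<le> D * (L * sqrt (real T)) + \<eta> * (real T * L\<^sup>2)" if k: "k < K" for k
  proof -
    have "(\<integral>\<omega>. W k \<omega> \<partial>Om) = D * (\<integral>\<omega>. norm (\<Sum>t<T. zt k t \<omega>) \<partial>Om)
        - (\<Sum>t<T. \<integral>\<omega>. inner (zt k t \<omega>) (dbar k t \<omega>) \<partial>Om) + \<eta> * (\<Sum>t<T. \<integral>\<omega>. (norm (gr k t \<omega>))\<^sup>2 \<partial>Om)"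
    proof -
      have iA: "integrable Om (\<lambda>\<omega>. D * norm (\<Sum>t<T. zt k t \<omega>))" using noise_sum(1)[OF k] by simp
      have iB: "integrable Om (\<lambda>\<omega>. \<Sum>t<T. inner (zt k t \<omega>) (dbar k t \<omega>))"
        by (intro Bochner_Integration.integrable_sum zt_dbar(1)[OF k]) auto
      have iC: "integrable Om (\<lambda>\<omega>. \<eta> * (\<Sum>t<T. (norm (gr k t \<omega>))\<^sup>2))"
        by (intro integrable_mult_right Bochner_Integration.integrable_sum gr_L2(1)[OF k]) auto
      have eB: "(\<integral>\<omega>. (\<Sum>t<T. inner (zt k t \<omega>) (dbar k t \<omega>)) \<partial>Om) = (\<Sum>t<T. \<integral>\<omega>. inner (zt k t \<omega>) (dbar k t \<omega>) \<partial>Om)"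
        by (intro Bochner_Integration.integral_sum zt_dbar(1)[OF k]) auto
      have eC: "(\<integral>\<omega>. (\<Sum>t<T. (norm (gr k t \<omega>))\<^sup>2) \<partial>Om) = (\<Sum>t<T. \<integral>\<omega>. (norm (gr k t \<omega>))\<^sup>2 \<partial>Om)"
        by (intro Bochner_Integration.integral_sum gr_L2(1)[OF k]) auto
      show ?thesis
        unfolding W_def Bochner_Integration.integral_add[OF Bochner_Integration.integrable_diff[OF iA iB] iC]
          Bochner_Integration.integral_diff[OF iA iB] integral_mult_right_zero eB eC ..
    qed
    also have "\<dots> = D * (\<integral>\<omega>. norm (\<Sum>t<T. zt k t \<omega>) \<partial>Om) + \<eta> * (\<Sum>t<T. \<integral>\<omega>. (norm (gr k t \<omega>))\<^sup>2 \<partial>Om)"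
      using zt_dbar(2)[OF k] by simp
    also have "\<dots> \<le> D * (L * sqrt (real T)) + \<eta> * (\<Sum>t<T. L\<^sup>2)"
      using D \<eta> by (intro add_mono mult_left_mono noise_sum(2)[OF k] sum_mono gr_L2(2)[OF k]) auto
    finally show ?thesis by simp
  qed
  have ae: "AE \<omega> in Om. D * real T * (\<Sum>k<K. gnorm i (Suc k) \<omega>) \<le> g0 + real K * c1 + (\<Sum>k<K. W k \<omega>)"
    using AE_good AE_space
  proof eventually_elim
    fix \<omega> assume \<omega>: "good \<omega>" "\<omega> \<in> space Om"
    let ?h = "\<lambda>k. f.smooth c (ybar k 0 \<omega>)"
    have "D * real T * gnorm i (Suc k) \<omega> \<le> (?h k - ?h (Suc k)) + (c1 + W k \<omega>)" if k: "k < K" for k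
    proof -
      have "D * real T * gnorm i (Suc k) \<omega> \<le> D * real T * ((1 / real T) * norm (\<Sum>t<T. mg k t \<omega>))"
        unfolding gnorm_def using D by (intro mult_left_mono goldstein_epoch[OF \<omega>(2,1) k i]) auto
      also have "\<dots> = D * norm (\<Sum>t<T. mg k t \<omega>)" using T by simp
      \<comment> \<open>An epoch begins where the previous one ended: the reset affects directions
        only, so \<open>ybar k T\<close> and \<open>ybar (Suc k) 0\<close> agree.\<close>
      also have "\<dots> \<le> (?h k - ?h (Suc k)) + (c1 + W k \<omega>)"
        using epoch_bound[OF \<omega>(2) k] by (simp add: ybar_def c1_def W_def)
      finally show ?thesis .
    qed
    then have "(\<Sum>k<K. D * real T * gnorm i (Suc k) \<omega>) \<le> (\<Sum>k<K. (?h k - ?h (Suc k)) + (c1 + W k \<omega>))"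
      by (intro sum_mono) auto
    also have "\<dots> = ?h 0 - ?h K + real K * c1 + (\<Sum>k<K. W k \<omega>)"
      using sum_lessThan_telescope'[of ?h K] by (simp add: sum.distrib)
    also have "\<dots> \<le> g0 + real K * c1 + (\<Sum>k<K. W k \<omega>)"
    proof -
      have "ybar 0 0 \<omega> = 0" by (simp add: ybar_def mean_def)
      then have "?h 0 \<le> f 0 + L * c" using f.smooth_close[OF c, of 0] by (simp add: abs_le_iff)
      moreover have "(INF x. f x) \<le> f (ybar K 0 \<omega>)" by (rule cINF_lower[OF lower]) simp
      moreover have "f (ybar K 0 \<omega>) - L * c \<le> ?h K" using f.smooth_close[OF c, of "ybar K 0 \<omega>"] by (simp add: abs_le_iff)
      ultimately show ?thesis by (simp add: g0_def)
    qed
    finally show "D * real T * (\<Sum>k<K. gnorm i (Suc k) \<omega>) \<le> g0 + real K * c1 + (\<Sum>k<K. W k \<omega>)"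
      by (simp add: sum_distrib_left)
  qed
  have iG: "integrable Om (\<lambda>\<omega>. \<Sum>k<K. gnorm i (Suc k) \<omega>)"
    by (intro Bochner_Integration.integrable_sum gnorm_integrable[OF _ i]) auto
  have iW: "integrable Om (\<lambda>\<omega>. \<Sum>k<K. W k \<omega>)"
    by (intro Bochner_Integration.integrable_sum W_int) auto
  have iC: "integrable Om (\<lambda>\<omega>. g0 + real K * c1 + (\<Sum>k<K. W k \<omega>))"
    by (intro Bochner_Integration.integrable_add iW Om.integrable_const)
  have "(\<integral>\<omega>. D * real T * (\<Sum>k<K. gnorm i (Suc k) \<omega>) \<partial>Om) \<le> (\<integral>\<omega>. g0 + real K * c1 + (\<Sum>k<K. W k \<omega>) \<partial>Om)"
    by (rule integral_mono_AE[OF integrable_mult_right[OF iG] iC ae])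
  also have "\<dots> = g0 + real K * c1 + (\<Sum>k<K. \<integral>\<omega>. W k \<omega> \<partial>Om)"
  proof -
    have "(\<integral>\<omega>. (\<Sum>k<K. W k \<omega>) \<partial>Om) = (\<Sum>k<K. \<integral>\<omega>. W k \<omega> \<partial>Om)"
      by (intro Bochner_Integration.integral_sum W_int) auto
    then show ?thesis
      using Bochner_Integration.integral_add[OF Om.integrable_const[of "g0 + real K * c1"] iW]
      by (simp only: Om.prob_space lebesgue_integral_const scaleR_one)
  qed
  also have "\<dots> \<le> g0 + real K * c1 + (\<Sum>k<K. D * (L * sqrt (real T)) + \<eta> * (real T * L\<^sup>2))"
    by (intro add_left_mono sum_mono W_E) auto
  also have "\<dots> = g0 + real K * epoch_error"
    by (simp add: epoch_error_def c1_def algebra_simps)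
  also have "(\<integral>\<omega>. D * real T * (\<Sum>k<K. gnorm i (Suc k) \<omega>) \<partial>Om) = D * real T * (\<Sum>k<K. \<integral>\<omega>. gnorm i (Suc k) \<omega> \<partial>Om)"
  proof -
    have "(\<integral>\<omega>. (\<Sum>k<K. gnorm i (Suc k) \<omega>) \<partial>Om) = (\<Sum>k<K. \<integral>\<omega>. gnorm i (Suc k) \<omega> \<partial>Om)"
      by (intro Bochner_Integration.integral_sum gnorm_integrable[OF _ i]) auto
    then show ?thesis by (simp only: integral_mult_right_zero)
  qed
  also have "(\<Sum>k<K. \<integral>\<omega>. gnorm i (Suc k) \<omega> \<partial>Om) = (\<Sum>k=1..K. \<integral>\<omega>. gnorm i k \<omega> \<partial>Om)"
    unfolding One_nat_def sum.atLeast1_atMost_eq ..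
  finally show ?thesis by (simp add: g0_def)
qed

section \<open>The output drawn uniformly from the epochs\<close>

abbreviation epochs :: "(nat \<Rightarrow> nat) measure" where
  "epochs \<equiv> PiM {..<n} (\<lambda>_. uniform_count_measure {1..K})"

lemma prob_space_epoch: "prob_space (uniform_count_measure {1..K})"
  using K by (intro prob_space_uniform_count_measure) auto

text \<open>The epoch index of a client is uniform and independent of the trajectory, which gives
  the plain average over the epochs.\<close>

lemma run_space_integral:
  assumes i: "i < n"
  shows "integrable (run_space n Dist K T) (\<lambda>\<omega>. gnorm i (snd \<omega> i) (fst \<omega>))"
    and "(\<integral>\<omega>. gnorm i (snd \<omega> i) (fst \<omega>) \<partial>run_space n Dist K T) = (1 / real K) * (\<Sum>k=1..K. \<integral>\<omega>. gnorm i k \<omega> \<partial>Om)"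
proof -
  have i': "i \<in> {..<n}" using i by simp
  interpret Om: prob_space Om by (rule prob_Om)
  interpret Ep: prob_space epochs by (intro prob_space_PiM prob_space_epoch)
  interpret pair_prob_space Om epochs ..
  have rs: "run_space n Dist K T = Om \<Otimes>\<^sub>M epochs" by (simp add: run_space_def)
  have comp: "(\<lambda>\<kappa>. \<kappa> i) \<in> measurable epochs (uniform_count_measure {1..K})"
    by (rule measurable_component_singleton[OF i'])
  have "(\<lambda>\<omega>. snd \<omega> i) \<in> measurable (Om \<Otimes>\<^sub>M epochs) (uniform_count_measure {1..K})"
    by (rule measurable_compose[OF measurable_snd comp])
  then have ix: "(\<lambda>\<omega>. snd \<omega> i) \<in> measurable (Om \<Otimes>\<^sub>M epochs) (count_space {1..K})"
    by (simp only: measurable_cong_sets[OF refl sets_uniform_count_measure_count_space])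
  have each: "(\<lambda>\<omega>. gnorm i k (fst \<omega>)) \<in> borel_measurable (Om \<Otimes>\<^sub>M epochs)" if "k \<in> {1..K}" for k
    by (rule measurable_compose[OF measurable_fst gnorm_measurable[OF that i]])
  have "(\<lambda>\<omega>. gnorm i (snd \<omega> i) (fst \<omega>)) \<in> borel_measurable (Om \<Otimes>\<^sub>M epochs)"
    by (rule measurable_compose_countable'[where f="\<lambda>k \<omega>. gnorm i k (fst \<omega>)" and g="\<lambda>\<omega>. snd \<omega> i" and I="{1..K}", OF each ix])
      auto
  then have int: "integrable (Om \<Otimes>\<^sub>M epochs) (\<lambda>\<omega>. gnorm i (snd \<omega> i) (fst \<omega>))"
    using gnorm_bounds by (intro P.integrable_const_bound[where B=L]) auto
  then show "integrable (run_space n Dist K T) (\<lambda>\<omega>. gnorm i (snd \<omega> i) (fst \<omega>))" by (simp only: rs)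
  have "(\<integral>\<omega>. gnorm i (snd \<omega> i) (fst \<omega>) \<partial>run_space n Dist K T) = (\<integral>\<kappa>. \<integral>\<omega>. gnorm i (\<kappa> i) \<omega> \<partial>Om \<partial>epochs)"
    using integral_snd[of "\<lambda>\<omega> \<kappa>. gnorm i (\<kappa> i) \<omega>"] int by (simp add: rs case_prod_unfold)
  also have "\<dots> = (\<integral>k. (\<integral>\<omega>. gnorm i k \<omega> \<partial>Om) \<partial>distr epochs (uniform_count_measure {1..K}) (\<lambda>\<kappa>. \<kappa> i))"
    by (rule integral_distr[symmetric, OF comp])
      (simp add: measurable_cong_sets[OF sets_uniform_count_measure_count_space refl])
  also have "\<dots> = (\<integral>k. (\<integral>\<omega>. gnorm i k \<omega> \<partial>Om) \<partial>uniform_count_measure {1..K})"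
    by (subst distr_PiM_component[OF prob_space_epoch i']) simp
  also have "\<dots> = (\<Sum>k=1..K. (1 / real K) * (\<integral>\<omega>. gnorm i k \<omega> \<partial>Om))"
    unfolding uniform_count_measure_def by (subst lebesgue_integral_point_measure_finite) auto
  finally show "(\<integral>\<omega>. gnorm i (snd \<omega> i) (fst \<omega>) \<partial>run_space n Dist K T) = (1 / real K) * (\<Sum>k=1..K. \<integral>\<omega>. gnorm i k \<omega> \<partial>Om)"
    by (simp add: sum_distrib_left)
qed

theorem outputs_stationary_run:
  assumes lower: "bdd_below (range f)"
    and le: "(f 0 - (INF x. f x) + 2 * L * c + real K * epoch_error) / (D * real T * real K) \<le> \<epsilon>"
  shows "outputs_stationary n Dist P F (2 * c) \<epsilon> c K T R \<eta> D"
  unfolding outputs_stationary_def Let_def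
proof (intro allI impI)
  fix i assume i: "i < n"
  have X: "(\<lambda>\<omega>. goldstein_norm f (2 * c) (doc2s_output n P F c T R \<eta> D \<omega> i)) = (\<lambda>\<omega>. gnorm i (snd \<omega> i) (fst \<omega>))"
    by (simp add: doc2s_output_def gnorm_def wout_def)
  have pos: "0 < D * real T" "0 < real K" using D T K by auto
  have "(1 / real K) * (\<Sum>k=1..K. \<integral>\<omega>. gnorm i k \<omega> \<partial>Om)
      = (D * real T * (\<Sum>k=1..K. \<integral>\<omega>. gnorm i k \<omega> \<partial>Om)) / (D * real T * real K)"
    using D T K by (simp add: less_imp_neq[symmetric] del: One_nat_def sum.atLeast1_atMost_eq)
  also have "\<dots> \<le> (f 0 - (INF x. f x) + 2 * L * c + real K * epoch_error) / (D * real T * real K)"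
    using pos by (intro divide_right_mono sum_expected_gnorm_le[OF i lower]) (simp add: less_imp_le)
  also note le
  finally show "integrable (run_space n Dist K T) (\<lambda>\<omega>. goldstein_norm f (2 * c) (doc2s_output n P F c T R \<eta> D \<omega> i)) \<and>
      (\<integral>\<omega>. goldstein_norm f (2 * c) (doc2s_output n P F c T R \<eta> D \<omega> i) \<partial>run_space n Dist K T) \<le> \<epsilon>"
    unfolding X using run_space_integral[OF i] by simp
qed

end

section \<open>Choice of the parameters\<close>

text \<open>The value \<open>D = \<delta> / (16 * T)\<close> makes \<open>4 * T\<close> steps of
  length \<open>2 * D\<close> fit into \<open>\<delta> / 2\<close>, and \<open>\<eta>\<close>
  balances \<open>D^2 / (2 * \<eta>)\<close> against \<open>\<eta> * T * L^2\<close>. The lower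
  bound on \<open>T\<close> brings the terms of order \<open>A / sqrt T\<close> below
  \<open>\<epsilon> / 8\<close>, the one on \<open>K\<close> the initial gap below
  \<open>\<epsilon> / 3\<close>. The upper bound on \<open>sqrt T\<close> serves the consensus error
  in the regret, which is divided by \<open>\<eta>\<close> and so grows with
  \<open>sqrt T\<close>.\<close>

lemma parameter_arithmetic:
  fixes A L g \<delta> \<epsilon> \<kappa> nn dd D \<eta> e c :: real and T K :: nat
  assumes A: "1 \<le> A" and L: "0 \<le> L" "L \<le> A" and g: "0 \<le> g" "g + L \<le> A"
    and \<epsilon>: "0 < \<epsilon>" "\<epsilon> \<le> 1" and \<delta>: "0 < \<delta>" "\<delta> \<le> 1" and nn: "1 \<le> nn" and dd: "1 \<le> dd"
    and T: "8 * A / \<epsilon> \<le> sqrt (real T)" "sqrt (real T) \<le> 9 * A / \<epsilon>" and K: "48 * A / (\<delta> * \<epsilon>) \<le> real K"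
    and D: "D = \<delta> / (16 * real T)" and \<eta>: "\<eta> = D / (A * sqrt (real T))"
    and \<kappa>: "0 \<le> \<kappa>" "\<kappa> * nn * dd \<le> \<epsilon>\<^sup>2 / (300 * A\<^sup>2)" and e: "e = \<kappa> * (nn * D)" and c: "c = \<delta> / 2"
  shows "(g + 2 * L * c + real K * (real T * (L * e) + 2 * D * (real T * (L * dd * (2 * \<kappa> * (nn * (D + e)) + e) / c))
    + D * (L * sqrt (real T)) + D\<^sup>2 / (2 * \<eta>) + real T * (2 * D * e + e\<^sup>2) / \<eta> + \<eta> * (real T * L\<^sup>2)))
    / (D * real T * real K) \<le> \<epsilon>" (is "?lhs \<le> _")
    and "(2 * real T + 2) * (D + e) + 2 * \<kappa> * (nn * (D + e)) \<le> c"
proof -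
  define r where "r = sqrt (real T)"
  \<comment> \<open>The relative consensus error: \<open>e = x * D\<close>.\<close>
  define x where "x = \<kappa> * nn"
  have r: "8 * A / \<epsilon> \<le> r" "r \<le> 9 * A / \<epsilon>" using T by (auto simp: r_def)
  have "8 \<le> 8 * A / \<epsilon>" using A \<epsilon> by (simp add: pos_le_divide_eq)
  then have r8: "8 \<le> r" using r by linarith
  have Tr: "real T = r\<^sup>2" by (simp add: r_def)
  have T1: "1 \<le> real T" using r8 unfolding Tr by (simp add: one_le_power)
  have Dpos: "0 < D" using \<delta> T1 by (simp add: D)
  have Kpos: "0 < real K" using K A \<delta> \<epsilon> by (smt (verit) divide_pos_pos mult_pos_pos)
  have x0: "0 \<le> x" using \<kappa> nn by (simp add: x_def)
  have xdd: "x * dd \<le> \<epsilon>\<^sup>2 / (300 * A\<^sup>2)" using \<kappa> by (simp add: x_def)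
  have x_le: "x \<le> x * dd" using x0 dd mult_left_mono[of 1 dd x] by simp
  have eA: "\<epsilon>\<^sup>2 / (300 * A\<^sup>2) \<le> 1 / 300"
  proof -
    have "\<epsilon>\<^sup>2 \<le> 1" "1 \<le> A\<^sup>2" using \<epsilon> A by (auto simp: power_le_one one_le_power)
    then show ?thesis by (simp add: divide_simps)
  qed
  have x1: "x * dd \<le> 1 / 300" "x \<le> 1 / 300" using xdd x_le eA by linarith+
  have ex: "e = x * D" by (simp add: e x_def)
  have De: "D + e \<le> 2 * D" using x1 x0 Dpos mult_right_mono[of x 1 D] by (simp add: ex)
  have Dc: "D \<le> c" using \<delta> T1 by (simp add: D c divide_simps)
  show "(2 * real T + 2) * (D + e) + 2 * \<kappa> * (nn * (D + e)) \<le> c"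
  proof -
    have "(2 * real T + 2) * (D + e) + 2 * \<kappa> * (nn * (D + e)) = (2 * real T + 2 + 2 * x) * (D + e)"
      by (simp add: x_def algebra_simps)
    also have "\<dots> \<le> (4 * real T) * (2 * D)"
    proof (rule mult_mono)
      have "64 \<le> real T" using r8 power_mono[of 8 r 2] by (simp add: Tr)
      then show "2 * real T + 2 + 2 * x \<le> 4 * real T" using x1 by linarith
    qed (use De x0 Dpos T1 ex in auto)
    also have "\<dots> = c" using T1 by (simp add: D c)
    finally show ?thesis .
  qed
  have \<eta>r: "\<eta> = D / (A * r)" by (simp add: \<eta> r_def)
  have nz: "D \<noteq> 0" "A \<noteq> 0" "r \<noteq> 0" "real K \<noteq> 0" "c \<noteq> 0" using Dpos A r8 Kpos \<delta> by (auto simp: c)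
  \<comment> \<open>Everything except the initial gap contains the factor \<open>D * T * K\<close>,
    which cancels.\<close>
  have split: "?lhs = (g + 2 * L * c) / (D * r\<^sup>2 * real K) + L * x + 2 * L * dd * (2 * x * (D + e) + e) / c
      + L / r + A / (2 * r) + (2 * x + x\<^sup>2) * (A * r) + L\<^sup>2 / (A * r)"
  proof -
    define b where "b = L * dd * (2 * x * (D + e) + e) / c"
    have b': "L * dd * (2 * \<kappa> * (nn * (D + e)) + e) / c = b" by (simp add: b_def x_def mult.assoc)
    have b2: "2 * L * dd * (2 * x * (D + e) + e) / c = 2 * b" by (simp add: b_def)
    have t1: "real T * (L * e) = (D * r\<^sup>2) * (L * x)" by (simp add: Tr ex)
    have t2: "2 * D * (real T * b) = (D * r\<^sup>2) * (2 * b)" by (simp add: Tr)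
    have t3: "D * (L * sqrt (real T)) = (D * r\<^sup>2) * (L / r)" using nz by (simp add: r_def[symmetric] power2_eq_square)
    have t4: "D\<^sup>2 / (2 * \<eta>) = (D * r\<^sup>2) * (A / (2 * r))" using nz by (simp add: \<eta>r power2_eq_square)
    have t5: "real T * (2 * D * e + e\<^sup>2) / \<eta> = (D * r\<^sup>2) * ((2 * x + x\<^sup>2) * (A * r))"
      using nz by (simp add: \<eta>r ex Tr power2_eq_square field_simps)
    have t6: "\<eta> * (real T * L\<^sup>2) = (D * r\<^sup>2) * (L\<^sup>2 / (A * r))"
      using nz by (simp add: \<eta>r Tr)
    have "?lhs = (g + 2 * L * c + real K * ((D * r\<^sup>2) * (L * x + 2 * b + L / r + A / (2 * r) + (2 * x + x\<^sup>2) * (A * r) + L\<^sup>2 / (A * r))))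
        / (D * r\<^sup>2 * real K)"
      unfolding b' t1 t2 t3 t4 t5 t6 by (simp only: distrib_left Tr[symmetric])
    also have "\<dots> = (g + 2 * L * c) / (D * r\<^sup>2 * real K) + (L * x + 2 * b + L / r + A / (2 * r) + (2 * x + x\<^sup>2) * (A * r) + L\<^sup>2 / (A * r))"
      using nz by (simp add: add_divide_distrib)
    finally show ?thesis unfolding b2 by simp
  qed
  have b1: "(g + 2 * L * c) / (D * r\<^sup>2 * real K) \<le> \<epsilon> / 3"
  proof -
    have DT: "D * r\<^sup>2 = \<delta> / 16" using T1 by (simp add: D Tr[symmetric])
    have "g + 2 * L * c \<le> A" using g L \<delta> mult_left_mono[of \<delta> 1 L] by (simp add: c)
    moreover have "A \<le> \<epsilon> / 3 * (D * r\<^sup>2 * real K)"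
    proof -
      have "48 * A \<le> real K * (\<delta> * \<epsilon>)" using K \<delta> \<epsilon> by (simp add: pos_divide_le_eq)
      then show ?thesis unfolding DT by (simp add: algebra_simps)
    qed
    ultimately have "g + 2 * L * c \<le> \<epsilon> / 3 * (D * r\<^sup>2 * real K)" by linarith
    then show ?thesis using Dpos r8 Kpos by (subst pos_divide_le_eq) auto
  qed
  have Ar: "A / r \<le> \<epsilon> / 8"
  proof -
    have "8 * A \<le> r * \<epsilon>" using r(1) \<epsilon> by (simp add: pos_divide_le_eq)
    then have "A \<le> \<epsilon> / 8 * r" by (simp add: mult.commute[of r])
    from mult_imp_div_pos_le[OF _ this] show ?thesis using r8 by linarith
  qed
  have b2: "L / r \<le> \<epsilon> / 8"
    using Ar divide_right_mono[OF L(2), of r] r8 by linarith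
  have "A / (2 * r) = A / r / 2" by (simp only: divide_divide_eq_left mult.commute)
  then have b3: "A / (2 * r) \<le> \<epsilon> / 16" using Ar by linarith
  have b4: "L\<^sup>2 / (A * r) \<le> \<epsilon> / 8"
  proof -
    have "L\<^sup>2 \<le> A * A" using L by (simp add: power2_eq_square mult_mono)
    then have "L\<^sup>2 / (A * r) \<le> A * A / (A * r)" using A r8 by (intro divide_right_mono) auto
    also have "\<dots> = A / r" using nz by simp
    finally show ?thesis using Ar by linarith
  qed
  have xA: "A * (x * dd) \<le> \<epsilon> / 300" "A * x * (A / \<epsilon>) \<le> \<epsilon> / 300"
  proof -
    have "A\<^sup>2 * (x * dd) \<le> A\<^sup>2 * (\<epsilon>\<^sup>2 / (300 * A\<^sup>2))" by (intro mult_left_mono xdd) auto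
    also have "\<dots> = \<epsilon>\<^sup>2 / 300" using nz by simp
    finally have sq: "A\<^sup>2 * (x * dd) \<le> \<epsilon>\<^sup>2 / 300" .
    have "A * (x * dd) \<le> A\<^sup>2 * (x * dd)"
      using A x0 dd mult_right_mono[of A "A\<^sup>2" "x * dd"] by (simp add: power2_eq_square)
    moreover have "\<epsilon>\<^sup>2 \<le> \<epsilon>" using \<epsilon> by (simp add: power2_eq_square mult_left_le)
    ultimately show "A * (x * dd) \<le> \<epsilon> / 300" using sq by linarith
    have "A\<^sup>2 * x \<le> A\<^sup>2 * (x * dd)" using x_le by (intro mult_left_mono) auto
    then have "A\<^sup>2 * x \<le> \<epsilon>\<^sup>2 / 300" using sq by linarith
    then have "A\<^sup>2 * x / \<epsilon> \<le> \<epsilon>\<^sup>2 / 300 / \<epsilon>" using \<epsilon> by (intro divide_right_mono) auto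
    then show "A * x * (A / \<epsilon>) \<le> \<epsilon> / 300" using \<epsilon> by (simp add: power2_eq_square mult.commute mult.left_commute)
  qed
  have b5: "L * x \<le> \<epsilon> / 300"
  proof -
    have "L * x \<le> A * (x * dd)" using L x0 x_le A by (intro mult_mono) auto
    then show ?thesis using xA(1) by linarith
  qed
  have b6: "2 * L * dd * (2 * x * (D + e) + e) / c \<le> 10 * (\<epsilon> / 300)"
  proof -
    have "2 * x * (D + e) + e \<le> 2 * x * (2 * D) + x * D"
      using De x0 unfolding ex by (intro add_mono mult_left_mono) auto
    then have "2 * x * (D + e) + e \<le> 5 * x * D" by (simp add: algebra_simps)
    also have "\<dots> \<le> 5 * x * c" using Dc x0 by (intro mult_left_mono) auto
    finally have "2 * L * dd * (2 * x * (D + e) + e) / c \<le> 2 * L * dd * (5 * x * c) / c"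
      using L dd Dpos Dc by (intro divide_right_mono mult_left_mono) auto
    also have "\<dots> = 10 * (L * (x * dd))" using nz by simp
    also have "\<dots> \<le> 10 * (A * (x * dd))" using L x0 dd by (intro mult_left_mono mult_right_mono) auto
    finally show ?thesis using xA(1) by linarith
  qed
  have b7: "(2 * x + x\<^sup>2) * (A * r) \<le> 27 * (\<epsilon> / 300)"
  proof -
    have "x\<^sup>2 \<le> x" using x0 x1 by (simp add: power2_eq_square mult_left_le)
    then have "(2 * x + x\<^sup>2) * (A * r) \<le> (3 * x) * (A * (9 * A / \<epsilon>))"
      using r r8 A x0 by (intro mult_mono) auto
    also have "\<dots> = 27 * (A * x * (A / \<epsilon>))" by simp
    finally show ?thesis using xA(2) by linarith
  qed
  \<comment> \<open>The bounds add up to \<open>1/3 + 5/16 + 38/300\<close> times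
    \<open>\<epsilon>\<close>.\<close>
  show "?lhs \<le> \<epsilon>"
    unfolding split using b1 b2 b3 b4 b5 b6 b7 \<epsilon> by linarith
qed

text \<open>The two summands of \<open>lf\<close> have separate tasks. The logarithm yields a factor
  \<open>1 / q^2\<close>, which swallows \<open>nn * dd\<close> and leaves
  \<open>\<epsilon>^2\<close>; the summand 1 yields \<open>exp (- 100 * A)\<close>, which is small
  against \<open>1 / A^2\<close>.\<close>

lemma contraction_small:
  fixes A \<gamma> lf \<delta> \<epsilon> nn dd R :: real
  assumes A: "1 \<le> A" and \<gamma>: "0 < \<gamma>" and \<delta>: "0 < \<delta>" "\<delta> \<le> 1" and \<epsilon>: "0 < \<epsilon>" "\<epsilon> \<le> 1" and nn: "1 \<le> nn" and dd: "1 \<le> dd"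
    and lf: "lf = 1 + ln (nn * dd / (\<delta> * \<epsilon>))" and R: "400 * A * lf \<le> sqrt \<gamma> * R"
  shows "5 * exp (- sqrt \<gamma> * R / 4) * nn * dd \<le> \<epsilon>\<^sup>2 / (300 * A\<^sup>2)"
proof -
  define q where "q = nn * dd / (\<delta> * \<epsilon>)"
  have nd: "1 \<le> nn * dd" using mult_mono[of 1 nn 1 dd] nn dd by simp
  have de: "0 < \<delta> * \<epsilon>" "\<delta> * \<epsilon> \<le> 1" using \<delta> \<epsilon> mult_mono[of \<delta> 1 \<epsilon> 1] by auto
  have q1: "1 \<le> q" unfolding q_def using nd de by (simp add: pos_le_divide_eq)
  have lnq: "0 \<le> ln q" using q1 by simp
  have "100 * A + 2 * ln q \<le> 100 * A * lf"
  proof -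
    have "2 * ln q \<le> 100 * A * ln q" using A lnq by (intro mult_right_mono) auto
    moreover have "lf = 1 + ln q" unfolding lf q_def ..
    ultimately show ?thesis by (simp add: algebra_simps)
  qed
  then have "- sqrt \<gamma> * R / 4 \<le> - (100 * A) - 2 * ln q" using R by simp
  then have "exp (- sqrt \<gamma> * R / 4) \<le> exp (- (100 * A) - 2 * ln q)" by simp
  also have "\<dots> = exp (- (100 * A)) / q\<^sup>2"
  proof -
    have "exp (2 * ln q) = q\<^sup>2" using q1 by (simp add: exp_double power2_eq_square)
    then show ?thesis by (simp add: exp_diff)
  qed
  finally have E: "exp (- sqrt \<gamma> * R / 4) \<le> exp (- (100 * A)) / q\<^sup>2" .
  \<comment> \<open>Here \<open>1500 = 5 * 300\<close>: the 5 stems from the contraction factor, the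
    300 from the target.\<close>
  have "1500 * A\<^sup>2 \<le> exp (100 * A)"
  proof -
    have "(50 * A)\<^sup>2 \<le> (exp (50 * A))\<^sup>2"
      using exp_ge_add_one_self[of "50 * A"] A by (intro power_mono) linarith+
    also have "\<dots> = exp (100 * A)" by (simp flip: exp_double)
    finally have "2500 * A\<^sup>2 \<le> exp (100 * A)" by (simp add: power_mult_distrib)
    moreover have "0 \<le> A\<^sup>2" by simp
    ultimately show ?thesis by linarith
  qed
  then have A2: "5 * exp (- (100 * A)) \<le> 1 / (300 * A\<^sup>2)"
    using A by (simp add: exp_minus divide_simps)
  have nq: "nn * dd / q\<^sup>2 \<le> \<epsilon>\<^sup>2"
  proof -
    have "nn * dd / q\<^sup>2 = (\<delta> * \<epsilon>)\<^sup>2 / (nn * dd)"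
      using nn dd de by (simp add: q_def power2_eq_square divide_simps)
    also have "\<dots> \<le> (\<delta> * \<epsilon>)\<^sup>2 / 1" using nd by (intro divide_left_mono) auto
    also have "\<dots> \<le> \<epsilon>\<^sup>2" using \<delta> \<epsilon> by (simp add: power_mult_distrib mult_left_le_one_le power_le_one)
    finally show ?thesis .
  qed
  have "5 * exp (- sqrt \<gamma> * R / 4) * nn * dd \<le> 5 * (exp (- (100 * A)) / q\<^sup>2) * nn * dd"
    using E nn dd by (intro mult_right_mono mult_left_mono) auto
  also have "\<dots> = (5 * exp (- (100 * A))) * (nn * dd / q\<^sup>2)" by simp
  also have "\<dots> \<le> (1 / (300 * A\<^sup>2)) * \<epsilon>\<^sup>2"
    using A2 nq nn dd by (intro mult_mono) auto
  finally show ?thesis by simp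
qed

lemma nat_ceiling_bounds:
  fixes x :: real
  assumes "1 \<le> x"
  obtains k :: nat where "1 \<le> k" "x \<le> real k" "real k \<le> x + 1"
proof
  show "1 \<le> nat \<lceil>x\<rceil>" "x \<le> real (nat \<lceil>x\<rceil>)" "real (nat \<lceil>x\<rceil>) \<le> x + 1"
    using assms by linarith+
qed

lemma (in stochastic_problem) exists_parameters:
  fixes \<delta> \<epsilon> :: real
  assumes \<delta>: "0 < \<delta>" "\<delta> \<le> 1" and \<epsilon>: "0 < \<epsilon>" "\<epsilon> \<le> 1" and lower: "bdd_below (range f)"
    and P: "gossip_matrix n adj P"
  shows "\<exists>K T R \<eta> D. parameter_orders (order_const L \<sigma> G (f 0 - (INF x. f x))) \<delta> \<epsilon> (spectral_gap P)
        (log_factor n DIM('a) \<delta> \<epsilon>) K T R \<eta> D \<and>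
      outputs_stationary n Dist P F \<delta> \<epsilon> (\<delta> / 2) K T R \<eta> D"
proof -
  define g where "g = f 0 - (INF x. f x)"
  \<comment> \<open>At least 1, and at least each of the quantities on which the hidden constant may
    depend.\<close>
  define A where "A = 1 + L + \<sigma> + G + g"
  define lf where "lf = log_factor n DIM('a) \<delta> \<epsilon>"
  define \<gamma> where "\<gamma> = spectral_gap P"
  have sG: "0 \<le> \<sigma>" "0 \<le> G" using A3 by (auto simp: stochastic_gradient_oracle_def)
  have g0: "0 \<le> g" unfolding g_def using cINF_lower[OF lower, of 0] by simp
  have A: "1 \<le> A" "L \<le> A" "g + L \<le> A" using sG g0 L_pos by (auto simp: A_def)
  have \<gamma>: "0 < \<gamma>" "\<gamma> \<le> 1" using gossip_matrixD(6,7)[OF P] by (auto simp: \<gamma>_def)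
  have nn: "1 \<le> real n" using n by simp
  have dd: "1 \<le> real DIM('a)" by (simp add: Suc_leI)
  have q1: "1 \<le> real n * real DIM('a) / (\<delta> * \<epsilon>)"
  proof -
    have "\<delta> * \<epsilon> \<le> 1 * 1" using \<delta> \<epsilon> by (intro mult_mono) auto
    also have "1 * 1 \<le> real n * real DIM('a)" using nn dd by (intro mult_mono) auto
    finally show ?thesis using \<delta> \<epsilon> by (simp add: pos_le_divide_eq)
  qed
  have lf1: "1 \<le> lf" using q1 by (simp add: lf_def log_factor_def)
  have de: "\<delta> * \<epsilon> \<le> 1" "0 < \<delta> * \<epsilon>" using \<delta> \<epsilon> mult_mono[of \<delta> 1 \<epsilon> 1] by auto
  have Ae: "1 \<le> A / \<epsilon>" using A \<epsilon> by (simp add: pos_le_divide_eq)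
  have "1 \<le> (8 * A / \<epsilon>)\<^sup>2" using Ae by (intro one_le_power) simp
  from nat_ceiling_bounds[OF this] obtain T :: nat where T: "1 \<le> T" "(8 * A / \<epsilon>)\<^sup>2 \<le> real T" "real T \<le> (8 * A / \<epsilon>)\<^sup>2 + 1" by blast
  have "1 \<le> 48 * A / (\<delta> * \<epsilon>)" using A de by (simp add: pos_le_divide_eq)
  from nat_ceiling_bounds[OF this] obtain K :: nat where K: "1 \<le> K" "48 * A / (\<delta> * \<epsilon>) \<le> real K" "real K \<le> 48 * A / (\<delta> * \<epsilon>) + 1" by blast
  have s\<gamma>: "0 < sqrt \<gamma>" "sqrt \<gamma> \<le> 1" using \<gamma> by auto
  have Alf: "1 \<le> A * lf" using A lf1 mult_mono[of 1 A 1 lf] by simp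
  have "sqrt \<gamma> \<le> 400 * A * lf" using Alf s\<gamma>(2) by linarith
  then have R1: "1 \<le> 400 * A * lf / sqrt \<gamma>" using s\<gamma>(1) by (simp only: pos_le_divide_eq mult_1_left)
  from nat_ceiling_bounds[OF this] obtain R :: nat where R: "1 \<le> R" "400 * A * lf / sqrt \<gamma> \<le> real R" "real R \<le> 400 * A * lf / sqrt \<gamma> + 1" by blast
  define \<kappa> where "\<kappa> = 5 * exp (- sqrt \<gamma> * real R / 4)"
  define D where "D = \<delta> / (16 * real T)"
  define \<eta> where "\<eta> = D / (A * sqrt (real T))"
  define e where "e = \<kappa> * (real n * D)"
  have sT: "8 * A / \<epsilon> \<le> sqrt (real T)" "sqrt (real T) \<le> 9 * A / \<epsilon>"
  proof -
    show "8 * A / \<epsilon> \<le> sqrt (real T)" using T(2) by (rule real_le_rsqrt)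
    \<comment> \<open>Rounding \<open>T\<close> up is absorbed between 8 and 9, as
      \<open>A / \<epsilon>\<close> is at least 1.\<close>
    have "(8 * A / \<epsilon>)\<^sup>2 + 1 \<le> (9 * A / \<epsilon>)\<^sup>2"
    proof -
      have "1 \<le> (A / \<epsilon>)\<^sup>2" using Ae by (intro one_le_power) simp
      moreover have "(8 * A / \<epsilon>)\<^sup>2 = 64 * (A / \<epsilon>)\<^sup>2" "(9 * A / \<epsilon>)\<^sup>2 = 81 * (A / \<epsilon>)\<^sup>2"
        by (simp_all add: power_mult_distrib power_divide)
      ultimately show ?thesis by linarith
    qed
    then have "real T \<le> (9 * A / \<epsilon>)\<^sup>2" using T(3) by linarith
    then have "sqrt (real T) \<le> sqrt ((9 * A / \<epsilon>)\<^sup>2)" by (rule real_sqrt_le_mono)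
    then show "sqrt (real T) \<le> 9 * A / \<epsilon>" using A \<epsilon> by simp
  qed
  have \<kappa>0: "0 \<le> \<kappa>" by (simp add: \<kappa>_def)
  have "400 * A * lf \<le> sqrt \<gamma> * real R"
    using R(2) s\<gamma> by (simp add: pos_divide_le_eq mult.commute)
  from contraction_small[OF A(1) \<gamma>(1) \<delta> \<epsilon> nn dd _ this]
  have \<kappa>: "\<kappa> * real n * real DIM('a) \<le> \<epsilon>\<^sup>2 / (300 * A\<^sup>2)"
    by (simp add: \<kappa>_def lf_def log_factor_def)
  note arith = parameter_arithmetic[OF A(1) less_imp_le[OF L_pos] A(2) g0 A(3) \<epsilon> \<delta> nn dd sT K(2) D_def \<eta>_def \<kappa>0 \<kappa> e_def refl]
  have \<kappa>half: "\<kappa> \<le> 1 / 2"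
  proof -
    have "\<kappa> * 1 \<le> \<kappa> * (real n * real DIM('a))"
      using \<kappa>0 nn dd mult_mono[of 1 "real n" 1 "real DIM('a)"] by (intro mult_left_mono) auto
    also have "\<dots> \<le> \<epsilon>\<^sup>2 / (300 * A\<^sup>2)" using \<kappa> by (simp add: mult.assoc)
    also have "\<dots> \<le> 1 / 2"
    proof -
      have "\<epsilon>\<^sup>2 \<le> 1" "1 \<le> A\<^sup>2" using \<epsilon> A by (auto simp: power_le_one one_le_power)
      then show ?thesis by (simp add: divide_simps)
    qed
    finally show ?thesis by simp
  qed
  have Dpos: "0 < D" using \<delta> T by (simp add: D_def)
  have \<eta>pos: "0 < \<eta>" using Dpos A T by (simp add: \<eta>_def)
  interpret run: doc2s_run n Dist F Lip L \<sigma> G adj P "\<delta> / 2" D \<eta> \<kappa> e K T R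
    using P \<delta> Dpos \<eta>pos \<kappa>half T K arith(2)
    by unfold_locales (auto simp: \<kappa>_def \<gamma>_def e_def)
  have stat: "outputs_stationary n Dist P F \<delta> \<epsilon> (\<delta> / 2) K T R \<eta> D"
    using run.outputs_stationary_run[OF lower, of \<epsilon>] arith(1)
    unfolding run.epoch_error_def g_def by simp
  define C where "C = order_const L \<sigma> G g"
  \<comment> \<open>The fourth power dominates \<open>A\<close>, \<open>A^2\<close> and 1, the
    powers that occur in the bounds below; the numerical factors there, at most 401, are far below
    the one here.\<close>
  have C: "C = 1000000 * A ^ 4" by (simp add: C_def order_const_def A_def)
  have A4: "A \<le> A ^ 4" "A\<^sup>2 \<le> A ^ 4" "1 \<le> A ^ 4"
    using A(1) power_increasing[of 1 4 A] power_increasing[of 2 4 A] by (auto simp: one_le_power)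
  have "parameter_orders C \<delta> \<epsilon> \<gamma> lf K T R \<eta> D"
    unfolding parameter_orders_def
  proof (intro conjI)
    show "real K \<le> C / (\<delta> * \<epsilon>)"
    proof -
      have "real K \<le> (48 * A + 1) / (\<delta> * \<epsilon>)"
        using K(3) de by (simp add: add_divide_distrib) (smt (verit) le_divide_eq_1_pos)
      also have "\<dots> \<le> C / (\<delta> * \<epsilon>)" using de A4 unfolding C by (intro divide_right_mono less_imp_le[OF de(2)]) linarith
      finally show ?thesis .
    qed
    show "real T \<le> C / \<epsilon>\<^sup>2"
    proof -
      have "sqrt (real T) * sqrt (real T) \<le> (9 * A / \<epsilon>) * (9 * A / \<epsilon>)" using sT A \<epsilon> by (intro mult_mono) auto
      then have "real T \<le> 81 * A\<^sup>2 / \<epsilon>\<^sup>2" by (simp add: power2_eq_square)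
      also have "\<dots> \<le> C / \<epsilon>\<^sup>2" using A4 unfolding C by (intro divide_right_mono) auto
      finally show ?thesis .
    qed
    show "real R \<le> C * \<gamma> powr (- 1 / 2) * lf"
    proof -
      have pw: "\<gamma> powr (- 1 / 2) = 1 / sqrt \<gamma>"
        using \<gamma> by (simp add: powr_minus_divide powr_half_sqrt[symmetric])
      have "sqrt \<gamma> \<le> A * lf" using Alf s\<gamma>(2) by linarith
      then have "1 \<le> A * lf / sqrt \<gamma>" using s\<gamma>(1) by (simp only: pos_le_divide_eq mult_1_left)
      then have "real R \<le> 401 * (A * lf / sqrt \<gamma>)" using R(3) by simp
      also have "\<dots> \<le> C * (lf / sqrt \<gamma>)"
        using A4(1,3) lf1 s\<gamma> mult_right_mono[of "401 * A" C "lf / sqrt \<gamma>"] unfolding C by simp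
      finally show ?thesis unfolding pw by simp
    qed
    have T64: "64 * A\<^sup>2 / \<epsilon>\<^sup>2 \<le> real T" using T(2) by (simp add: power_mult_distrib power_divide)
    have D_le: "D \<le> \<delta> * \<epsilon>\<^sup>2"
    proof -
      have "1 \<le> 64 * A\<^sup>2" using one_le_power[OF A(1), of 2] by linarith
      then have "1 / \<epsilon>\<^sup>2 \<le> 64 * A\<^sup>2 / \<epsilon>\<^sup>2" by (intro divide_right_mono) auto
      then have "1 / \<epsilon>\<^sup>2 \<le> 16 * real T" using T64 by simp
      then have "\<delta> * (1 / \<epsilon>\<^sup>2) \<le> \<delta> * (16 * real T)" using \<delta> by (intro mult_left_mono) auto
      then show ?thesis using \<epsilon> T by (simp add: D_def divide_simps mult_ac)
    qed
    have C1: "1 \<le> C" using A4(3) by (simp add: C)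
    show "D \<le> C * \<delta> * \<epsilon>\<^sup>2"
    proof -
      have "1 * (\<delta> * \<epsilon>\<^sup>2) \<le> C * (\<delta> * \<epsilon>\<^sup>2)" using C1 \<delta> \<epsilon> by (intro mult_right_mono) auto
      then show ?thesis using D_le by simp
    qed
    show "\<eta> \<le> C * \<delta> * \<epsilon> ^ 3"
    proof -
      have r: "1 / \<epsilon> \<le> A * sqrt (real T)"
      proof -
        have "1 / \<epsilon> \<le> 8 * A / \<epsilon>" using A \<epsilon> by (intro divide_right_mono) auto
        also have "\<dots> \<le> 1 * sqrt (real T)" using sT by simp
        also have "\<dots> \<le> A * sqrt (real T)" using A by (intro mult_right_mono) auto
        finally show ?thesis .
      qed
      have "\<eta> \<le> D / (1 / \<epsilon>)" unfolding \<eta>_def using r Dpos \<epsilon> A T by (intro divide_left_mono) auto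
      also have "\<dots> = D * \<epsilon>" by simp
      also have "\<dots> \<le> \<delta> * \<epsilon>\<^sup>2 * \<epsilon>" using D_le \<epsilon> by (intro mult_right_mono) auto
      also have "\<dots> = 1 * (\<delta> * \<epsilon> ^ 3)" by (simp add: power3_eq_cube power2_eq_square)
      also have "\<dots> \<le> C * (\<delta> * \<epsilon> ^ 3)" using C1 \<delta> \<epsilon> by (intro mult_right_mono) auto
      finally show ?thesis by simp
    qed
  qed (use K T R \<eta>pos Dpos in auto)
  then show ?thesis using stat unfolding C_def g_def lf_def \<gamma>_def by blast
qed

section \<open>Costs of a run\<close>

lemma doc2s_state_costs:
  fixes F :: "nat \<Rightarrow> 'a::euclidean_space \<Rightarrow> 'x \<Rightarrow> real" and \<rho> :: "nat \<times> nat \<Rightarrow> ('x, 'a) draw"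
    and c \<eta> D :: real and n T R K :: nat and P :: "real mat"
  assumes P: "gossip_matrix n adj P" "2 \<le> n"
    and it: "\<And>k t. k \<in> {1..K} \<Longrightarrow> t \<in> {1..T} \<Longrightarrow> fst (\<rho> (k, t)) < n"
  defines "S \<equiv> doc2s_state n P F c T R \<eta> D \<rho>"
  shows "k \<le> K \<Longrightarrow> (\<Sum>i<n. oracle_calls (S k T) i) = k * T \<and> comp_rounds (S k T) = k * T
    \<and> comm_rounds (S k T) = 2 * R * (k * T)"
proof (induction k)
  case 0
  show ?case by (simp add: S_def)
next
  case (Suc k)
  have "t \<le> T \<Longrightarrow> (\<Sum>i<n. oracle_calls (S (Suc k) t) i) = k * T + t \<and> comp_rounds (S (Suc k) t) = k * T + t
    \<and> comm_rounds (S (Suc k) t) = 2 * R * (k * T + t)" for t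
  proof (induction t)
    case 0
    show ?case using Suc by (simp add: S_def)
  next
    case (Suc t)
    let ?\<rho> = "\<rho> (Suc k, Suc t)"
    have i: "fst ?\<rho> < n" using Suc.prems \<open>Suc k \<le> K\<close> by (intro it) auto
    have "(\<Sum>i<n. ((oracle_calls (S (Suc k) t))(fst ?\<rho> := oracle_calls (S (Suc k) t) (fst ?\<rho>) + 1)) i)
        = (\<Sum>i<n. oracle_calls (S (Suc k) t) i + (if i = fst ?\<rho> then 1 else 0))"
      by (intro sum.cong) auto
    also have "\<dots> = (\<Sum>i<n. oracle_calls (S (Suc k) t) i) + 1" using i by (simp add: sum.distrib)
    finally have o: "(\<Sum>i<n. ((oracle_calls (S (Suc k) t))(fst ?\<rho> := oracle_calls (S (Suc k) t) (fst ?\<rho>) + 1)) i)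
        = (\<Sum>i<n. oracle_calls (S (Suc k) t) i) + 1" .
    \<comment> \<open>Each iteration calls gossip twice, for the positions and for the
      directions.\<close>
    have m: "comm_rounds (doc2s_step n P F c R \<eta> D ?\<rho> X) = comm_rounds X + 2 * R" for X
      by (simp add: doc2s_step_def Let_def case_prod_unfold snd_fast_gossip[OF P])
    show ?case
      using Suc o by (simp add: S_def doc2s_step_fields m algebra_simps)
  qed
  from this[of T] show ?case by (simp add: algebra_simps)
qed

text \<open>The cost bounds hold on every sample path and for any parameters of the stated orders:
  \<open>c^2\<close> is the product of the constants in \<open>K\<close> and \<open>T\<close>, and
  \<open>2 * c^3\<close> further contains that of \<open>R\<close> and the two gossip calls of each
  iteration.\<close>

theorem corollary2:
  fixes n :: nat
    and Dist :: "nat \<Rightarrow> 'x measure"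
    and F :: "nat \<Rightarrow> 'a::euclidean_space \<Rightarrow> 'x \<Rightarrow> real"
    and Lip :: "nat \<Rightarrow> 'x \<Rightarrow> real"
    and adj :: "nat \<Rightarrow> nat \<Rightarrow> bool"
    and P :: "real mat"
    and L \<sigma> G \<delta> \<epsilon> :: real
  defines "f \<equiv> global_obj n Dist F"
    and "\<gamma> \<equiv> spectral_gap P"
    and "lf \<equiv> log_factor n DIM('a) \<delta> \<epsilon>"
  assumes n: "n \<ge> 2"
    and accuracies: "0 < \<delta>" "\<delta> \<le> 1" "0 < \<epsilon>" "\<epsilon> \<le> 1"
    and problem: "well_posed n Dist F"
    and A1: "stochastic_Lipschitz n Dist F Lip L"
    and A2: "bdd_below (range f)"
    and A3: "stochastic_gradient_oracle n Dist F \<sigma> G"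
    and A5: "gossip_matrix n adj P"
  shows
    "(\<exists>K T R \<eta> D. parameter_orders (order_const L \<sigma> G (f 0 - (INF x. f x))) \<delta> \<epsilon> \<gamma> lf K T R \<eta> D \<and>
        outputs_stationary n Dist P F \<delta> \<epsilon> (\<delta> / 2) K T R \<eta> D)
     \<and>
     (\<forall>c K T R \<eta> D. parameter_orders c \<delta> \<epsilon> \<gamma> lf K T R \<eta> D \<longrightarrow>
        outputs_stationary n Dist P F \<delta> \<epsilon> (\<delta> / 2) K T R \<eta> D \<longrightarrow>
        (\<forall>\<omega> \<in> space (run_space n Dist K T :: ((nat \<times> nat \<Rightarrow> ('x, 'a) draw) \<times> (nat \<Rightarrow> nat)) measure).
           let S = doc2s_state n P F (\<delta> / 2) T R \<eta> D (fst \<omega>) K T in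
           real (\<Sum>i<n. oracle_calls S i) \<le> c^2 / (\<delta> * \<epsilon>^3) \<and>
           real (comp_rounds S) \<le> c^2 / (\<delta> * \<epsilon>^3) \<and>
           real (comm_rounds S) \<le> 2 * c^3 * \<gamma> powr (-1/2) * lf / (\<delta> * \<epsilon>^3)))"
proof (intro conjI allI impI ballI)
  interpret stochastic_problem n Dist F Lip L \<sigma> G
    using n problem A1 A3 by unfold_locales
  show "\<exists>K T R \<eta> D. parameter_orders (order_const L \<sigma> G (f 0 - (INF x. f x))) \<delta> \<epsilon> \<gamma> lf K T R \<eta> D \<and>
        outputs_stationary n Dist P F \<delta> \<epsilon> (\<delta> / 2) K T R \<eta> D"
    using exists_parameters[OF accuracies _ A5] A2 unfolding f_def \<gamma>_def lf_def by blast
next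
  fix c :: real and K T R :: nat and \<eta> D :: real
    and \<omega> :: "(nat \<times> nat \<Rightarrow> ('x, 'a) draw) \<times> (nat \<Rightarrow> nat)"
  assume "parameter_orders c \<delta> \<epsilon> \<gamma> lf K T R \<eta> D"
  then have K: "1 \<le> K" "real K \<le> c / (\<delta> * \<epsilon>)" and T: "real T \<le> c / \<epsilon>\<^sup>2" and R: "real R \<le> c * \<gamma> powr (-1/2) * lf"
    by (auto simp: parameter_orders_def)
  assume \<omega>: "\<omega> \<in> space (run_space n Dist K T)"
  have it: "fst (fst \<omega> (k, t)) < n" if "k \<in> {1..K}" "t \<in> {1..T}" for k t
  proof -
    have "fst \<omega> (k, t) \<in> space (draw_space n Dist :: ('x, 'a) draw measure)"
      using \<omega> that by (auto simp: run_space_def space_pair_measure space_PiM PiE_iff)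
    then show ?thesis by (auto simp: draw_space_def space_pair_measure space_uniform_count_measure)
  qed
  let ?S = "doc2s_state n P F (\<delta> / 2) T R \<eta> D (fst \<omega>) K T"
  have costs: "(\<Sum>i<n. oracle_calls ?S i) = K * T \<and> comp_rounds ?S = K * T \<and> comm_rounds ?S = 2 * R * (K * T)"
    by (rule doc2s_state_costs[where \<rho>="fst \<omega>" and K=K, OF A5 n]) (auto intro: it)
  have "real K * real T \<le> c / (\<delta> * \<epsilon>) * (c / \<epsilon>\<^sup>2)"
    using K T by (intro mult_mono) (auto intro: order.trans[OF of_nat_0_le_iff])
  also have "\<dots> = c\<^sup>2 / (\<delta> * \<epsilon> ^ 3)" by (simp add: power2_eq_square power3_eq_cube)
  finally have KT: "real K * real T \<le> c\<^sup>2 / (\<delta> * \<epsilon> ^ 3)" .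
  have "real (2 * R * (K * T)) = 2 * (real R * (real K * real T))" by simp
  also have "\<dots> \<le> 2 * ((c * \<gamma> powr (-1/2) * lf) * (c\<^sup>2 / (\<delta> * \<epsilon> ^ 3)))"
    using R KT by (intro mult_left_mono mult_mono) (auto intro: order.trans[OF of_nat_0_le_iff])
  also have "\<dots> = 2 * c ^ 3 * \<gamma> powr (-1/2) * lf / (\<delta> * \<epsilon> ^ 3)"
    by (simp add: power2_eq_square power3_eq_cube)
  finally have KTR: "real (2 * R * (K * T)) \<le> 2 * c ^ 3 * \<gamma> powr (-1/2) * lf / (\<delta> * \<epsilon> ^ 3)" .
  show "let S = doc2s_state n P F (\<delta> / 2) T R \<eta> D (fst \<omega>) K T in
           real (\<Sum>i<n. oracle_calls S i) \<le> c^2 / (\<delta> * \<epsilon>^3) \<and>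
           real (comp_rounds S) \<le> c^2 / (\<delta> * \<epsilon>^3) \<and>
           real (comm_rounds S) \<le> 2 * c^3 * \<gamma> powr (-1/2) * lf / (\<delta> * \<epsilon>^3)"
    using costs KT KTR unfolding Let_def by simp
qed

end
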